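(* Let $\mathcal P$ be a finite chiral polytope of odd rank $n$ of type $\{p_1, \ldots, p_{n-1}\}$. Suppose $\gcd(p_i, p_{n-i}) = 1$ for $i = 1, \ldots, n-1$, and suppose that $|\Gamma^+(\mathcal P) \mathbin{\square} \Gamma^+(\overline{\mathcal P})| < \mathrm{lcm}(p_1, \ldots, p_{n-1})$. Then $\mathcal P \diamond \mathcal P^{\delta}$ is a properly self-dual chiral polytope of type $\{p_1 p_{n-1}, p_2 p_{n-2}, \ldots, p_{n-1} p_1\}$, and with group $\Gamma^+(\mathcal P) \times \Gamma^+(\mathcal P^{\delta})$.
   Context: An abstract polytope of rank $n$ (an $n$-polytope) is a ranked poset of faces with ranks from $-1$ to $n$, with a unique least face (rank $-1$) and a unique greatest face (rank $n$), in which every flag (maximal chain) has $n+2$ faces, which satisfies the diamond condition (whenever $F<G$ with ranks $j-1$ and $j+1$ there are exactly two $j$-faces strictly between them), and which is strongly flag-connected (any two flags $\Phi,\Psi$ are joined by a sequence of flags, consecutive ones adjacent, all containing $\Phi\cap\Psi$; two flags are adjacent if they differ in exactly one face). $\Phi^j$ denotes the unique flag differing from $\Phi$ only in its $j$-face, and $\Phi^{i,j}=(\Phi^i)^j$. Each polytope considered has a fixed base flag $\Phi$. $\mathcal P$ is regular if its automorphism group $\Gamma(\mathcal P)$ is transitive on flags; then $\Gamma(\mathcal P)$ is generated by $\rho_0,\dots,\rho_{n-1}$, where $\rho_i$ maps $\Phi$ to $\Phi^i$. Put $\sigma_i=\rho_{i-1}\rho_i$ and $\Gamma^+(\mathcal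 P)=\langle\sigma_1,\dots,\sigma_{n-1}\rangle$; $\mathcal P$ is directly regular if it is regular and $\Gamma^+(\mathcal P)$ has index $2$ in $\Gamma(\mathcal P)$. $\mathcal P$ is chiral if $\Gamma(\mathcal P)$ has exactly two orbits on flags and adjacent flags lie in distinct orbits; then $\Gamma^+(\mathcal P):=\Gamma(\mathcal P)$ is generated by $\sigma_1,\dots,\sigma_{n-1}$, where $\sigma_i$ maps $\Phi$ to $\Phi^{i,i-1}$. In both cases $(\sigma_i\cdots\sigma_j)^2=1$ for $i<j$, and the type of $\mathcal P$ is $\{p_1,\dots,p_{n-1}\}$ where $p_i$ is the order of $\sigma_i$. Let $W^+=\langle \sigma_1,\dots,\sigma_{n-1}\mid (\sigma_i\cdots\sigma_j)^2=1 \text{ for } 1\le i<j\le n-1\rangle$. Writing $\Gamma^+(\mathcal P)=W^+/M$ means that $M$ is the kernel of the epimorphism $W^+\to\Gamma^+(\mathcal P)$ preserving the specified generators. For $w\in W^+$, $\overline w$ is obtained by replacing $\sigma_1$ by $\sigma_1^{-1}$, $\sigma_2$ by $\sigma_1^2\sigma_2$ and fixing $\sigma_j$ for $j\ge3$; $\delta(w)$ is obtained by replacing each $\sigma_i$ by $\sigma_{n-i}^{-1}$ (both are automorphisms of $W^+$). Put $\overline M=\{\overline w:w\in M\}$, $\delta(M)=\{\delta(w):w\in M\}$. If $\Gamma^+(\mathcal P)=W^+/M$, then $\mathcal P$ is directly regular if $\overline M=M$ and chiral otherwise; the mirror image $\overline{\mathcal P}$ of a chiral $\mathcal P$ (same faces,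 base flag $\Phi^0$) has $\Gamma^+(\overline{\mathcal P})=W^+/\overline M$; the dual $\mathcal P^\delta$ (reversed order) has $\Gamma^+(\mathcal P^\delta)=W^+/\delta(M)$; $\mathcal P$ is properly self-dual if it has a duality (order-reversing bijection onto itself) fixing the base flag, equivalently $\delta(M)=M$. Intersection property: for a group $G$ with specified generators $\sigma_1,\dots,\sigma_{n-1}$, put $\tau_{i,j}=\sigma_i\cdots\sigma_j$ and, for $I\subseteq\{0,\dots,n-1\}$, $G_I=\langle\tau_{i,j}\mid 1\le i\le j\le n-1,\ i-1,j\in I\rangle$; $G$ has the intersection property if $G_I\cap G_J=G_{I\cap J}$ for all $I,J$. Known facts: rotation groups of chiral or directly regular polytopes have it; conversely a quotient of $W^+$ with the intersection property is the rotation group of a chiral or directly regular $n$-polytope. Mix and comix: for groups with specified generators $\Gamma=\langle x_1,\dots,x_k\mid R\rangle$, $\Gamma'=\langle x_1',\dots,x_k'\mid S\rangle$, the mix $\Gamma\diamond\Gamma'$ is the subgroup of $\Gamma\times\Gamma'$ with specified generators $(x_i,x_i')$, $i=1,\dots,k$, and the comix $\Gamma\mathbin{\square}\Gamma'$ is the group $\langle x_1,x_1',\dots,x_k,x_k'\mid R,S,x_1^{-1}x_1',\dots,x_k^{-1}x_k'\rangle$. $\mathcal P\diamond\mathcal Q$ is the flag-connected pre-polytope (polytope axioms with strong flag-connectedness weakened to flag-connectedness) built from $\Gamma^+(\mathcal P)\diamond\Gamma^+(\mathcal Q)=\Gamma^+(\mathcal P\diamond\mathcal Q)$; it is a polytope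 if and only if this group has the intersection property, and is then the chiral or directly regular $n$-polytope with this rotation group. *)

theory Defs
  imports "HOL-Algebra.Bij" "HOL-Algebra.Multiplicative_Group"
begin

section \<open>Polytopes with a base flag\<close>

record 'a ranked_poset =
  faces :: "'a set"
  le :: "'a rel"
  rank :: "'a \<Rightarrow> int"
  base_flag :: "'a set"

definition flags :: "('a, 'm) ranked_poset_scheme \<Rightarrow> 'a set set" where
  "flags P = {C. C \<subseteq> faces P \<and> C \<in> Chains (le P) \<and>
                 (\<forall>D. D \<subseteq> faces P \<and> D \<in> Chains (le P) \<and> C \<subseteq> D \<longrightarrow> D = C)}"

definition adjacent :: "'a set \<Rightarrow> 'a set \<Rightarrow> bool" where
  "adjacent X Y \<longleftrightarrow> card (X - Y) = 1 \<and> card (Y - X) = 1"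

definition strongly_flag_connected :: "('a, 'm) ranked_poset_scheme \<Rightarrow> bool" where
  "strongly_flag_connected P \<longleftrightarrow>
     (\<forall>\<Phi>\<in>flags P. \<forall>\<Psi>\<in>flags P.
        (\<Phi>, \<Psi>) \<in> {(X, Y). X \<in> flags P \<and> Y \<in> flags P \<and> adjacent X Y \<and>
                         \<Phi> \<inter> \<Psi> \<subseteq> X \<and> \<Phi> \<inter> \<Psi> \<subseteq> Y}\<^sup>*)"

text \<open>Since the rank function is strictly monotone with values in $\{-1,\dots,n\}$ and flags
  have $n+2$ elements, each flag contains exactly one face of every rank.\<close>

definition abstract_polytope :: "nat \<Rightarrow> ('a, 'm) ranked_poset_scheme \<Rightarrow> bool" where
  "abstract_polytope n P \<longleftrightarrow>
     partial_order_on (faces P) (le P) \<and>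
     (\<forall>F\<in>faces P. - 1 \<le> rank P F \<and> rank P F \<le> int n) \<and>
     (\<forall>F G. (F, G) \<in> le P \<and> F \<noteq> G \<longrightarrow> rank P F < rank P G) \<and>
     (\<exists>F\<in>faces P. rank P F = - 1 \<and> (\<forall>G\<in>faces P. (F, G) \<in> le P)) \<and>
     (\<exists>F\<in>faces P. rank P F = int n \<and> (\<forall>G\<in>faces P. (G, F) \<in> le P)) \<and>
     (\<forall>\<Phi>\<in>flags P. card \<Phi> = n + 2) \<and>
     (\<forall>F G j. (F, G) \<in> le P \<and> rank P F = j - 1 \<and> rank P G = j + 1 \<longrightarrow>
        card {H \<in> faces P. rank P H = j \<and> (F, H) \<in> le P \<and> (H, G) \<in> le P} = 2) \<and>
     strongly_flag_connected P \<and>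
     base_flag P \<in> flags P"

text \<open>\<open>flag_adj P j \<Phi>\<close> is the flag $\Phi^j$; so
  \<open>flag_adj P j (flag_adj P i \<Phi>)\<close> is $\Phi^{i,j} = (\Phi^i)^j$.\<close>

definition flag_adj :: "('a, 'm) ranked_poset_scheme \<Rightarrow> int \<Rightarrow> 'a set \<Rightarrow> 'a set" where
  "flag_adj P j \<Phi> = (THE \<Psi>. \<Psi> \<in> flags P \<and> \<Psi> \<noteq> \<Phi> \<and>
                        {F \<in> \<Psi>. rank P F \<noteq> j} = {F \<in> \<Phi>. rank P F \<noteq> j})"

text \<open>Automorphisms act on the right: in the product \<open>f \<otimes> g\<close> the map \<open>f\<close> is applied first
  (the opposite of \<^const>\<open>BijGroup\<close>). With the $\sigma_i$ defined below, this is the convention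
  for which $\sigma_i = \rho_{i-1}\rho_i$ and $(\sigma_i\cdots\sigma_j)^2 = 1$ for $i<j$.\<close>

definition automorphism_group :: "('a, 'm) ranked_poset_scheme \<Rightarrow> ('a \<Rightarrow> 'a) monoid" where
  "automorphism_group P =
     \<lparr>carrier = {f \<in> Bij (faces P). \<forall>F\<in>faces P. \<forall>G\<in>faces P. (F, G) \<in> le P \<longleftrightarrow> (f F, f G) \<in> le P},
      mult = (\<lambda>f g. compose (faces P) g f),
      one = (\<lambda>F\<in>faces P. F)\<rparr>"

definition flag_orbit_rel :: "('a, 'm) ranked_poset_scheme \<Rightarrow> 'a set rel" where
  "flag_orbit_rel P = {(\<Phi>, \<Psi>). \<Phi> \<in> flags P \<and> \<Psi> \<in> flags P \<and>
                          (\<exists>f\<in>carrier (automorphism_group P). f ` \<Phi> = \<Psi>)}"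

definition chiral :: "nat \<Rightarrow> ('a, 'm) ranked_poset_scheme \<Rightarrow> bool" where
  "chiral n P \<longleftrightarrow> abstract_polytope n P \<and>
     card (flags P // flag_orbit_rel P) = 2 \<and>
     (\<forall>\<Phi>\<in>flags P. \<forall>\<Psi>\<in>flags P. adjacent \<Phi> \<Psi> \<longrightarrow> (\<Phi>, \<Psi>) \<notin> flag_orbit_rel P)"

text \<open>\<open>rotation P i\<close> is $\sigma_i$, mapping the base flag $\Phi$ to $\Phi^{i,i-1}$. In a directly
  regular polytope $\rho_{i-1}\rho_i$ does the same. The group generated by the $\sigma_i$ is all
  of \<^const>\<open>automorphism_group\<close> when \<open>P\<close> is chiral.\<close>

definition rotation :: "('a, 'm) ranked_poset_scheme \<Rightarrow> nat \<Rightarrow> 'a \<Rightarrow> 'a" where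
  "rotation P i = (THE f. f \<in> carrier (automorphism_group P) \<and>
     f ` base_flag P = flag_adj P (int i - 1) (flag_adj P (int i) (base_flag P)))"

definition rotation_group :: "nat \<Rightarrow> ('a, 'm) ranked_poset_scheme \<Rightarrow> ('a \<Rightarrow> 'a) monoid" where
  "rotation_group n P = (automorphism_group P)
     \<lparr>carrier := generate (automorphism_group P) (rotation P ` {1..<n})\<rparr>"

definition has_type :: "nat \<Rightarrow> ('a, 'm) ranked_poset_scheme \<Rightarrow> (nat \<Rightarrow> nat) \<Rightarrow> bool" where
  "has_type n P p \<longleftrightarrow> (\<forall>i\<in>{1..<n}. p i = group.ord (rotation_group n P) (rotation P i))"

definition mirror :: "'a ranked_poset \<Rightarrow> 'a ranked_poset" where
  "mirror P = P\<lparr>base_flag := flag_adj P 0 (base_flag P)\<rparr>"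

definition dual :: "nat \<Rightarrow> 'a ranked_poset \<Rightarrow> 'a ranked_poset" where
  "dual n P = P\<lparr>le := (le P)\<inverse>, rank := (\<lambda>F. int n - 1 - rank P F)\<rparr>"

definition properly_self_dual :: "('a, 'm) ranked_poset_scheme \<Rightarrow> bool" where
  "properly_self_dual P \<longleftrightarrow>
     (\<exists>d. bij_betw d (faces P) (faces P) \<and>
          (\<forall>F\<in>faces P. \<forall>G\<in>faces P. (F, G) \<in> le P \<longleftrightarrow> (d G, d F) \<in> le P) \<and>
          d ` base_flag P = base_flag P)"


section \<open>Mix and comix of groups with specified generators\<close>

text \<open>A group with specified generators is given by a group \<open>G\<close> and a family
  \<open>x 1, \<dots>, x k\<close> of elements.\<close>

definition mix :: "nat \<Rightarrow> ('a, 'm) monoid_scheme \<Rightarrow> (nat \<Rightarrow> 'a)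
    \<Rightarrow> ('b, 'l) monoid_scheme \<Rightarrow> (nat \<Rightarrow> 'b) \<Rightarrow> ('a \<times> 'b) monoid" where
  "mix k G x H y = (G \<times>\<times> H)\<lparr>carrier := generate (G \<times>\<times> H) ((\<lambda>i. (x i, y i)) ` {1..k})\<rparr>"

text \<open>Words in the letters \<open>X\<close> and their formal inverses: \<open>(a, True)\<close> stands for $a$,
  \<open>(a, False)\<close> for $a^{-1}$.\<close>

definition words :: "'g set \<Rightarrow> ('g \<times> bool) list set" where
  "words X = lists (X \<times> UNIV)"

definition eval_word :: "('a, 'm) monoid_scheme \<Rightarrow> ('g \<Rightarrow> 'a) \<Rightarrow> ('g \<times> bool) list \<Rightarrow> 'a" where
  "eval_word G x w =
     foldr (\<lambda>(a, b) z. (if b then x a else inv\<^bsub>G\<^esub> x a) \<otimes>\<^bsub>G\<^esub> z) w \<one>\<^bsub>G\<^esub>"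

definition word_step :: "'g set \<Rightarrow> ('g \<times> bool) list set \<Rightarrow> ('g \<times> bool) list rel" where
  "word_step X R = {(u @ r @ v, u @ v) | u r v. u \<in> words X \<and> v \<in> words X \<and>
                      r \<in> R \<union> {[(a, b), (a, \<not> b)] | a b. a \<in> X}}"

definition word_cong :: "'g set \<Rightarrow> ('g \<times> bool) list set \<Rightarrow> ('g \<times> bool) list rel" where
  "word_cong X R = (word_step X R \<union> (word_step X R)\<inverse>)\<^sup>* \<inter> words X \<times> words X"

text \<open>The group $\langle X \mid R\rangle$.\<close>

definition presented_group :: "'g set \<Rightarrow> ('g \<times> bool) list set \<Rightarrow> ('g \<times> bool) list set monoid" where
  "presented_group X R =
     \<lparr>carrier = words X // word_cong X R,
      mult = (\<lambda>A B. \<Union>a\<in>A. \<Union>b\<in>B. word_cong X R `` {a @ b}),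
      one = word_cong X R `` {[]}\<rparr>"

text \<open>The comix does not depend on the chosen presentations of the two groups; we present each
  of them by all the relations that hold among its generators. The letters \<open>Inl i\<close> and \<open>Inr i\<close>
  stand for $x_i$ and $x_i'$.\<close>

definition relations :: "nat \<Rightarrow> ('a, 'm) monoid_scheme \<Rightarrow> (nat \<Rightarrow> 'a) \<Rightarrow> (nat \<times> bool) list set" where
  "relations k G x = {w \<in> words {1..k}. eval_word G x w = \<one>\<^bsub>G\<^esub>}"

definition comix :: "nat \<Rightarrow> ('a, 'm) monoid_scheme \<Rightarrow> (nat \<Rightarrow> 'a)
    \<Rightarrow> ('b, 'l) monoid_scheme \<Rightarrow> (nat \<Rightarrow> 'b) \<Rightarrow> ((nat + nat) \<times> bool) list set monoid" where
  "comix k G x H y = presented_group (Inl ` {1..k} \<union> Inr ` {1..k})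
     (map (map_prod Inl id) ` relations k G x \<union>
      map (map_prod Inr id) ` relations k H y \<union>
      {[(Inl i, False), (Inr i, True)] | i. i \<in> {1..k}})"


section \<open>The poset built from a group, and the mix of polytopes\<close>

text \<open>$\tau_{i,j} = \sigma_i\cdots\sigma_j$ and $G_I$ for $I \subseteq \{0,\dots,n-1\}$.\<close>

definition \<tau> :: "('g, 'm) monoid_scheme \<Rightarrow> (nat \<Rightarrow> 'g) \<Rightarrow> nat \<Rightarrow> nat \<Rightarrow> 'g" where
  "\<tau> G \<sigma> i j = foldr (\<lambda>k z. \<sigma> k \<otimes>\<^bsub>G\<^esub> z) [i..<Suc j] \<one>\<^bsub>G\<^esub>"

definition G_sub :: "nat \<Rightarrow> ('g, 'm) monoid_scheme \<Rightarrow> (nat \<Rightarrow> 'g) \<Rightarrow> int set \<Rightarrow> 'g set" where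
  "G_sub n G \<sigma> I = generate G
     {\<tau> G \<sigma> i j | i j. 1 \<le> i \<and> i \<le> j \<and> j < n \<and> int i - 1 \<in> I \<and> int j \<in> I}"

text \<open>The poset built from a group with specified generators $\sigma_1,\dots,\sigma_{n-1}$
  (Schulte and Weiss): the $j$-faces are the right cosets of the would-be stabilizer
  $G_{\{0,\dots,n-1\}\setminus\{j\}}$ of the base $j$-face, and $G_i\varphi \le G_j\psi$ iff
  $i \le j$ and the cosets meet. For $j = -1$ and $j = n$ the subgroup is all of $G$, giving
  the least and the greatest face. Cosets are tagged with their rank, as cosets belonging to
  different ranks may coincide as sets. This description of incidence is the right one for
  $n \ge 3$, and chiral polytopes have rank at least 3.\<close>

definition face_group :: "nat \<Rightarrow> ('g, 'm) monoid_scheme \<Rightarrow> (nat \<Rightarrow> 'g) \<Rightarrow> int \<Rightarrow> 'g set" where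
  "face_group n G \<sigma> j = G_sub n G \<sigma> ({0..int n - 1} - {j})"

definition coset_poset :: "nat \<Rightarrow> ('g, 'm) monoid_scheme \<Rightarrow> (nat \<Rightarrow> 'g)
    \<Rightarrow> (int \<times> 'g set) ranked_poset" where
  "coset_poset n G \<sigma> =
     (let A = (SIGMA j:{- 1..int n}. rcosets\<^bsub>G\<^esub> (face_group n G \<sigma> j))
      in \<lparr>faces = A,
          le = {((i, C), (j, D)). (i, C) \<in> A \<and> (j, D) \<in> A \<and> i \<le> j \<and> C \<inter> D \<noteq> {}},
          rank = fst,
          base_flag = (\<lambda>j. (j, face_group n G \<sigma> j)) ` {- 1..int n}\<rparr>)"

definition polytope_mix :: "nat \<Rightarrow> 'a ranked_poset \<Rightarrow> 'b ranked_poset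
    \<Rightarrow> (int \<times> (('a \<Rightarrow> 'a) \<times> ('b \<Rightarrow> 'b)) set) ranked_poset" where
  "polytope_mix n P Q = coset_poset n
     (mix (n - 1) (rotation_group n P) (rotation P) (rotation_group n Q) (rotation Q))
     (\<lambda>i. (rotation P i, rotation Q i))"

end

(* The rotation group of a chiral polytope is determined by its generators together with the
   relations tau_{ij}^2 = 1, the nontriviality of the tau_{ij}, the intersection property for
   intervals and the failure of the mirror map to be a homomorphism; conversely these
   properties make the coset poset a chiral polytope with that group. Here the flags are
   labelled by G x {even, odd}, with the i-adjacency swapping (g, even) and (t_i g, odd),
   where t_i = sigma_1 ... sigma_i, so that both directions become statements about orbits of
   commuting involutions.

   The dual of P has the same automorphism group, with generators sigma_{n-i}^{-1}. As p_i and
   p_{n-i} are coprime, (sigma_i, 1) is a power of (sigma_i, sigma_{n-i}^{-1}), so the mix is the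
   whole direct product, the properties above pass to it componentwise, and a mirror
   homomorphism of the product would restrict to one of the first factor, against the
   chirality of P. Swapping the two factors inverts and reverses the generators, which gives
   the self-duality. *)
theory Submission
  imports Defs
begin

section \<open>Orbits under families of involutions\<close>

text \<open>Coprimality splits only single generators. For i < j the element
  \<open>\<tau> G \<sigma> i j\<close> has order 2 in both factors, so for an index set with gaps
  the subgroup \<open>G_sub\<close> of the product is in general not a product, and the intersection
  property cannot be checked componentwise there. For an interval, however, \<open>G_sub\<close> is
  generated by the generators inside it, and these pairs do split. This is why a group is only
  required to intersect an initial with a final segment well, and why everything else is recovered
  from that: steps of ranks below j and above j commute, so a path avoiding several ranks can be cut
  at each of them in turn (\<open>orb_faces\<close>).

  Flags rather than faces carry the argument, because the group acts by right multiplication while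
  the adjacencies multiply on the left by prefix products or their inverses, and the two commute.
  Two labels per group element are needed because a chiral polytope has two flag orbits; an
  automorphism interchanging the two kinds of label is exactly a mirror homomorphism.\<close>

inductive_set orb :: "(int \<Rightarrow> 'x \<Rightarrow> 'x) \<Rightarrow> int set \<Rightarrow> 'x \<Rightarrow> 'x set" for r I x where
  base: "x \<in> orb r I x"
| step: "y \<in> orb r I x \<Longrightarrow> i \<in> I \<Longrightarrow> r i y \<in> orb r I x"

lemma orb_mono:
  assumes "y \<in> orb r I x" "I \<subseteq> J"
  shows "y \<in> orb r J x"
  using assms by (induction rule: orb.induct) (auto intro: orb.intros)

lemma orb_trans:
  assumes "z \<in> orb r I y" "y \<in> orb r I x"
  shows "z \<in> orb r I x"
  using assms by (induction rule: orb.induct) (auto intro: orb.intros)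

lemma orb_single: "i \<in> I \<Longrightarrow> r i x \<in> orb r I x"
  by (auto intro: orb.intros)

lemma orb_empty: "y \<in> orb r {} x \<Longrightarrow> y = x"
  by (induction rule: orb.induct) auto

locale involutions =
  fixes n :: nat and X :: "'x set" and r :: "int \<Rightarrow> 'x \<Rightarrow> 'x"
  assumes r_closed: "i \<in> {0..<int n} \<Longrightarrow> x \<in> X \<Longrightarrow> r i x \<in> X"
    and r_r: "i \<in> {0..<int n} \<Longrightarrow> x \<in> X \<Longrightarrow> r i (r i x) = x"
begin

lemma orb_closed:
  assumes "y \<in> orb r I x" "I \<subseteq> {0..<int n}" "x \<in> X"
  shows "y \<in> X"
  using assms by (induction rule: orb.induct) (auto intro!: r_closed)

lemma orb_sym:
  assumes "y \<in> orb r I x" "I \<subseteq> {0..<int n}" "x \<in> X"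
  shows "x \<in> orb r I y"
  using assms
proof (induction rule: orb.induct)
  case (step y i)
  have "y \<in> X" using orb_closed[OF step(1)] step by auto
  then have "y \<in> orb r I (r i y)"
    using orb_single[of i I r "r i y"] r_r[of i y] step by auto
  then show ?case using step orb_trans by metis
qed (auto intro: orb.intros)

lemma orb_singleton:
  assumes "y \<in> orb r {i} x" "i \<in> {0..<int n}" "x \<in> X"
  shows "y = x \<or> y = r i x"
  using assms by (induction rule: orb.induct) (auto simp: r_r)

lemma orb_hom:
  assumes "y \<in> orb r I x" "I \<subseteq> {0..<int n}" "x \<in> X"
    and "\<And>i x. i \<in> I \<Longrightarrow> x \<in> X \<Longrightarrow> h (r i x) = r' i (h x)"
  shows "h y \<in> orb r' I (h x)"
  using assms
proof (induction rule: orb.induct)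
  case (step y i)
  then show ?case using orb_closed[OF step(1)] orb.step[of "h y" r' I "h x" i] by auto
qed (auto intro: orb.intros)

end

section \<open>Flags of abstract polytopes\<close>

locale polytope =
  fixes n :: nat and P :: "('a, 'm) ranked_poset_scheme"
  assumes poly: "abstract_polytope n P"
begin

lemma
  le_faces: "(F, G) \<in> le P \<Longrightarrow> F \<in> faces P \<and> G \<in> faces P" and
  le_refl: "F \<in> faces P \<Longrightarrow> (F, F) \<in> le P" and
  le_trans: "(F, G) \<in> le P \<Longrightarrow> (G, H) \<in> le P \<Longrightarrow> (F, H) \<in> le P"
  using poly
  by (auto simp: abstract_polytope_def partial_order_on_def preorder_on_def refl_on_def
      dest: transD)

lemma rank_range: "F \<in> faces P \<Longrightarrow> rank P F \<in> {-1..int n}"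
  and rank_less: "(F, G) \<in> le P \<Longrightarrow> F \<noteq> G \<Longrightarrow> rank P F < rank P G"
  and flag_card: "\<Phi> \<in> flags P \<Longrightarrow> card \<Phi> = n + 2"
  and diamond: "(F, G) \<in> le P \<Longrightarrow> rank P F = j - 1 \<Longrightarrow> rank P G = j + 1 \<Longrightarrow>
        card {H \<in> faces P. rank P H = j \<and> (F, H) \<in> le P \<and> (H, G) \<in> le P} = 2"
  and connected: "strongly_flag_connected P"
  and base_flag: "base_flag P \<in> flags P"
  and least_ex: "\<exists>F\<in>faces P. rank P F = - 1 \<and> (\<forall>G\<in>faces P. (F, G) \<in> le P)"
  and greatest_ex: "\<exists>F\<in>faces P. rank P F = int n \<and> (\<forall>G\<in>faces P. (G, F) \<in> le P)"
  using poly by (auto simp: abstract_polytope_def)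

text \<open>The diamond condition is silent on ranks -1 and n, so uniqueness there comes from the
  least and the greatest face. It confines every change of a flag to ranks 0 to n - 1.\<close>

lemma extreme_unique:
  assumes "F \<in> faces P" "G \<in> faces P" "rank P F = rank P G" "rank P F \<in> {-1, int n}"
  shows "F = G"
proof -
  obtain A B where A: "A \<in> faces P" "rank P A = -1" "\<forall>G\<in>faces P. (A, G) \<in> le P"
    and B: "B \<in> faces P" "rank P B = int n" "\<forall>G\<in>faces P. (G, B) \<in> le P"
    using least_ex greatest_ex by blast
  have "rank P F = -1 \<Longrightarrow> F = A \<and> G = A" "rank P F = int n \<Longrightarrow> F = B \<and> G = B"
    using assms A B rank_less[of A F] rank_less[of A G] rank_less[of F B] rank_less[of G B]
    by force+
  then show ?thesis using assms by blast
qed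

section \<open>Chains and flags, counted by their ranks\<close>

definition chain :: "'a set \<Rightarrow> bool" where
  "chain C \<longleftrightarrow> C \<subseteq> faces P \<and> C \<in> Chains (le P)"

lemma chain_inj: "chain C \<Longrightarrow> inj_on (rank P) C"
  unfolding chain_def Chains_def inj_on_def using rank_less by fastforce

lemma chain_rank: "chain C \<Longrightarrow> rank P ` C \<subseteq> {-1..int n}"
  unfolding chain_def using rank_range by blast

lemma chain_finite: "chain C \<Longrightarrow> finite C"
  using finite_imageD[OF finite_subset[OF chain_rank] chain_inj] by simp

lemma chain_card: "chain C \<Longrightarrow> card C \<le> n + 2"
  using chain_inj[of C] chain_rank[of C] card_mono[of "{-1..int n}" "rank P ` C"]
  by (simp add: card_image)

lemma flag_chain: "\<Phi> \<in> flags P \<Longrightarrow> chain \<Phi>"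
  by (auto simp: flags_def chain_def)

lemma chain_rank_full:
  assumes "chain C" "card C = n + 2"
  shows "rank P ` C = {-1..int n}"
  using card_subset_eq[of "{-1..int n}" "rank P ` C"] chain_rank chain_inj assms
  by (simp add: card_image)

lemma flag_rank: "\<Phi> \<in> flags P \<Longrightarrow> rank P ` \<Phi> = {-1..int n}"
  using chain_rank_full flag_chain flag_card by blast

lemma chain_cardI:
  assumes "chain C" "rank P ` C = {-1..int n}"
  shows "card C = n + 2"
  using card_image[OF chain_inj[OF assms(1)]] assms(2) by simp

lemma full_chain_flag:
  assumes "chain C" "card C = n + 2"
  shows "C \<in> flags P"
proof -
  have "D = C" if "chain D" "C \<subseteq> D" for D
    using card_subset_eq[OF chain_finite[OF that(1)] that(2)] chain_card[OF that(1)]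
      card_mono[OF chain_finite[OF that(1)] that(2)] assms by auto
  then show ?thesis using assms by (auto simp: flags_def chain_def)
qed

text \<open>Distinct ranks bound the size of chains, so an extension of greatest size exists, and it
  is maximal for inclusion.\<close>

lemma chain_extends:
  assumes "chain C"
  obtains \<Phi> where "\<Phi> \<in> flags P" "C \<subseteq> \<Phi>"
proof -
  define Q where "Q D \<longleftrightarrow> chain D \<and> C \<subseteq> D" for D
  have "Q C" using assms by (auto simp: Q_def)
  moreover have "\<And>D. Q D \<Longrightarrow> card D < n + 3" using chain_card by (fastforce simp: Q_def)
  ultimately obtain D where D: "Q D" "\<And>E. Q E \<Longrightarrow> card E \<le> card D"
    using ex_has_greatest_nat[of Q C card "n + 3"] by (metis less_or_eq_imp_le)
  have "E = D" if "chain E" "D \<subseteq> E" for E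
    using D(2)[of E] that D(1) card_seteq[OF chain_finite, of E D] by (auto simp: Q_def)
  then have "D \<in> flags P" using D(1) by (auto simp: flags_def chain_def Q_def)
  then show ?thesis using that D(1) by (auto simp: Q_def)
qed

lemma face_in_flag:
  assumes "F \<in> faces P"
  obtains \<Phi> where "\<Phi> \<in> flags P" "F \<in> \<Phi>"
  using chain_extends[of "{F}"] assms le_refl by (auto simp: chain_def Chains_def)

lemma le_in_flag:
  assumes "(F, G) \<in> le P"
  obtains \<Phi> where "\<Phi> \<in> flags P" "F \<in> \<Phi>" "G \<in> \<Phi>"
proof -
  have "chain {F, G}" using assms le_refl le_faces by (auto simp: chain_def Chains_def)
  then show ?thesis using that by (meson chain_extends insert_subset)
qed

text \<open>Coordinates on flags: two flags are compared rank by rank. The value is meaningful only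
  for ranks between -1 and n.\<close>

definition fc :: "'a set \<Rightarrow> int \<Rightarrow> 'a" where
  "fc \<Phi> j = (THE F. F \<in> \<Phi> \<and> rank P F = j)"

lemma fc_eq:
  assumes "\<Phi> \<in> flags P" "F \<in> \<Phi>"
  shows "fc \<Phi> (rank P F) = F"
  unfolding fc_def using chain_inj[OF flag_chain[OF assms(1)]] assms(2)
  by (auto simp: inj_on_def)

lemma fc_props:
  assumes "\<Phi> \<in> flags P" "j \<in> {-1..int n}"
  shows "fc \<Phi> j \<in> \<Phi>" "rank P (fc \<Phi> j) = j"
proof -
  obtain F where F: "F \<in> \<Phi>" "rank P F = j"
    using assms(2) unfolding flag_rank[OF assms(1), symmetric] by blast
  then have "fc \<Phi> j = F" using fc_eq[OF assms(1) F(1)] by simp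
  then show "fc \<Phi> j \<in> \<Phi>" "rank P (fc \<Phi> j) = j" using F by simp_all
qed

lemma flag_faces: "\<Phi> \<in> flags P \<Longrightarrow> F \<in> \<Phi> \<Longrightarrow> F \<in> faces P"
  by (auto simp: flags_def)

lemma flag_eq_image:
  assumes "\<Phi> \<in> flags P" shows "\<Phi> = fc \<Phi> ` {-1..int n}"
proof -
  have "F \<in> fc \<Phi> ` {-1..int n}" if "F \<in> \<Phi>" for F
    using fc_eq[OF assms that] rank_range[OF flag_faces[OF assms that]] by (metis imageI)
  then show ?thesis using fc_props(1)[OF assms] by auto
qed

lemma flag_eqI:
  assumes "\<Phi> \<in> flags P" "\<Psi> \<in> flags P" "\<And>j. j \<in> {-1..int n} \<Longrightarrow> fc \<Phi> j = fc \<Psi> j"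
  shows "\<Phi> = \<Psi>"
  using flag_eq_image[OF assms(1)] flag_eq_image[OF assms(2)] assms(3) by (metis image_cong)

lemma fc_le:
  assumes "\<Phi> \<in> flags P" "i \<in> {-1..int n}" "j \<in> {-1..int n}" "i \<le> j"
  shows "(fc \<Phi> i, fc \<Phi> j) \<in> le P"
proof (cases "i = j")
  case True
  then show ?thesis using le_refl flag_faces fc_props(1) assms by auto
next
  case False
  have "(fc \<Phi> i, fc \<Phi> j) \<in> le P \<or> (fc \<Phi> j, fc \<Phi> i) \<in> le P"
    using flag_chain[OF assms(1)] fc_props(1) assms by (auto simp: chain_def Chains_def)
  then show ?thesis
    using rank_less[of "fc \<Phi> j" "fc \<Phi> i"] fc_props(2) assms False by fastforce
qed

section \<open>Adjacent flags from the diamond condition\<close>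

lemma between_flag:
  assumes "\<Phi> \<in> flags P" "j \<in> {0..<int n}"
  shows "fc \<Phi> j \<in> {H \<in> faces P. rank P H = j \<and> (fc \<Phi> (j - 1), H) \<in> le P \<and> (H, fc \<Phi> (j + 1)) \<in> le P}"
    "card {H \<in> faces P. rank P H = j \<and> (fc \<Phi> (j - 1), H) \<in> le P \<and> (H, fc \<Phi> (j + 1)) \<in> le P} = 2"
  using assms fc_props[of \<Phi> j] flag_faces fc_le[of \<Phi> "j - 1" j] fc_le[of \<Phi> j "j + 1"]
    diamond[of "fc \<Phi> (j - 1)" "fc \<Phi> (j + 1)" j] fc_le[of \<Phi> "j - 1" "j + 1"]
    fc_props(2)[of \<Phi> "j - 1"] fc_props(2)[of \<Phi> "j + 1"]
  by auto

lemma third_eq: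
  assumes "card S = 2" "a \<in> S" "b \<in> S" "c \<in> S" "b \<noteq> a" "c \<noteq> a"
  shows "b = c"
  using assms by (auto simp: card_2_iff)

text \<open>The j-face is exchanged for the other element of its diamond. Transitivity through the
  faces of ranks j - 1 and j + 1 makes the new face comparable with the rest of the flag.\<close>

lemma adj_exists:
  assumes \<Phi>: "\<Phi> \<in> flags P" and j: "j \<in> {0..<int n}"
  obtains \<Psi> where "\<Psi> \<in> flags P" "\<Psi> \<noteq> \<Phi>" "\<And>k. k \<in> {-1..int n} \<Longrightarrow> k \<noteq> j \<Longrightarrow> fc \<Psi> k = fc \<Phi> k"
proof -
  define S where
    "S = {H \<in> faces P. rank P H = j \<and> (fc \<Phi> (j - 1), H) \<in> le P \<and> (H, fc \<Phi> (j + 1)) \<in> le P}"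
  obtain H where H: "H \<in> S" "H \<noteq> fc \<Phi> j"
    using between_flag[OF assms] unfolding S_def[symmetric] by (metis card_2_iff insertI1 insertI2)
  define \<Psi> where "\<Psi> = insert H (fc \<Phi> ` ({-1..int n} - {j}))"
  have comp: "(H, fc \<Phi> k) \<in> le P \<or> (fc \<Phi> k, H) \<in> le P" if "k \<in> {-1..int n} - {j}" for k
  proof (cases "k < j")
    case True
    then show ?thesis using H(1) fc_le[OF \<Phi>, of k "j - 1"] that j le_trans by (auto simp: S_def)
  next
    case False
    then show ?thesis using H(1) fc_le[OF \<Phi>, of "j + 1" k] that j le_trans by (auto simp: S_def)
  qed
  have fcc: "(fc \<Phi> k, fc \<Phi> l) \<in> le P \<or> (fc \<Phi> l, fc \<Phi> k) \<in> le P"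
    if "k \<in> {-1..int n}" "l \<in> {-1..int n}" for k l
    using fc_le[OF \<Phi>] that by (meson linear)
  have Hf: "H \<in> faces P" "rank P H = j" using H(1) by (auto simp: S_def)
  have "\<Psi> \<in> Chains (le P)"
    using comp fcc le_refl[OF Hf(1)] unfolding Chains_def \<Psi>_def by blast
  then have ch: "chain \<Psi>"
    using Hf flag_faces[OF \<Phi>] fc_props(1)[OF \<Phi>] by (auto simp: chain_def \<Psi>_def)
  have "rank P ` \<Psi> = insert j ({-1..int n} - {j})"
    using Hf(2) fc_props(2)[OF \<Phi>] by (force simp: \<Psi>_def)
  then have "rank P ` \<Psi> = {-1..int n}" using j by auto
  then have fl: "\<Psi> \<in> flags P" using full_chain_flag chain_cardI ch by blast
  have "fc \<Psi> k = fc \<Phi> k" if "k \<in> {-1..int n}" "k \<noteq> j" for k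
    using fc_eq[OF fl, of "fc \<Phi> k"] fc_props(2)[OF \<Phi>, of k] that by (auto simp: \<Psi>_def)
  moreover have "\<Psi> \<noteq> \<Phi>"
    using fc_eq[OF fl, of H] H(2) Hf by (auto simp: \<Psi>_def)
  ultimately show ?thesis using that fl by blast
qed

lemma adj_face_eq:
  assumes "\<Phi> \<in> flags P" "\<Psi> \<in> flags P" "\<Psi>' \<in> flags P" "j \<in> {0..<int n}"
    and "fc \<Psi> j \<noteq> fc \<Phi> j" "fc \<Psi>' j \<noteq> fc \<Phi> j"
    and "\<And>k. k \<in> {j - 1, j + 1} \<Longrightarrow> fc \<Psi> k = fc \<Phi> k"
    and "\<And>k. k \<in> {j - 1, j + 1} \<Longrightarrow> fc \<Psi>' k = fc \<Phi> k"
  shows "fc \<Psi> j = fc \<Psi>' j"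
  using third_eq[OF between_flag(2)[OF assms(1,4)] between_flag(1)[OF assms(1,4)], of "fc \<Psi> j" "fc \<Psi>' j"]
    between_flag(1)[OF assms(2,4)] between_flag(1)[OF assms(3,4)] assms(5-)
  by auto

lemma adj_unique:
  assumes "\<Phi> \<in> flags P" "\<Psi> \<in> flags P" "\<Psi>' \<in> flags P" "j \<in> {0..<int n}"
    and ne: "\<Psi> \<noteq> \<Phi>" "\<Psi>' \<noteq> \<Phi>"
    and \<Psi>: "\<And>k. k \<in> {-1..int n} \<Longrightarrow> k \<noteq> j \<Longrightarrow> fc \<Psi> k = fc \<Phi> k"
    and \<Psi>': "\<And>k. k \<in> {-1..int n} \<Longrightarrow> k \<noteq> j \<Longrightarrow> fc \<Psi>' k = fc \<Phi> k"
  shows "\<Psi> = \<Psi>'"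
proof -
  have "fc \<Psi> j \<noteq> fc \<Phi> j" "fc \<Psi>' j \<noteq> fc \<Phi> j"
    using flag_eqI assms by metis+
  moreover have "k \<in> {-1..int n} \<and> k \<noteq> j" if "k \<in> {j - 1, j + 1}" for k using that assms(4) by auto
  ultimately have "fc \<Psi> j = fc \<Psi>' j"
    using adj_face_eq[OF assms(1-4)] \<Psi> \<Psi>' by blast
  then show ?thesis using flag_eqI[OF assms(2,3)] \<Psi> \<Psi>' by metis
qed

abbreviation r :: "int \<Rightarrow> 'a set \<Rightarrow> 'a set" where
  "r \<equiv> flag_adj P"

lemma agree_iff:
  assumes "\<Phi> \<in> flags P" "\<Psi> \<in> flags P"
  shows "{F \<in> \<Psi>. rank P F \<noteq> j} = {F \<in> \<Phi>. rank P F \<noteq> j} \<longleftrightarrow>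
    (\<forall>k\<in>{-1..int n}. k \<noteq> j \<longrightarrow> fc \<Psi> k = fc \<Phi> k)" (is "?L \<longleftrightarrow> ?R")
proof
  assume L: ?L
  show ?R
  proof (intro ballI impI)
    fix k assume k: "k \<in> {-1..int n}" "k \<noteq> j"
    have "fc \<Psi> k \<in> {F \<in> \<Psi>. rank P F \<noteq> j}" using k fc_props[OF assms(2) k(1)] by auto
    then have "fc \<Psi> k \<in> \<Phi>" unfolding L by simp
    then show "fc \<Psi> k = fc \<Phi> k" using fc_eq[OF assms(1), of "fc \<Psi> k"] fc_props(2)[OF assms(2) k(1)] by simp
  qed
next
  assume R: ?R
  have *: "{F \<in> A. rank P F \<noteq> j} = fc A ` ({-1..int n} - {j})" if A: "A \<in> flags P" for A
  proof (intro equalityI subsetI)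
    fix F assume "F \<in> {F \<in> A. rank P F \<noteq> j}"
    then have "F = fc A (rank P F)" "rank P F \<in> {-1..int n} - {j}"
      using fc_eq[OF A] rank_range flag_faces[OF A] by auto
    then show "F \<in> fc A ` ({-1..int n} - {j})" by (rule image_eqI)
  qed (use fc_props[OF A] in auto)
  have "fc \<Psi> ` ({-1..int n} - {j}) = fc \<Phi> ` ({-1..int n} - {j})"
    using R by (intro image_cong) auto
  then show ?L using *[OF assms(1)] *[OF assms(2)] by simp
qed

lemma r_eqI:
  assumes "\<Phi> \<in> flags P" "\<Psi> \<in> flags P" "j \<in> {0..<int n}" "\<Psi> \<noteq> \<Phi>"
    and "\<And>k. k \<in> {-1..int n} \<Longrightarrow> k \<noteq> j \<Longrightarrow> fc \<Psi> k = fc \<Phi> k"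
  shows "r j \<Phi> = \<Psi>"
  unfolding flag_adj_def
proof (rule the_equality)
  fix \<Psi>' assume "\<Psi>' \<in> flags P \<and> \<Psi>' \<noteq> \<Phi> \<and> {F \<in> \<Psi>'. rank P F \<noteq> j} = {F \<in> \<Phi>. rank P F \<noteq> j}"
  then have "\<Psi>' \<in> flags P" "\<Psi>' \<noteq> \<Phi>" "\<forall>k\<in>{-1..int n}. k \<noteq> j \<longrightarrow> fc \<Psi>' k = fc \<Phi> k"
    using agree_iff[OF assms(1)] by blast+
  then show "\<Psi>' = \<Psi>" using adj_unique[OF assms(1) _ assms(2,3)] assms(4,5) by blast
qed (use assms agree_iff[OF assms(1,2)] in blast)

lemma r_props:
  assumes "\<Phi> \<in> flags P" "j \<in> {0..<int n}"
  shows r_flag: "r j \<Phi> \<in> flags P" and r_ne: "r j \<Phi> \<noteq> \<Phi>"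
    and r_fc: "\<And>k. k \<in> {-1..int n} \<Longrightarrow> k \<noteq> j \<Longrightarrow> fc (r j \<Phi>) k = fc \<Phi> k"
proof -
  obtain \<Psi> where \<Psi>: "\<Psi> \<in> flags P" "\<Psi> \<noteq> \<Phi>"
    "\<And>k. k \<in> {-1..int n} \<Longrightarrow> k \<noteq> j \<Longrightarrow> fc \<Psi> k = fc \<Phi> k"
    using adj_exists[OF assms] by blast
  then have "r j \<Phi> = \<Psi>" using r_eqI assms by blast
  then show "r j \<Phi> \<in> flags P" "r j \<Phi> \<noteq> \<Phi>"
    "\<And>k. k \<in> {-1..int n} \<Longrightarrow> k \<noteq> j \<Longrightarrow> fc (r j \<Phi>) k = fc \<Phi> k" using \<Psi> by auto
qed

lemma r_fc_ne:
  assumes "\<Phi> \<in> flags P" "j \<in> {0..<int n}"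
  shows "fc (r j \<Phi>) j \<noteq> fc \<Phi> j"
  using flag_eqI[of "r j \<Phi>" \<Phi>] r_props[OF assms] assms by metis

sublocale involutions n "flags P" r
proof
  fix i x assume "i \<in> {0..<int n}" "x \<in> flags P"
  then show "r i x \<in> flags P" "r i (r i x) = x"
    using r_props[of x i] r_eqI[of "r i x" x i] by auto
qed

text \<open>As the ranks differ by at least 2, changing the j-face leaves the faces of ranks i - 1
  and i + 1 alone. The diamond at rank i is therefore the same before and after, and the new i-face
  is the same in both orders.\<close>

lemma r_commute:
  assumes "i \<in> {0..<int n}" "j \<in> {0..<int n}" "\<bar>i - j\<bar> \<ge> 2" "\<Phi> \<in> flags P"
  shows "r i (r j \<Phi>) = r j (r i \<Phi>)"
proof -
  have ij: "i \<noteq> j" using assms by auto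
  have fl: "r i \<Phi> \<in> flags P" "r j \<Phi> \<in> flags P" "r i (r j \<Phi>) \<in> flags P"
    using assms r_flag by auto
  have *: "fc (r i (r j \<Phi>)) k = fc (r i \<Phi>) k" if k: "k \<in> {-1..int n}" "k \<noteq> j" for k
  proof (cases "k = i")
    case True
    have "fc (r i (r j \<Phi>)) i \<noteq> fc \<Phi> i"
      using r_fc_ne[of "r j \<Phi>" i] r_fc[of \<Phi> j i] fl assms ij by auto
    moreover have "fc (r i (r j \<Phi>)) l = fc \<Phi> l" "fc (r i \<Phi>) l = fc \<Phi> l" if "l \<in> {i - 1, i + 1}" for l
    proof -
      have "l \<in> {-1..int n}" "l \<noteq> i" "l \<noteq> j" using that assms(1,3) by auto
      then show "fc (r i (r j \<Phi>)) l = fc \<Phi> l" "fc (r i \<Phi>) l = fc \<Phi> l"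
        using r_fc assms fl by simp_all
    qed
    ultimately have "fc (r i (r j \<Phi>)) i = fc (r i \<Phi>) i"
      using adj_face_eq[OF assms(4) fl(3,1) assms(1)] r_fc_ne[of \<Phi> i] assms by blast
    then show ?thesis using True by simp
  next
    case False
    then show ?thesis using r_fc[of \<Phi>] r_fc[of "r j \<Phi>"] fl assms that by auto
  qed
  have "fc (r i (r j \<Phi>)) j \<noteq> fc (r i \<Phi>) j"
    using r_fc_ne[of \<Phi> j] r_fc[of "r j \<Phi>" i j] r_fc[of \<Phi> i j] fl assms ij by auto
  then show ?thesis using r_eqI[of "r i \<Phi>" "r i (r j \<Phi>)" j] * fl assms by metis
qed

section \<open>Adjacency and strong flag-connectedness\<close>

lemma adjacent_iff:
  assumes "X \<in> flags P" "Y \<in> flags P"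
  shows "adjacent X Y \<longleftrightarrow> (\<exists>i\<in>{0..<int n}. Y = r i X)"
proof
  assume "adjacent X Y"
  then obtain F H where F: "X - Y = {F}" "Y - X = {H}" by (auto simp: adjacent_def card_1_singleton_iff)
  define i where "i = rank P F"
  have "F \<in> X" using F by auto
  then have i: "i \<in> {-1..int n}" "fc X i = F"
    using rank_range[OF flag_faces] fc_eq assms unfolding i_def by blast+
  have *: "fc Y k = fc X k" if k: "k \<in> {-1..int n}" "k \<noteq> i" for k
  proof -
    have "fc X k \<noteq> F" using fc_props(2)[OF assms(1) k(1)] k(2) i_def by auto
    then have "fc X k \<in> Y" using fc_props(1)[OF assms(1) k(1)] F by auto
    then show ?thesis using fc_eq[OF assms(2)] fc_props(2)[OF assms(1) k(1)] by metis
  qed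
  \<comment> \<open>All flags share their faces of rank -1 and n, so the rank of the differing face
    lies strictly between.\<close>
  have "i \<noteq> -1" "i \<noteq> int n"
    using extreme_unique[of "fc X i" "fc Y i"] fc_props[OF assms(1) i(1)] fc_props[OF assms(2) i(1)]
      flag_faces assms F i by auto
  then have "i \<in> {0..<int n}" using i by auto
  then show "\<exists>i\<in>{0..<int n}. Y = r i X" using r_eqI[OF assms] * F by blast
next
  assume "\<exists>i\<in>{0..<int n}. Y = r i X"
  then obtain i where i: "i \<in> {0..<int n}" "Y = r i X" by blast
  have "A - B = {fc A i}" if A: "A \<in> flags P" "B \<in> flags P" "fc A i \<noteq> fc B i"
    "\<And>k. k \<in> {-1..int n} \<Longrightarrow> k \<noteq> i \<Longrightarrow> fc A k = fc B k" for A B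
  proof -
    have "rank P (fc A i) = i" using fc_props(2)[OF A(1), of i] i by simp
    then have "fc A i \<notin> B" using fc_eq[OF A(2), of "fc A i"] A(3) by auto
    moreover have "F \<in> B" if "F \<in> A" "F \<noteq> fc A i" for F
      using A(4)[of "rank P F"] fc_eq[OF A(1) that(1)] that fc_props(1)[OF A(2), of "rank P F"]
        rank_range[OF flag_faces[OF A(1) that(1)]] by force
    ultimately show ?thesis using fc_props(1)[OF A(1), of i] i by auto
  qed
  moreover have "fc X i \<noteq> fc Y i" "\<And>k. k \<in> {-1..int n} \<Longrightarrow> k \<noteq> i \<Longrightarrow> fc X k = fc Y k"
    using r_fc_ne[OF assms(1) i(1)] r_fc[OF assms(1) i(1)] i(2) by metis+
  ultimately have "X - Y = {fc X i}" "Y - X = {fc Y i}" using assms by metis+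
  then show "adjacent X Y" by (simp add: adjacent_def)
qed

lemma orb_fc:
  assumes "y \<in> orb r I x" "I \<subseteq> {0..<int n}" "x \<in> flags P" "k \<in> {-1..int n}" "k \<notin> I"
  shows "fc y k = fc x k"
  using assms
proof (induction rule: orb.induct)
  case (step y i)
  then have "i \<in> {0..<int n}" "k \<noteq> i" "y \<in> flags P" using orb_closed[OF step(1)] by blast+
  then show ?case using r_fc[of y i k] step by simp
qed auto

text \<open>This is the form in which strong flag-connectedness is used: on a path of flags
  containing the common faces, a step of a rank outside \<open>I\<close> would replace a common
  face.\<close>

lemma orb_iff:
  assumes "x \<in> flags P" "y \<in> flags P" "I \<subseteq> {0..<int n}"
  shows "y \<in> orb r I x \<longleftrightarrow> (\<forall>k\<in>{-1..int n} - I. fc y k = fc x k)"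
proof
  assume R: "\<forall>k\<in>{-1..int n} - I. fc y k = fc x k"
  have "(x, y) \<in> {(X, Y). X \<in> flags P \<and> Y \<in> flags P \<and> adjacent X Y \<and> x \<inter> y \<subseteq> X \<and> x \<inter> y \<subseteq> Y}\<^sup>*"
    using connected assms unfolding strongly_flag_connected_def by blast
  then show "y \<in> orb r I x"
  proof (induction rule: rtrancl_induct)
    case (step X Y)
    then obtain i where i: "i \<in> {0..<int n}" "Y = r i X" using adjacent_iff by blast
    have "i \<in> I"
    proof (rule ccontr)
      assume "i \<notin> I"
      then have "fc y i = fc x i" using R i by auto
      then have "fc x i \<in> x \<inter> y" "rank P (fc x i) = i"
        using fc_props[OF assms(1), of i] fc_props(1)[OF assms(2), of i] i by auto
      then have "fc X i = fc x i" "fc Y i = fc x i"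
        using step fc_eq[of X "fc x i"] fc_eq[of Y "fc x i"] by auto
      then show False using r_fc_ne[of X i] i step by auto
    qed
    then show ?case using step i by (auto intro: orb.step)
  qed (rule orb.base)
qed (use orb_fc assms in auto)

end

section \<open>Automorphisms and flags\<close>

text \<open>The map is squeezed from both ends: induction upwards gives i \<le> g i, induction
  downwards gives g i \<le> i.\<close>

lemma strict_mono_int_interval_id:
  fixes g :: "int \<Rightarrow> int"
  assumes "\<And>i. i \<in> {a..b} \<Longrightarrow> g i \<in> {a..b}"
    and "\<And>i j. i \<in> {a..b} \<Longrightarrow> j \<in> {a..b} \<Longrightarrow> i < j \<Longrightarrow> g i < g j"
    and "i \<in> {a..b}"
  shows "g i = i"
proof -
  have "a \<le> i \<Longrightarrow> i \<le> b \<longrightarrow> i \<le> g i"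
  proof (induction i rule: int_ge_induct)
    case (step i)
    then show ?case using assms(2)[of i "i + 1"] by auto
  qed (use assms(1) in auto)
  moreover have "i \<le> b \<Longrightarrow> a \<le> i \<longrightarrow> g i \<le> i"
  proof (induction i rule: int_le_induct)
    case (step i)
    then show ?case using assms(2)[of "i - 1" i] by auto
  qed (use assms(1) in auto)
  ultimately show ?thesis using assms(3) by auto
qed

context polytope
begin

abbreviation Aut :: "('a \<Rightarrow> 'a) monoid" where
  "Aut \<equiv> automorphism_group P"

lemma Aut_iff: "f \<in> carrier Aut \<longleftrightarrow> f \<in> extensional (faces P) \<and> bij_betw f (faces P) (faces P) \<and>
    (\<forall>F\<in>faces P. \<forall>G\<in>faces P. (F, G) \<in> le P \<longleftrightarrow> (f F, f G) \<in> le P)"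
  by (auto simp: automorphism_group_def Bij_def)

lemma Aut_mult: "f \<otimes>\<^bsub>Aut\<^esub> g = compose (faces P) g f"
  by (simp add: automorphism_group_def)

lemma Aut_one: "\<one>\<^bsub>Aut\<^esub> = (\<lambda>F\<in>faces P. F)"
  by (simp add: automorphism_group_def)

lemma Aut_face: "f \<in> carrier Aut \<Longrightarrow> F \<in> faces P \<Longrightarrow> f F \<in> faces P"
  using Aut_iff bij_betwE by blast

lemma group_Aut: "group Aut"
proof (rule groupI)
  fix f g assume f: "f \<in> carrier Aut" and g: "g \<in> carrier Aut"
  show "f \<otimes>\<^bsub>Aut\<^esub> g \<in> carrier Aut"
    unfolding Aut_mult
  proof (subst Aut_iff, intro conjI ballI)
    show "bij_betw (compose (faces P) g f) (faces P) (faces P)"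
      using f g Aut_iff bij_betw_compose by blast
  next
    fix F G assume FG: "F \<in> faces P" "G \<in> faces P"
    have "(F, G) \<in> le P \<longleftrightarrow> (f F, f G) \<in> le P" "(f F, f G) \<in> le P \<longleftrightarrow> (g (f F), g (f G)) \<in> le P"
      using f g FG Aut_iff Aut_face by blast+
    then show "(F, G) \<in> le P \<longleftrightarrow> (compose (faces P) g f F, compose (faces P) g f G) \<in> le P"
      using FG by (simp add: compose_eq)
  qed (rule compose_extensional)
next
  show "\<one>\<^bsub>Aut\<^esub> \<in> carrier Aut" by (auto simp: Aut_iff Aut_one bij_betw_def inj_on_def)
next
  fix f g h assume "f \<in> carrier Aut" "g \<in> carrier Aut" "h \<in> carrier Aut"
  then show "f \<otimes>\<^bsub>Aut\<^esub> g \<otimes>\<^bsub>Aut\<^esub> h = f \<otimes>\<^bsub>Aut\<^esub> (g \<otimes>\<^bsub>Aut\<^esub> h)"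
    using Aut_face by (auto simp: Aut_mult compose_def fun_eq_iff)
next
  fix f assume "f \<in> carrier Aut"
  then show "\<one>\<^bsub>Aut\<^esub> \<otimes>\<^bsub>Aut\<^esub> f = f"
    using Aut_iff by (auto simp: Aut_mult Aut_one compose_def fun_eq_iff extensional_def)
next
  fix f assume f: "f \<in> carrier Aut"
  define g where "g = restrict (inv_into (faces P) f) (faces P)"
  have bf: "bij_betw f (faces P) (faces P)" using f Aut_iff by blast
  have bg: "bij_betw g (faces P) (faces P)"
    unfolding g_def using bij_betw_inv_into[OF bf] by simp
  have fg: "f (g F) = F" "g (f F) = F" if "F \<in> faces P" for F
    using that bij_betw_inv_into_right[OF bf] bij_betw_inv_into_left[OF bf] Aut_face[OF f]
    by (auto simp: g_def)
  have "g \<in> carrier Aut"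
  proof (subst Aut_iff, intro conjI ballI)
    fix F G assume FG: "F \<in> faces P" "G \<in> faces P"
    then have "g F \<in> faces P" "g G \<in> faces P" using bg bij_betwE by blast+
    then have "(g F, g G) \<in> le P \<longleftrightarrow> (f (g F), f (g G)) \<in> le P" using f Aut_iff by blast
    then show "(F, G) \<in> le P \<longleftrightarrow> (g F, g G) \<in> le P" using fg FG by simp
  qed (use bg in \<open>auto simp: g_def\<close>)
  moreover have "g \<otimes>\<^bsub>Aut\<^esub> f = \<one>\<^bsub>Aut\<^esub>"
    using fg by (auto simp: Aut_mult Aut_one compose_def fun_eq_iff)
  ultimately show "\<exists>g\<in>carrier Aut. g \<otimes>\<^bsub>Aut\<^esub> f = \<one>\<^bsub>Aut\<^esub>" by blast
qed

lemma Aut_mult_image: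
  assumes "\<Phi> \<in> flags P"
  shows "(f \<otimes>\<^bsub>Aut\<^esub> g) ` \<Phi> = g ` (f ` \<Phi>)"
  using flag_faces[OF assms] by (force simp: Aut_mult compose_def)

lemma Aut_one_image:
  assumes "\<Phi> \<in> flags P"
  shows "\<one>\<^bsub>Aut\<^esub> ` \<Phi> = \<Phi>"
  using flag_faces[OF assms] by (force simp: Aut_one)

lemma Aut_le: "f \<in> carrier Aut \<Longrightarrow> (F, G) \<in> le P \<Longrightarrow> (f F, f G) \<in> le P"
  using Aut_iff le_faces by blast

lemma Aut_flag_chain:
  assumes f: "f \<in> carrier Aut" and \<Phi>: "\<Phi> \<in> flags P"
  shows "chain (f ` \<Phi>)"
proof -
  have "\<Phi> \<subseteq> faces P" "\<Phi> \<in> Chains (le P)" using \<Phi> by (auto simp: flags_def)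
  then show ?thesis using Aut_face[OF f] Aut_le[OF f] unfolding chain_def Chains_def by blast
qed

lemma Aut_flag:
  assumes f: "f \<in> carrier Aut" and \<Phi>: "\<Phi> \<in> flags P"
  shows "f ` \<Phi> \<in> flags P"
proof -
  have "inj_on f \<Phi>"
    using f Aut_iff flag_faces[OF \<Phi>] by (meson bij_betw_def inj_on_subset subsetI)
  then have "card (f ` \<Phi>) = n + 2" using flag_card[OF \<Phi>] by (simp add: card_image)
  then show ?thesis using full_chain_flag Aut_flag_chain[OF assms] by blast
qed

text \<open>Automorphisms are only required to respect the order. Along a flag they induce a
  strictly increasing self-map of the ranks, which must be the identity.\<close>

lemma Aut_rank:
  assumes f: "f \<in> carrier Aut" and F: "F \<in> faces P"
  shows "rank P (f F) = rank P F"
proof -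
  obtain \<Phi> where \<Phi>: "\<Phi> \<in> flags P" "F \<in> \<Phi>" using face_in_flag[OF F] .
  have "rank P (f (fc \<Phi> i)) = i" if i: "i \<in> {-1..int n}" for i
  proof (rule strict_mono_int_interval_id[OF _ _ i, where g = "\<lambda>i. rank P (f (fc \<Phi> i))"])
    fix i assume "i \<in> {-1..int n}"
    then have "fc \<Phi> i \<in> faces P" using fc_props(1) flag_faces \<Phi> by blast
    then show "rank P (f (fc \<Phi> i)) \<in> {-1..int n}" using rank_range Aut_face[OF f] by blast
  next
    fix i j assume ij: "i \<in> {-1..int n}" "j \<in> {-1..int n}" "i < j"
    have "fc \<Phi> i \<in> faces P" "fc \<Phi> j \<in> faces P" using fc_props(1) flag_faces \<Phi> ij by blast+
    moreover have "fc \<Phi> i \<noteq> fc \<Phi> j"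
      using fc_props(2)[OF \<Phi>(1) ij(1)] fc_props(2)[OF \<Phi>(1) ij(2)] ij(3) by auto
    ultimately have "f (fc \<Phi> i) \<noteq> f (fc \<Phi> j)" using f Aut_iff by (meson bij_betw_def inj_onD)
    then show "rank P (f (fc \<Phi> i)) < rank P (f (fc \<Phi> j))"
      using rank_less Aut_le[OF f] fc_le[OF \<Phi>(1)] ij by (meson less_imp_le)
  qed
  then show ?thesis using fc_eq[OF \<Phi>] rank_range[OF F] by metis
qed

lemma Aut_fc:
  assumes f: "f \<in> carrier Aut" and \<Phi>: "\<Phi> \<in> flags P" and j: "j \<in> {-1..int n}"
  shows "fc (f ` \<Phi>) j = f (fc \<Phi> j)"
  using fc_eq[OF Aut_flag[OF f \<Phi>], of "f (fc \<Phi> j)"] fc_props[OF \<Phi> j] Aut_rank[OF f]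
    flag_faces[OF \<Phi>] by auto

lemma Aut_image_inj:
  assumes f: "f \<in> carrier Aut" and "\<Phi> \<in> flags P" "\<Psi> \<in> flags P" "f ` \<Phi> = f ` \<Psi>"
  shows "\<Phi> = \<Psi>"
proof -
  have "inj_on f (faces P)" using f Aut_iff by (auto simp: bij_betw_def)
  then show ?thesis using inj_on_image_eq_iff assms flag_faces by (metis subsetI)
qed

lemma Aut_r:
  assumes f: "f \<in> carrier Aut" and \<Phi>: "\<Phi> \<in> flags P" and j: "j \<in> {0..<int n}"
  shows "f ` (r j \<Phi>) = r j (f ` \<Phi>)"
proof -
  have "f ` (r j \<Phi>) \<noteq> f ` \<Phi>"
    using Aut_image_inj[OF f \<Phi> r_flag[OF \<Phi> j]] r_ne[OF \<Phi> j] by metis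
  moreover have "fc (f ` (r j \<Phi>)) k = fc (f ` \<Phi>) k" if "k \<in> {-1..int n}" "k \<noteq> j" for k
    using Aut_fc[OF f] r_fc[OF \<Phi> j that] r_flag[OF \<Phi> j] \<Phi> that by simp
  ultimately show ?thesis
    using r_eqI[OF Aut_flag[OF f \<Phi>] Aut_flag[OF f r_flag[OF \<Phi> j]] j] by metis
qed

section \<open>Flag permutations and the automorphisms they induce\<close>

lemma orb_all:
  assumes "x \<in> flags P" "y \<in> flags P"
  shows "y \<in> orb r {0..<int n} x"
proof -
  have "fc y k = fc x k" if "k \<in> {-1..int n} - {0..<int n}" for k
    using that extreme_unique[of "fc y k" "fc x k"] fc_props[OF assms(1), of k] fc_props[OF assms(2), of k]
      flag_faces assms by auto
  then show ?thesis using orb_iff[OF assms] by blast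
qed

lemma flag_maps_eq:
  assumes "\<And>i x. i \<in> {0..<int n} \<Longrightarrow> x \<in> flags P \<Longrightarrow> h (r i x) = s i (h x)"
    and "\<And>i x. i \<in> {0..<int n} \<Longrightarrow> x \<in> flags P \<Longrightarrow> h' (r i x) = s i (h' x)"
    and "h x = h' x" "x \<in> flags P" "y \<in> flags P"
  shows "h y = h' y"
  using orb_all[OF assms(4,5)]
proof (induction rule: orb.induct)
  case (step y i)
  then show ?case using assms orb_closed[OF step(1)] by auto
qed (use assms in auto)

text \<open>Automorphisms commute with the adjacencies, so by connectedness the value on one flag
  determines the value on all flags, and every face lies in a flag.\<close>

lemma Aut_free:
  assumes f: "f \<in> carrier Aut" and g: "g \<in> carrier Aut" and \<Phi>: "\<Phi> \<in> flags P" and eq: "f ` \<Phi> = g ` \<Phi>"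
  shows "f = g"
proof (rule extensionalityI)
  fix F assume "F \<in> faces P"
  then obtain \<Psi> where \<Psi>: "\<Psi> \<in> flags P" "F \<in> \<Psi>" by (rule face_in_flag)
  then have "f ` \<Psi> = g ` \<Psi>"
    using flag_maps_eq[of "(`) f" r "(`) g"] Aut_r f g eq \<Phi> by blast
  then have "f (fc \<Psi> (rank P F)) = g (fc \<Psi> (rank P F))"
    using Aut_fc[OF f \<Psi>(1)] Aut_fc[OF g \<Psi>(1)] rank_range[OF \<open>F \<in> faces P\<close>] by metis
  then show "f F = g F" using fc_eq[OF \<Psi>] by simp
qed (use f g Aut_iff in auto)

text \<open>Two flags sharing the face are joined by a path avoiding its rank, and a map commuting
  with the adjacencies carries it to another such path. This makes the induced map on faces well
  defined.\<close>

lemma flag_map_face: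
  assumes "\<And>x. x \<in> flags P \<Longrightarrow> h x \<in> flags P"
    and "\<And>i x. i \<in> {0..<int n} \<Longrightarrow> x \<in> flags P \<Longrightarrow> h (r i x) = r i (h x)"
    and "x \<in> flags P" "y \<in> flags P" "F \<in> x" "F \<in> y"
  shows "fc (h x) (rank P F) = fc (h y) (rank P F)"
proof -
  have F: "rank P F \<in> {-1..int n}" using rank_range flag_faces assms by blast
  let ?I = "{k \<in> {0..<int n}. fc y k \<noteq> fc x k}"
  have "fc y k = fc x k" if "k \<in> {-1..int n} - {0..<int n}" for k
    using that orb_fc[OF orb_all[OF assms(3,4)] _ assms(3)] by auto
  then have "y \<in> orb r ?I x" using orb_iff[OF assms(3,4), of ?I] by blast
  then have "h y \<in> orb r ?I (h x)" using orb_hom[of y ?I x h r] assms by blast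
  moreover have "rank P F \<notin> ?I" using fc_eq assms by auto
  moreover have "?I \<subseteq> {0..<int n}" by blast
  ultimately have "fc (h y) (rank P F) = fc (h x) (rank P F)"
    using orb_fc[of "h y" ?I "h x" "rank P F"] assms(1)[OF assms(3)] F by blast
  then show ?thesis by simp
qed

text \<open>The source of the automorphisms constructed below: it suffices to give a permutation of
  the flags, with inverse \<open>h'\<close>, that commutes with every adjacency.\<close>

lemma flag_map_induces_Aut:
  assumes h: "\<And>x. x \<in> flags P \<Longrightarrow> h x \<in> flags P"
    and hr: "\<And>i x. i \<in> {0..<int n} \<Longrightarrow> x \<in> flags P \<Longrightarrow> h (r i x) = r i (h x)"
    and h': "\<And>x. x \<in> flags P \<Longrightarrow> h' x \<in> flags P"
    and hr': "\<And>i x. i \<in> {0..<int n} \<Longrightarrow> x \<in> flags P \<Longrightarrow> h' (r i x) = r i (h' x)"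
    and hh': "\<And>x. x \<in> flags P \<Longrightarrow> h (h' x) = x" "\<And>x. x \<in> flags P \<Longrightarrow> h' (h x) = x"
  obtains f where "f \<in> carrier Aut" "\<And>x. x \<in> flags P \<Longrightarrow> f ` x = h x"
proof -
  \<comment> \<open>The image of a face is read off from an arbitrary flag through it; by
    \<open>flag_map_face\<close> the choice does not matter.\<close>
  define ind where
    "ind g = (\<lambda>F\<in>faces P. fc (g (SOME x. x \<in> flags P \<and> F \<in> x)) (rank P F))" for g :: "'a set \<Rightarrow> 'a set"
  have ind: "ind g F = fc (g x) (rank P F)"
    if g: "g = h \<or> g = h'" and x: "x \<in> flags P" "F \<in> x" for g x F
  proof -
    let ?y = "SOME y. y \<in> flags P \<and> F \<in> y"
    have "?y \<in> flags P \<and> F \<in> ?y" using someI_ex[of "\<lambda>y. y \<in> flags P \<and> F \<in> y"] x by blast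
    then have "fc (g ?y) (rank P F) = fc (g x) (rank P F)"
      using flag_map_face[of h ?y x F] flag_map_face[of h' ?y x F] h hr h' hr' x g by blast
    then show ?thesis using flag_faces x by (simp add: ind_def)
  qed
  have ind_mem: "ind g F \<in> g x \<and> rank P (ind g F) = rank P F"
    if "g = h \<or> g = h'" "x \<in> flags P" "F \<in> x" for g x F
    using ind[OF that] fc_props[of "g x" "rank P F"] h h' that rank_range[OF flag_faces[OF that(2,3)]] by auto
  have le: "(ind g F, ind g G) \<in> le P" if g: "g = h \<or> g = h'" and FG: "(F, G) \<in> le P" for g F G
  proof -
    obtain x where x: "x \<in> flags P" "F \<in> x" "G \<in> x" using le_in_flag[OF FG] .
    have "rank P F \<le> rank P G" using rank_less[OF FG] by force
    then show ?thesis
      using ind[OF g x(1,2)] ind[OF g x(1,3)] fc_le[of "g x"] h h' x(1) g rank_range le_faces[OF FG] by auto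
  qed
  have inv: "ind g' (ind g F) = F"
    if g: "(g = h \<and> g' = h') \<or> (g = h' \<and> g' = h)" and F: "F \<in> faces P" for g g' F
  proof -
    obtain x where x: "x \<in> flags P" "F \<in> x" using face_in_flag[OF F] .
    then have "ind g F \<in> g x" "rank P (ind g F) = rank P F" "g x \<in> flags P" "g' (g x) = x"
      using ind_mem[of g x F] g h h' hh' by auto
    then have "ind g' (ind g F) = fc x (rank P F)" using ind[of g' "g x" "ind g F"] g by auto
    then show ?thesis using fc_eq[OF x] by simp
  qed
  have mem: "ind g F \<in> faces P" if g: "g = h \<or> g = h'" and F: "F \<in> faces P" for g F
  proof -
    obtain x where x: "x \<in> flags P" "F \<in> x" using face_in_flag[OF F] .
    then show ?thesis using ind_mem[OF g x] flag_faces h h' g by blast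
  qed
  have "ind h \<in> carrier Aut"
  proof (subst Aut_iff, intro conjI ballI)
    show "ind h \<in> extensional (faces P)" by (simp add: ind_def)
    show "bij_betw (ind h) (faces P) (faces P)"
      by (rule bij_betw_byWitness[where f' = "ind h'"]) (use inv mem in auto)
  next
    fix F G assume FG: "F \<in> faces P" "G \<in> faces P"
    show "(F, G) \<in> le P \<longleftrightarrow> (ind h F, ind h G) \<in> le P"
      using le[of h F G] le[of h' "ind h F" "ind h G"] inv[of h h'] FG by auto
  qed
  moreover have "ind h ` x = h x" if x: "x \<in> flags P" for x
  proof (rule flag_eqI)
    fix j assume j: "j \<in> {-1..int n}"
    show "fc (ind h ` x) j = fc (h x) j"
      using Aut_fc[OF \<open>ind h \<in> carrier Aut\<close> x j] ind[of h x "fc x j"] fc_props[OF x j] x by simp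
  qed (use Aut_flag[OF \<open>ind h \<in> carrier Aut\<close> x] h x in auto)
  ultimately show ?thesis using that by blast
qed

end

section \<open>Polytopes from commuting involutions\<close>

text \<open>The bounds in \<open>path_intersection\<close> are arbitrary integers clipped to the
  ranks, so that empty segments are covered too. Only an initial and a final segment are
  intersected; \<open>orb_Inter\<close> extends this to arbitrary sets of ranks.\<close>

locale maniplex = involutions +
  assumes r_commute: "i \<in> {0..<int n} \<Longrightarrow> j \<in> {0..<int n} \<Longrightarrow> \<bar>i - j\<bar> \<ge> 2 \<Longrightarrow> x \<in> X \<Longrightarrow>
      r i (r j x) = r j (r i x)"
    and r_ne: "i \<in> {0..<int n} \<Longrightarrow> x \<in> X \<Longrightarrow> r i x \<noteq> x"
    and connected: "x \<in> X \<Longrightarrow> y \<in> X \<Longrightarrow> y \<in> orb r {0..<int n} x"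
    and path_intersection: "x \<in> X \<Longrightarrow> y \<in> X \<Longrightarrow> y \<in> orb r ({0..k} \<inter> {0..<int n}) x \<Longrightarrow>
      y \<in> orb r ({m..} \<inter> {0..<int n}) x \<Longrightarrow> y \<in> orb r ({m..k} \<inter> {0..<int n}) x"
begin

abbreviation N :: "int set" where "N \<equiv> {0..<int n}"

text \<open>Each step from \<open>I\<close> commutes with each step from \<open>J\<close>, so all
  steps from \<open>J\<close> can be moved to the start of the path.\<close>

lemma orb_commute:
  assumes "y \<in> orb r (I \<union> J) x" "I \<subseteq> N" "J \<subseteq> N" "x \<in> X"
    and "\<And>i j. i \<in> I \<Longrightarrow> j \<in> J \<Longrightarrow> \<bar>i - j\<bar> \<ge> 2"
  obtains z where "z \<in> orb r J x" "y \<in> orb r I z"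
proof -
  have "\<exists>z. z \<in> orb r J x \<and> y \<in> orb r I z"
    using assms(1)
  proof (induction rule: orb.induct)
    case base
    show ?case by (intro exI[of _ x] conjI orb.base)
  next
    case (step y i)
    then obtain z where z: "z \<in> orb r J x" "y \<in> orb r I z" by blast
    have zX: "z \<in> X" using orb_closed z assms by blast
    show ?case
    proof (cases "i \<in> I")
      case True
      then show ?thesis using z by (meson orb.step)
    next
      case False
      then have i: "i \<in> J" using step by auto
      have "r i y \<in> orb r I (r i z)"
      proof (rule orb_hom[OF z(2) assms(2) zX])
        fix k w assume k: "k \<in> I" and w: "w \<in> X"
        then have "\<bar>i - k\<bar> \<ge> 2" using assms(5)[OF k i] by auto
        then show "r i (r k w) = r k (r i w)" using r_commute i k w assms(2,3) by blast
      qed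
      then show ?thesis using z i by (meson orb.step)
    qed
  qed
  then show ?thesis using that by blast
qed

text \<open>Once rank j is avoided, the ranks below j and above j are at distance at least 2, so the
  path can be sorted into two halves.\<close>

lemma orb_face_split:
  assumes "y \<in> orb r (N - {j}) x" "x \<in> X"
  obtains z where "z \<in> orb r (N \<inter> {j<..}) x" "y \<in> orb r (N \<inter> {..<j}) z"
proof -
  have "y \<in> orb r ((N \<inter> {..<j}) \<union> (N \<inter> {j<..})) x"
    using assms(1) by (rule orb_mono) auto
  then obtain z where "z \<in> orb r (N \<inter> {j<..}) x" "y \<in> orb r (N \<inter> {..<j}) z"
    by (rule orb_commute) (use assms in auto)
  then show ?thesis using that by blast
qed

text \<open>Induction over the least rank b to be avoided. The path is cut at b into a part from x
  to z above b and a part from z to y below b. Path intersection pushes the latter strictly between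
  k0 and b, and z inherits the hypotheses with b in the role of k0.\<close>

lemma orb_faces:
  assumes "finite K" "K \<subseteq> {k0<..}" "x \<in> X" "-1 \<le> k0"
    and "y \<in> orb r (N \<inter> {k0<..}) x" "\<And>k. k \<in> K \<Longrightarrow> y \<in> orb r (N - {k}) x"
  shows "y \<in> orb r (N \<inter> {k0<..} - K) x"
  using assms
proof (induction K arbitrary: k0 x y rule: finite_linorder_min_induct)
  case (insert b A)
  have b: "k0 < b" and xX: "x \<in> X" using insert by auto
  obtain z where z: "z \<in> orb r (N \<inter> {b<..}) x" "y \<in> orb r (N \<inter> {..<b}) z"
    using orb_face_split[of y b x] insert by auto
  have zX: "z \<in> X" using orb_closed[OF z(1) _ xX] by auto
  have yX: "y \<in> X" using orb_closed[OF z(2) _ zX] by auto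
  have "x \<in> orb r (N \<inter> {b<..}) z" using orb_sym[OF z(1) _ xX] by blast
  then have "x \<in> orb r (N \<inter> {k0<..}) z" by (rule orb_mono) (use b in auto)
  then have "y \<in> orb r (N \<inter> {k0<..}) z" by (rule orb_trans[OF insert.prems(4)])
  then have "y \<in> orb r ({k0 + 1..} \<inter> N) z" by (rule orb_mono) auto
  moreover have "y \<in> orb r ({0..b - 1} \<inter> N) z" using z(2) by (rule orb_mono) auto
  ultimately have yz: "y \<in> orb r ({k0 + 1..b - 1} \<inter> N) z"
    using path_intersection[OF zX yX] by blast
  have "z \<in> orb r (N - {k}) x" if k: "k \<in> A" for k
  proof -
    have "z \<in> orb r (N \<inter> {..<b}) y" using orb_sym[OF z(2) _ zX] by auto
    then have "z \<in> orb r (N - {k}) y" by (rule orb_mono) (use insert.hyps k in force)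
    then show ?thesis by (rule orb_trans) (use insert.prems(5)[of k] k in simp)
  qed
  then have "z \<in> orb r (N \<inter> {b<..} - A) x"
    using insert.IH[of b x z] insert.hyps xX z(1) b insert.prems by auto
  then have "z \<in> orb r (N \<inter> {k0<..} - Set.insert b A) x"
    by (rule orb_mono) (use b in auto)
  moreover have "y \<in> orb r (N \<inter> {k0<..} - Set.insert b A) z"
    using yz by (rule orb_mono) (use insert.hyps in force)
  ultimately show ?case by (rule orb_trans[rotated])
qed auto

lemma orb_Inter:
  assumes "x \<in> X" "y \<in> X" "\<And>k. k \<in> K \<Longrightarrow> y \<in> orb r (N - {k}) x"
  shows "y \<in> orb r (N - K) x"
proof -
  have "N \<inter> {-1<..} = N" by auto
  then have "y \<in> orb r (N \<inter> {-1<..} - (K \<inter> N)) x"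
    using orb_faces[of "K \<inter> N" "-1" x y] assms connected[OF assms(1,2)] by auto
  then show ?thesis by (rule orb_mono) auto
qed

end

text \<open>\<open>f j x\<close> is the j-face of the flag x, shared by exactly the flags that can
  be reached without a step of rank j. For j = -1 and j = n nothing is removed from the ranks, which
  gives a single face each.\<close>

locale face_poset = maniplex n X r for n and X :: "'x set" and r +
  fixes L :: "('f, 'm) ranked_poset_scheme" and f :: "int \<Rightarrow> 'x \<Rightarrow> 'f" and x0 :: 'x
  assumes faces_L: "faces L = {f j x | j x. j \<in> {-1..int n} \<and> x \<in> X}"
    and rank_f: "j \<in> {-1..int n} \<Longrightarrow> x \<in> X \<Longrightarrow> rank L (f j x) = j"
    and f_eq: "j \<in> {-1..int n} \<Longrightarrow> x \<in> X \<Longrightarrow> y \<in> X \<Longrightarrow>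
      f j x = f j y \<longleftrightarrow> y \<in> orb r ({0..<int n} - {j}) x"
    and le_L: "le L = {(f i z, f j z) | i j z. z \<in> X \<and> i \<in> {-1..int n} \<and> j \<in> {-1..int n} \<and> i \<le> j}"
    and x0: "x0 \<in> X"
    and base_L: "base_flag L = (\<lambda>j. f j x0) ` {-1..int n}"
begin

abbreviation R :: "int set" where "R \<equiv> {-1..int n}"

definition flag :: "'x \<Rightarrow> 'f set" where
  "flag x = (\<lambda>j. f j x) ` R"

lemma f_eq_rank:
  assumes "f i x = f j y" "i \<in> R" "j \<in> R" "x \<in> X" "y \<in> X"
  shows "i = j"
  using assms rank_f by metis

lemma le_iff:
  assumes "i \<in> R" "j \<in> R" "x \<in> X" "y \<in> X"
  shows "(f i x, f j y) \<in> le L \<longleftrightarrow> i \<le> j \<and> (\<exists>z\<in>X. f i z = f i x \<and> f j z = f j y)"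
proof
  assume "(f i x, f j y) \<in> le L"
  then obtain i' j' z where z: "f i x = f i' z" "f j y = f j' z" "z \<in> X" "i' \<in> R" "j' \<in> R" "i' \<le> j'"
    unfolding le_L by blast
  then have "i' = i" "j' = j" using f_eq_rank assms by metis+
  then show "i \<le> j \<and> (\<exists>z\<in>X. f i z = f i x \<and> f j z = f j y)" using z by auto
next
  assume "i \<le> j \<and> (\<exists>z\<in>X. f i z = f i x \<and> f j z = f j y)"
  then obtain z where z: "z \<in> X" "f i z = f i x" "f j z = f j y" "i \<le> j" by auto
  have "(f i z, f j z) \<in> le L" unfolding le_L using z(1,4) assms(1,2) by blast
  then show "(f i x, f j y) \<in> le L" using z by simp
qed

lemma f_orb:
  assumes "y \<in> orb r I x" "x \<in> X" "I \<subseteq> N" "j \<in> R" "j \<notin> I"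
  shows "f j y = f j x"
proof -
  have "y \<in> orb r (N - {j}) x" using assms(1) by (rule orb_mono) (use assms in auto)
  then show ?thesis using f_eq[of j x y] orb_closed[OF assms(1,3,2)] assms by auto
qed

text \<open>Two flags through a common face of rank a combine to a flag with the lower part of the
  first and the upper part of the second: it is the midpoint of the path split at a. Transitivity,
  extension of chains and the diamond condition all rest on it.\<close>

lemma splice:
  assumes "x \<in> X" "y \<in> X" "a \<in> R" "f a x = f a y"
  obtains z where "z \<in> X" "\<And>i. i \<in> R \<Longrightarrow> i \<le> a \<Longrightarrow> f i z = f i x"
    "\<And>i. i \<in> R \<Longrightarrow> a \<le> i \<Longrightarrow> f i z = f i y"
proof -
  have "y \<in> orb r (N - {a}) x" using f_eq assms by blast
  then obtain z where z: "z \<in> orb r (N \<inter> {a<..}) x" "y \<in> orb r (N \<inter> {..<a}) z"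
    using orb_face_split assms(1) by blast
  have zX: "z \<in> X" using orb_closed[OF z(1)] assms(1) by auto
  show ?thesis
  proof (rule that[OF zX])
    fix i assume "i \<in> R" "i \<le> a"
    then show "f i z = f i x" using f_orb[OF z(1) assms(1)] by auto
  next
    fix i assume "i \<in> R" "a \<le> i"
    then show "f i z = f i y" using f_orb[OF z(2) zX] by auto
  qed
qed

lemma faces_cases:
  assumes "F \<in> faces L" obtains j x where "F = f j x" "j \<in> R" "x \<in> X"
  using assms faces_L by blast

lemma f_le: "i \<in> R \<Longrightarrow> j \<in> R \<Longrightarrow> i \<le> j \<Longrightarrow> x \<in> X \<Longrightarrow> (f i x, f j x) \<in> le L"
  using le_iff by blast

lemma f_faces: "j \<in> R \<Longrightarrow> x \<in> X \<Longrightarrow> f j x \<in> faces L"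
  using faces_L by blast

lemma partial_order: "partial_order_on (faces L) (le L)"
proof -
  have "le L \<subseteq> faces L \<times> faces L" unfolding le_L using f_faces by auto
  moreover have "refl_on (faces L) (le L)"
    using faces_L le_L by (fastforce simp: refl_on_def)
  moreover have "trans (le L)"
  proof (rule transI)
    fix A B C assume "(A, B) \<in> le L" "(B, C) \<in> le L"
    then obtain i j z j' k w where z: "A = f i z" "B = f j z" "z \<in> X" "i \<in> R" "j \<in> R" "i \<le> j"
      and w: "B = f j' w" "C = f k w" "w \<in> X" "j' \<in> R" "k \<in> R" "j' \<le> k"
      unfolding le_L by blast
    have j: "j' = j" using f_eq_rank z w by metis
    then have "f j z = f j w" using z w by simp
    then obtain v where v: "v \<in> X" "\<And>i. i \<in> R \<Longrightarrow> i \<le> j \<Longrightarrow> f i v = f i z"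
      "\<And>i. i \<in> R \<Longrightarrow> j \<le> i \<Longrightarrow> f i v = f i w"
      using splice[OF z(3) w(3) z(5)] by blast
    then have "A = f i v" "C = f k v" using z w j by auto
    then show "(A, C) \<in> le L" using f_le[of i k v] v(1) z w j by simp
  qed
  moreover have "antisym (le L)"
  proof (rule antisymI)
    fix A B assume "(A, B) \<in> le L" "(B, A) \<in> le L"
    then obtain i j z j' k w where z: "A = f i z" "B = f j z" "z \<in> X" "i \<in> R" "j \<in> R" "i \<le> j"
      and w: "B = f j' w" "A = f k w" "w \<in> X" "j' \<in> R" "k \<in> R" "j' \<le> k"
      unfolding le_L by blast
    then have "j' = j" "k = i" using f_eq_rank z w by metis+
    then show "A = B" using z w by auto
  qed
  ultimately show ?thesis by (simp add: partial_order_on_def preorder_on_def)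
qed

lemma flag_faces: "x \<in> X \<Longrightarrow> flag x \<subseteq> faces L"
  unfolding flag_def using f_faces by auto

lemma flag_Chains:
  assumes "x \<in> X" shows "flag x \<in> Chains (le L)"
proof -
  have "(f i x, f j x) \<in> le L \<or> (f j x, f i x) \<in> le L" if "i \<in> R" "j \<in> R" for i j
    using le_iff[of i j x x] le_iff[of j i x x] that assms linear[of i j] by blast
  then show ?thesis by (auto simp: Chains_def flag_def)
qed

lemma mem_flag: "y \<in> X \<Longrightarrow> x \<in> X \<Longrightarrow> j \<in> R \<Longrightarrow> f j x \<in> flag y \<longleftrightarrow> f j x = f j y"
  using f_eq_rank by (fastforce simp: flag_def)

text \<open>Faces are added by increasing rank. The flag found so far is spliced, at the largest
  rank a already treated, with a flag through the faces of ranks a and b; so pairwise incidence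
  suffices.\<close>

lemma chain_subset_flag:
  assumes "C \<subseteq> faces L" "C \<in> Chains (le L)"
  obtains x where "x \<in> X" "C \<subseteq> flag x"
proof -
  define K where "K = {j \<in> R. \<exists>x\<in>X. f j x \<in> C}"
  have "\<forall>j\<in>K. \<exists>x. x \<in> X \<and> f j x \<in> C" by (auto simp: K_def)
  then obtain g where g: "\<And>j. j \<in> K \<Longrightarrow> g j \<in> X \<and> f j (g j) \<in> C" by metis
  have comp: "\<exists>z\<in>X. f i z = f i (g i) \<and> f j z = f j (g j)" if ij: "i \<in> K" "j \<in> K" "i < j" for i j
  proof -
    have "(f i (g i), f j (g j)) \<in> le L \<or> (f j (g j), f i (g i)) \<in> le L"
      using g ij assms(2) by (auto simp: Chains_def)
    then show ?thesis using le_iff g ij by (auto simp: K_def)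
  qed
  have "\<exists>x\<in>X. \<forall>k\<in>A. f k x = f k (g k)" if "finite A" "A \<subseteq> K" for A
    using that
  proof (induction A rule: finite_linorder_max_induct)
    case empty
    then show ?case using x0 by blast
  next
    case (insert b A)
    then obtain x where x: "x \<in> X" "\<forall>k\<in>A. f k x = f k (g k)" by auto
    show ?case
    proof (cases "A = {}")
      case True
      then show ?thesis using g insert.prems by auto
    next
      case False
      define a where "a = Max A"
      have a: "a \<in> A" "\<forall>k\<in>A. k \<le> a" using insert.hyps(1) False by (auto simp: a_def)
      have "a < b" "a \<in> K" "b \<in> K" using a insert by auto
      then obtain y where y: "y \<in> X" "f a y = f a (g a)" "f b y = f b (g b)" using comp by blast
      then have "f a x = f a y" using x a by auto
      moreover have "a \<in> R" using \<open>a \<in> K\<close> by (simp add: K_def)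
      ultimately obtain z where z: "z \<in> X" "\<And>i. i \<in> R \<Longrightarrow> i \<le> a \<Longrightarrow> f i z = f i x"
        "\<And>i. i \<in> R \<Longrightarrow> a \<le> i \<Longrightarrow> f i z = f i y"
        using splice[OF x(1) y(1)] by blast
      have "f k z = f k (g k)" if k: "k \<in> insert b A" for k
      proof (cases "k = b")
        case True
        then show ?thesis using z(3)[of b] y(3) \<open>a < b\<close> \<open>b \<in> K\<close> by (simp add: K_def)
      next
        case False
        then have "k \<in> A" "k \<in> R" using k insert.prems by (auto simp: K_def)
        then show ?thesis using z(2)[of k] x(2) a by auto
      qed
      then show ?thesis using z(1) by blast
    qed
  qed
  moreover have "finite K" by (rule finite_subset[of K R]) (auto simp: K_def)
  ultimately obtain x where x: "x \<in> X" "\<forall>k\<in>K. f k x = f k (g k)" by blast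
  have "F \<in> flag x" if F: "F \<in> C" for F
  proof -
    obtain j y where y: "F = f j y" "j \<in> R" "y \<in> X" using F assms(1) faces_cases by blast
    then have j: "j \<in> K" using F by (auto simp: K_def)
    have "(F, f j (g j)) \<in> le L \<or> (f j (g j), F) \<in> le L"
      using F g[OF j] assms(2) by (auto simp: Chains_def)
    then have "F = f j (g j)" using le_iff y g[OF j] by auto
    then have "F = f j x" using x(2) j by simp
    then show ?thesis using y(2) by (simp add: flag_def)
  qed
  then show ?thesis using that x(1) by blast
qed

lemma flag_subset_eq:
  assumes "x \<in> X" "y \<in> X" "flag x \<subseteq> flag y"
  shows "flag x = flag y"
proof -
  have "f j x = f j y" if "j \<in> R" for j
  proof -
    have "f j x \<in> flag y" using assms(3) that by (auto simp: flag_def)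
    then show ?thesis using mem_flag assms that by blast
  qed
  then show ?thesis unfolding flag_def by (intro image_cong) auto
qed

lemma flags_eq: "flags L = flag ` X"
proof (intro equalityI subsetI)
  fix C assume C: "C \<in> flags L"
  then have C': "C \<subseteq> faces L" "C \<in> Chains (le L)"
    "\<And>D. D \<subseteq> faces L \<Longrightarrow> D \<in> Chains (le L) \<Longrightarrow> C \<subseteq> D \<Longrightarrow> D = C"
    unfolding flags_def by auto
  obtain x where x: "x \<in> X" "C \<subseteq> flag x" using chain_subset_flag[OF C'(1,2)] .
  then have "flag x = C" using C'(3) flag_faces flag_Chains by simp
  then show "C \<in> flag ` X" using x by blast
next
  fix C assume "C \<in> flag ` X"
  then obtain x where x: "x \<in> X" "C = flag x" by blast
  have "D = flag x" if D: "D \<subseteq> faces L" "D \<in> Chains (le L)" "flag x \<subseteq> D" for D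
  proof -
    obtain y where y: "y \<in> X" "D \<subseteq> flag y" using chain_subset_flag[OF D(1,2)] .
    then show ?thesis using flag_subset_eq[OF x(1) y(1)] D(3) by blast
  qed
  then show "C \<in> flags L" using x flag_faces flag_Chains unfolding flags_def by blast
qed

text \<open>Flags with all faces in common are joined by a path avoiding every rank, that is, by the
  empty path.\<close>

lemma flag_inj:
  assumes "x \<in> X" "y \<in> X" "flag x = flag y"
  shows "x = y"
proof -
  have "f j y = f j x" if "j \<in> R" for j
    using assms mem_flag[of x y j] that by (auto simp: flag_def)
  then have "y \<in> orb r (N - {k}) x" if "k \<in> R" for k using f_eq assms that by metis
  then have "y \<in> orb r (N - R) x" using orb_Inter assms by blast
  moreover have "N - R = {}" by auto
  ultimately show ?thesis using orb_empty by metis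
qed

lemma f_r: "x \<in> X \<Longrightarrow> i \<in> N \<Longrightarrow> j \<in> R \<Longrightarrow> j \<noteq> i \<Longrightarrow> f j (r i x) = f j x"
  using f_orb[of "r i x" "{i}" x j] orb_single[of i "{i}" r x] by auto

lemma f_r_ne:
  assumes "x \<in> X" "i \<in> N"
  shows "f i (r i x) \<noteq> f i x"
proof
  assume "f i (r i x) = f i x"
  then have "f j (r i x) = f j x" if "j \<in> R" for j using f_r[OF assms that] by (cases "j = i") simp_all
  then have "flag (r i x) = flag x" unfolding flag_def by (rule image_cong[OF refl])
  then show False using flag_inj r_ne r_closed assms by metis
qed

lemma flag_card: "x \<in> X \<Longrightarrow> card (flag x) = n + 2"
  unfolding flag_def by (subst card_image) (auto simp: inj_on_def dest: f_eq_rank)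

lemma flag_diff:
  assumes "x \<in> X" "i \<in> N"
  shows "flag x - flag (r i x) = {f i x}"
proof -
  have "i \<in> R" "r i x \<in> X" using assms r_closed by auto
  then have "f j x \<in> flag (r i x) \<longleftrightarrow> j \<noteq> i" if "j \<in> R" for j
    using mem_flag[of "r i x" x j] that assms f_r f_r_ne by metis
  then show ?thesis using \<open>i \<in> R\<close> by (auto simp: flag_def[of x])
qed

lemma adjacent_flag:
  assumes "x \<in> X" "i \<in> N"
  shows "adjacent (flag x) (flag (r i x))"
  using flag_diff[OF assms] flag_diff[of "r i x" i] r_closed r_r assms by (simp add: adjacent_def)

lemma L_connected: "strongly_flag_connected L"
  unfolding strongly_flag_connected_def flags_eq
proof (intro ballI)
  fix \<Phi> \<Psi> assume "\<Phi> \<in> flag ` X" "\<Psi> \<in> flag ` X"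
  then obtain x y where x: "x \<in> X" "\<Phi> = flag x" and y: "y \<in> X" "\<Psi> = flag y" by blast
  define K where "K = {j \<in> R. f j x = f j y}"
  let ?S = "{(A, B). A \<in> flag ` X \<and> B \<in> flag ` X \<and> adjacent A B \<and> \<Phi> \<inter> \<Psi> \<subseteq> A \<and> \<Phi> \<inter> \<Psi> \<subseteq> B}"
  have int: "\<Phi> \<inter> \<Psi> \<subseteq> flag z" if z: "z \<in> orb r (N - K) x" "z \<in> X" for z
  proof
    fix F assume "F \<in> \<Phi> \<inter> \<Psi>"
    then obtain j where j: "j \<in> R" "F = f j x" "f j x \<in> flag y" using x y by (auto simp: flag_def)
    then have "j \<in> K" using mem_flag[OF y(1) x(1)] by (auto simp: K_def)
    then have "f j z = f j x" using f_orb[OF z(1) x(1)] j by auto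
    then show "F \<in> flag z" using j by (force simp: flag_def)
  qed
  \<comment> \<open>Each common face separately admits a path that keeps it;
    \<open>orb_Inter\<close> yields one path keeping all of them at once.\<close>
  have "y \<in> orb r (N - {k}) x" if "k \<in> K" for k
    using that f_eq[of k x y] x y by (auto simp: K_def)
  then have "y \<in> orb r (N - K) x" using orb_Inter x y by blast
  then have "(flag x, flag y) \<in> ?S\<^sup>*"
  proof (induction rule: orb.induct)
    case (step z i)
    have z: "z \<in> X" "r i z \<in> X" using orb_closed[OF step(1)] r_closed x step(2) by auto
    have "(flag z, flag (r i z)) \<in> ?S"
      using int[OF step(1) z(1)] int[OF orb.step[OF step(1,2)] z(2)] z adjacent_flag[OF z(1)] step(2)
      by blast
    then show ?case using step.IH by (rule rtrancl_into_rtrancl[rotated])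
  qed simp
  then show "(\<Phi>, \<Psi>) \<in> ?S\<^sup>*" using x y by simp
qed

text \<open>A face H between F and G is put into a flag z that agrees with x at the two outer ranks.
  A path from x to z avoiding these ranks consists of steps of rank j and steps far from j, so H is
  one of the two j-faces at x and \<open>r j x\<close>.\<close>

lemma L_diamond:
  assumes "(F, G) \<in> le L" "rank L F = j - 1" "rank L G = j + 1"
  shows "card {H \<in> faces L. rank L H = j \<and> (F, H) \<in> le L \<and> (H, G) \<in> le L} = 2"
proof -
  obtain a b x where x: "F = f a x" "G = f b x" "x \<in> X" "a \<in> R" "b \<in> R"
    using assms(1) unfolding le_L by blast
  then have ab: "a = j - 1" "b = j + 1" using assms rank_f by auto
  then have j: "j \<in> N" "j \<in> R" using x by auto
  have rx: "r j x \<in> X" "f a (r j x) = F" "f b (r j x) = G" using f_r r_closed x j ab by auto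
  have "{H \<in> faces L. rank L H = j \<and> (F, H) \<in> le L \<and> (H, G) \<in> le L} = {f j x, f j (r j x)}" (is "?S = _")
  proof (intro equalityI subsetI)
    fix H assume "H \<in> ?S"
    then have H: "H \<in> faces L" "rank L H = j" "(f a x, H) \<in> le L" "(H, f b x) \<in> le L" using x by auto
    obtain i y where "H = f i y" "i \<in> R" "y \<in> X" using H(1) by (rule faces_cases)
    then have y: "H = f j y" "y \<in> X" using rank_f H(2) by auto
    then obtain u v where u: "u \<in> X" "f a u = f a x" "f j u = H" and v: "v \<in> X" "f j v = H" "f b v = f b x"
      using H y(1) le_iff[OF x(4) j(2) x(3) y(2)] le_iff[OF j(2) x(5) y(2) x(3)] by auto
    obtain z where z: "z \<in> X" "\<And>i. i \<in> R \<Longrightarrow> i \<le> j \<Longrightarrow> f i z = f i u"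
      "\<And>i. i \<in> R \<Longrightarrow> j \<le> i \<Longrightarrow> f i z = f i v"
      using splice[OF u(1) v(1) j(2)] u v by metis
    have fz: "f a z = f a x" "f b z = f b x" "f j z = H"
      using z(2)[of a] z(3)[of b] z(2)[of j] u v x ab j by simp_all
    have "z \<in> orb r (N - {k}) x" if "k \<in> {a, b}" for k
      using that f_eq[of k x z] fz x z(1) by auto
    then have "z \<in> orb r (N - {a, b}) x" by (rule orb_Inter[OF x(3) z(1)])
    \<comment> \<open>With a = j - 1 and b = j + 1 removed, every remaining rank other than j is at
      distance at least 2 from j, so the steps of rank j can be collected first.\<close>
    then have "z \<in> orb r ((N - {a, b, j}) \<union> {j}) x" by (rule orb_mono) auto
    then obtain w where w: "w \<in> orb r {j} x" "z \<in> orb r (N - {a, b, j}) w"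
      by (rule orb_commute) (use x j ab in auto)
    have "w = x \<or> w = r j x" using orb_singleton[OF w(1)] j x by blast
    moreover have "f j z = f j w" using f_orb[OF w(2)] calculation rx(1) x(3) j by auto
    ultimately show "H \<in> {f j x, f j (r j x)}" using \<open>f j z = H\<close> by auto
  next
    fix H assume "H \<in> {f j x, f j (r j x)}"
    then obtain z where z: "z \<in> X" "H = f j z" "f a z = F" "f b z = G" using rx x by auto
    then have "(F, H) \<in> le L" "(H, G) \<in> le L"
      using le_iff[of a j z z] le_iff[of j b z z] x j ab by auto
    then show "H \<in> ?S" using z faces_L rank_f j by blast
  qed
  then show ?thesis using f_r_ne[OF x(3) j(1)] by auto
qed

lemma extreme_face:
  assumes "j = -1 \<or> j = int n"
  shows "f j x0 \<in> faces L" "rank L (f j x0) = j"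
    "G \<in> faces L \<Longrightarrow> \<exists>x\<in>X. \<exists>k\<in>R. G = f k x \<and> f j x = f j x0"
proof -
  have j: "j \<in> R" "N - {j} = N" using assms by auto
  show "f j x0 \<in> faces L" "rank L (f j x0) = j" using faces_L rank_f j x0 by auto
  assume "G \<in> faces L"
  then obtain k x where "G = f k x" "k \<in> R" "x \<in> X" by (rule faces_cases)
  moreover have "f j x = f j x0" if "x \<in> X" for x
    using f_eq[OF j(1) that x0] j x0 connected[OF that x0] by simp
  ultimately show "\<exists>x\<in>X. \<exists>k\<in>R. G = f k x \<and> f j x = f j x0" by blast
qed

theorem polytope_L: "abstract_polytope n L"
  unfolding abstract_polytope_def
proof (intro conjI allI impI ballI)
  fix F assume "F \<in> faces L"
  then show "- 1 \<le> rank L F" "rank L F \<le> int n" using rank_f by (auto elim!: faces_cases)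
next
  fix F G assume "(F, G) \<in> le L \<and> F \<noteq> G"
  then obtain i j z where "F = f i z" "G = f j z" "z \<in> X" "i \<in> R" "j \<in> R" "i \<le> j" "F \<noteq> G"
    unfolding le_L by blast
  then show "rank L F < rank L G" using rank_f by (cases "i = j") auto
next
  have "(f (-1) x0, G) \<in> le L" "(G, f (int n) x0) \<in> le L" if G: "G \<in> faces L" for G
  proof -
    obtain x k where "x \<in> X" "k \<in> R" "G = f k x" "f (-1) x = f (-1) x0"
      using extreme_face(3)[of "-1" G] G by blast
    moreover obtain y l where "y \<in> X" "l \<in> R" "G = f l y" "f (int n) y = f (int n) x0"
      using extreme_face(3)[of "int n" G] G by blast
    ultimately show "(f (-1) x0, G) \<in> le L" "(G, f (int n) x0) \<in> le L"
      using le_iff[of "-1" k x0 x] le_iff[of l "int n" y x0] x0 by auto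
  qed
  then show "\<exists>F\<in>faces L. rank L F = - 1 \<and> (\<forall>G\<in>faces L. (F, G) \<in> le L)"
    "\<exists>F\<in>faces L. rank L F = int n \<and> (\<forall>G\<in>faces L. (G, F) \<in> le L)"
    using extreme_face by blast+
next
  fix \<Phi> assume "\<Phi> \<in> flags L"
  then show "card \<Phi> = n + 2" using flags_eq flag_card by auto
next
  show "base_flag L \<in> flags L" using base_L x0 by (auto simp: flags_eq flag_def)
qed (use partial_order L_connected L_diamond in auto)

sublocale L: polytope n L
  by unfold_locales (rule polytope_L)

lemma flag_L_adj:
  assumes "x \<in> X" "i \<in> N"
  shows "flag_adj L i (flag x) = flag (r i x)"
proof -
  have fl: "flag x \<in> flags L" "flag (r i x) \<in> flags L" using assms r_closed flags_eq by auto
  have fc: "L.fc (flag y) k = f k y" if "y \<in> X" "k \<in> R" for y k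
    using L.fc_eq[of "flag y" "f k y"] rank_f that flags_eq by (auto simp: flag_def)
  show ?thesis
  proof (rule L.r_eqI[OF fl assms(2)])
    show "flag (r i x) \<noteq> flag x" using flag_inj r_ne r_closed assms by metis
    show "L.fc (flag (r i x)) k = L.fc (flag x) k" if "k \<in> R" "k \<noteq> i" for k
      using fc f_r r_closed assms that by simp
  qed
qed

end

section \<open>Groups with specified generators\<close>

locale group_family = group G for G (structure) +
  fixes n :: nat and \<sigma> :: "nat \<Rightarrow> 'a"
  assumes \<sigma>_closed: "i \<in> {1..<n} \<Longrightarrow> \<sigma> i \<in> carrier G"
begin

lemma \<tau>_empty: "j < i \<Longrightarrow> \<tau> G \<sigma> i j = \<one>"
  by (simp add: \<tau>_def)

lemma \<tau>_Cons: "i \<le> j \<Longrightarrow> \<tau> G \<sigma> i j = \<sigma> i \<otimes> \<tau> G \<sigma> (Suc i) j"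
  unfolding \<tau>_def by (subst upt_conv_Cons) auto

lemma \<tau>_closed: "1 \<le> i \<Longrightarrow> j < n \<Longrightarrow> \<tau> G \<sigma> i j \<in> carrier G"
proof (induction "Suc j - i" arbitrary: i)
  case (Suc k)
  then have "i \<le> j" by simp
  then show ?case using Suc \<sigma>_closed[of i] \<tau>_Cons[of i j] by simp
qed (simp add: \<tau>_empty)

lemma \<tau>_generate:
  "1 \<le> i \<Longrightarrow> j < n \<Longrightarrow> \<tau> G \<sigma> i j \<in> generate G (\<sigma> ` {i..j})"
proof (induction "Suc j - i" arbitrary: i)
  case (Suc k)
  then have "i \<le> j" by simp
  moreover have "\<sigma> i \<in> generate G (\<sigma> ` {i..j})"
    by (rule generate.incl) (use \<open>i \<le> j\<close> in auto)
  moreover have "\<tau> G \<sigma> (Suc i) j \<in> generate G (\<sigma> ` {i..j})"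
    by (rule subsetD[OF mono_generate Suc.hyps(1)]) (use Suc in auto)
  ultimately show ?case using \<tau>_Cons[of i j] by (simp add: generate.eng)
qed (simp add: \<tau>_empty generate.one)

text \<open>Ranks start at 0 and generators at 1: the generator numbered i links ranks i - 1 and i,
  so those inside the ranks m to k are numbered from \<open>nat m + 1\<close> to
  \<open>nat k\<close>.\<close>

lemma G_sub_interval_generate:
  assumes "0 \<le> m" "k < int n"
  shows "G_sub n G \<sigma> {m..k} \<subseteq> generate G (\<sigma> ` {nat m + 1..nat k})"
proof -
  have "\<tau> G \<sigma> i j \<in> generate G (\<sigma> ` {nat m + 1..nat k})"
    if "1 \<le> i" "i \<le> j" "j < n" "int i - 1 \<in> {m..k}" "int j \<in> {m..k}" for i j
  proof (rule subsetD[OF mono_generate \<tau>_generate])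
    show "\<sigma> ` {i..j} \<subseteq> \<sigma> ` {nat m + 1..nat k}" by (rule image_mono) (use that assms in auto)
  qed (use that in auto)
  moreover have "subgroup (generate G (\<sigma> ` {nat m + 1..nat k})) G"
    by (rule generate_is_subgroup) (use \<sigma>_closed assms in auto)
  ultimately show ?thesis unfolding G_sub_def by (intro generate_subgroup_incl) auto
qed

lemma G_sub_subset_generate: "G_sub n G \<sigma> {0..<int n} \<subseteq> generate G (\<sigma> ` {1..<n})"
proof -
  have "{0..<int n} = {0..int n - 1}" "{nat 0 + 1..nat (int n - 1)} \<subseteq> {1..<n}" by auto
  then show ?thesis
    using G_sub_interval_generate[of 0 "int n - 1"]
      mono_generate[OF image_mono[of "{nat 0 + 1..nat (int n - 1)}" "{1..<n}" \<sigma>]] by auto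
qed

lemma \<tau>_single: "1 \<le> i \<Longrightarrow> i < n \<Longrightarrow> \<tau> G \<sigma> i i = \<sigma> i"
  using \<tau>_Cons[of i i] \<tau>_empty[of i "Suc i"] \<sigma>_closed[of i] by simp

lemma \<tau>_split:
  assumes "1 \<le> i" "i \<le> k" "k \<le> Suc j" "j < n"
  shows "\<tau> G \<sigma> i j = \<tau> G \<sigma> i (k - 1) \<otimes> \<tau> G \<sigma> k j"
  using assms
proof (induction "k - i" arbitrary: i)
  case 0
  then show ?case using \<tau>_empty[of "k - 1" i] \<tau>_closed[of k j] by simp
next
  case (Suc m)
  have i: "i \<in> {1..<n}" "i \<le> j" "i \<le> k - 1" "k - 1 < n" using Suc by auto
  have "\<tau> G \<sigma> (Suc i) j = \<tau> G \<sigma> (Suc i) (k - 1) \<otimes> \<tau> G \<sigma> k j" using Suc by simp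
  then show ?case
    using \<tau>_Cons[of i] i \<tau>_closed[of "Suc i" "k - 1"] \<tau>_closed[of k j] \<sigma>_closed[of i] Suc.prems
    by (simp add: m_assoc)
qed

text \<open>Prefix products turn each consecutive product into a quotient:
  \<open>\<tau> G \<sigma> i j\<close> is the inverse of t (i - 1) times t j. Every index set then
  generates all quotients of its prefix products, in either order, and mirroring becomes inversion
  of each prefix product.\<close>

definition t :: "int \<Rightarrow> 'a" where
  "t i = \<tau> G \<sigma> 1 (nat i)"

lemma t_closed [simp]: "0 \<le> i \<Longrightarrow> i < int n \<Longrightarrow> t i \<in> carrier G"
  unfolding t_def by (rule \<tau>_closed) auto

lemma t_0 [simp]: "t 0 = \<one>"
  by (simp add: t_def \<tau>_empty)

lemma t_diff:
  assumes "0 \<le> a" "a < b" "b < int n"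
  shows "inv (t a) \<otimes> t b = \<tau> G \<sigma> (nat a + 1) (nat b)"
proof -
  have *: "nat b < n" "nat a < n" using assms by auto
  have "t b = t a \<otimes> \<tau> G \<sigma> (nat a + 1) (nat b)"
    using \<tau>_split[of 1 "nat a + 1" "nat b"] assms * by (simp add: t_def)
  then show ?thesis
    using \<tau>_closed[of "nat a + 1" "nat b"] * assms by (simp add: m_assoc[symmetric])
qed

lemma t_diff_\<sigma>:
  assumes "i \<in> {1..<n}"
  shows "inv (t (int i - 1)) \<otimes> t (int i) = \<sigma> i"
proof -
  have "nat (int i - 1) + 1 = i" using assms by auto
  then show ?thesis using t_diff[of "int i - 1" "int i"] \<tau>_single[of i] assms by simp
qed

lemma G_sub_eq:
  assumes "I \<subseteq> {0..<int n}"
  shows "G_sub n G \<sigma> I = generate G {inv (t a) \<otimes> t b | a b. a \<in> I \<and> b \<in> I \<and> a < b}"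
proof -
  have "{\<tau> G \<sigma> i j | i j. 1 \<le> i \<and> i \<le> j \<and> j < n \<and> int i - 1 \<in> I \<and> int j \<in> I} =
    {inv (t a) \<otimes> t b | a b. a \<in> I \<and> b \<in> I \<and> a < b}" (is "?A = ?B")
  proof (intro equalityI subsetI)
    fix x assume "x \<in> ?A"
    then obtain i j where ij: "x = \<tau> G \<sigma> i j" "1 \<le> i" "i \<le> j" "j < n" "int i - 1 \<in> I" "int j \<in> I" by blast
    moreover have "nat (int i - 1) + 1 = i" using ij by simp
    ultimately have "x = inv (t (int i - 1)) \<otimes> t (int j)" using t_diff[of "int i - 1" "int j"] by simp
    then show "x \<in> ?B" using ij by (intro CollectI exI[of _ "int i - 1"] exI[of _ "int j"]) auto
  next
    fix x assume "x \<in> ?B"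
    then obtain a b where ab: "x = inv (t a) \<otimes> t b" "a \<in> I" "b \<in> I" "a < b" by blast
    then have "0 \<le> a" "b < int n" using assms by auto
    then show "x \<in> ?A" using ab t_diff[of a b]
      by (intro CollectI exI[of _ "nat a + 1"] exI[of _ "nat b"]) auto
  qed
  then show ?thesis by (simp add: G_sub_def)
qed

lemma G_sub_closed:
  assumes "I \<subseteq> {0..<int n}"
  shows "G_sub n G \<sigma> I \<subseteq> carrier G"
proof -
  have "inv (t a) \<otimes> t b \<in> carrier G" if "a \<in> I" "b \<in> I" for a b
  proof -
    have "a \<in> {0..<int n}" "b \<in> {0..<int n}" using that assms by auto
    then show ?thesis by simp
  qed
  then show ?thesis unfolding G_sub_eq[OF assms] by (intro generate_incl) blast
qed

lemma G_sub_mult: "x \<in> G_sub n G \<sigma> I \<Longrightarrow> y \<in> G_sub n G \<sigma> I \<Longrightarrow> x \<otimes> y \<in> G_sub n G \<sigma> I"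
  unfolding G_sub_def by (rule generate.eng)

lemma t_diff_G_sub:
  assumes "a \<in> I" "b \<in> I" "I \<subseteq> {0..<int n}"
  shows "inv (t a) \<otimes> t b \<in> G_sub n G \<sigma> I"
proof -
  have n: "0 \<le> a" "0 \<le> b" "a < int n" "b < int n" using assms by auto
  have *: "inv (t a) \<otimes> t b \<in> G_sub n G \<sigma> I" if "a \<in> I" "b \<in> I" "a < b" for a b
    unfolding G_sub_eq[OF assms(3)] by (rule generate.incl) (use that in blast)
  consider "a < b" | "a = b" | "b < a" by linarith
  then show ?thesis
  proof cases
    case 1
    then show ?thesis using * assms by blast
  next
    case 2
    then have "inv (t a) \<otimes> t b = \<one>" using n assms by auto
    then show ?thesis by (simp add: G_sub_def generate.one)
  next
    case 3
    have "{inv (t a) \<otimes> t b | a b. a \<in> I \<and> b \<in> I \<and> a < b} \<subseteq> carrier G"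
      using t_closed assms(3) by (auto intro!: m_closed inv_closed)
    then have "inv (inv (t b) \<otimes> t a) \<in> G_sub n G \<sigma> I"
      using *[OF assms(2,1) 3] generate_m_inv_closed unfolding G_sub_eq[OF assms(3)] by blast
    then show ?thesis using n by (simp add: inv_mult_group)
  qed
qed

text \<open>The flag graph: \<open>(g, False)\<close> stands for the image of the base flag $\Phi$ under \<open>g\<close> and
  \<open>(g, True)\<close> for that of $\Phi^0$.\<close>

definition rr :: "int \<Rightarrow> 'a \<times> bool \<Rightarrow> 'a \<times> bool" where
  "rr i x = (if snd x then inv (t i) \<otimes> fst x else t i \<otimes> fst x, \<not> snd x)"

abbreviation XX :: "('a \<times> bool) set" where
  "XX \<equiv> carrier G \<times> UNIV"

lemma rr_simps [simp]:
  "rr i (g, False) = (t i \<otimes> g, True)" "rr i (g, True) = (inv (t i) \<otimes> g, False)"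
  "snd (rr i x) \<longleftrightarrow> \<not> snd x"
  by (simp_all add: rr_def)

sublocale fl: involutions n XX rr
proof
  fix i x assume i: "i \<in> {0..<int n}" and x: "x \<in> XX"
  then have [simp]: "t i \<in> carrier G" by simp
  show "rr i x \<in> XX" "rr i (rr i x) = x"
    using x by (auto simp: rr_def m_assoc[symmetric])
qed

text \<open>Two steps of ranks b and a multiply an even label on the left by the quotient of the
  prefix products t a and t b, and these quotients generate \<open>G_sub\<close>. Paths of even
  length are therefore words in the subgroup.\<close>

lemma orb_even_iff:
  assumes I: "I \<subseteq> {0..<int n}" and g: "g \<in> carrier G"
  shows "(g', False) \<in> orb rr I (g, False) \<longleftrightarrow> (\<exists>h\<in>G_sub n G \<sigma> I. g' = h \<otimes> g)"
proof
  have tc: "t a \<in> carrier G" if "a \<in> I" for a using that I by auto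
  note hc = subsetD[OF G_sub_closed[OF I]]
  \<comment> \<open>The invariant must also describe the odd labels passed on the way: they carry
    one extra prefix product on the left, which the next step turns into a quotient.\<close>
  have "(\<not> snd y \<and> (\<exists>h\<in>G_sub n G \<sigma> I. fst y = h \<otimes> g)) \<or>
        (snd y \<and> (\<exists>a\<in>I. \<exists>h\<in>G_sub n G \<sigma> I. fst y = t a \<otimes> (h \<otimes> g)))"
    if "y \<in> orb rr I (g, False)" for y
    using that
  proof (induction rule: orb.induct)
    case base
    have "\<one> \<in> G_sub n G \<sigma> I" by (simp add: G_sub_def generate.one)
    then show ?case using g by force
  next
    case (step y i)
    from step(3) consider h where "\<not> snd y" "h \<in> G_sub n G \<sigma> I" "fst y = h \<otimes> g"
      | a h where "snd y" "a \<in> I" "h \<in> G_sub n G \<sigma> I" "fst y = t a \<otimes> (h \<otimes> g)" by blast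
    then show ?case
    proof cases
      case 1
      then have "snd (rr i y)" "fst (rr i y) = t i \<otimes> (h \<otimes> g)" by (simp_all add: rr_def)
      then show ?thesis using step(2) 1(2) by blast
    next
      case 2
      have "inv (t i) \<otimes> t a \<otimes> h \<in> G_sub n G \<sigma> I"
        using t_diff_G_sub[OF step(2) 2(2) I] 2(3) by (rule G_sub_mult)
      moreover have "fst (rr i y) = (inv (t i) \<otimes> t a \<otimes> h) \<otimes> g"
        using 2 tc step(2) hc g by (simp add: rr_def m_assoc)
      moreover have "\<not> snd (rr i y)" using 2(1) by simp
      ultimately show ?thesis by blast
    qed
  qed
  then show "(g', False) \<in> orb rr I (g, False) \<Longrightarrow> \<exists>h\<in>G_sub n G \<sigma> I. g' = h \<otimes> g"
    by fastforce
next
  have tc: "t a \<in> carrier G" if "a \<in> I" for a using that I by auto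
  have two: "(inv (t a) \<otimes> t b \<otimes> g, False) \<in> orb rr I (g, False)"
    if "a \<in> I" "b \<in> I" "g \<in> carrier G" for a b g
  proof -
    have "rr a (rr b (g, False)) \<in> orb rr I (g, False)"
      using that by (intro orb.intros)
    then show ?thesis using that tc by (simp add: m_assoc)
  qed
  have "\<forall>g\<in>carrier G. (h \<otimes> g, False) \<in> orb rr I (g, False)" if "h \<in> G_sub n G \<sigma> I" for h
    using that unfolding G_sub_eq[OF I]
  proof (induction rule: generate.induct)
    case one
    then show ?case by (simp add: orb.base)
  next
    case (incl h)
    then show ?case using two by blast
  next
    case (inv h)
    then obtain a b where "h = inv (t a) \<otimes> t b" "a \<in> I" "b \<in> I" by blast
    then have "inv h = inv (t b) \<otimes> t a" "a \<in> I" "b \<in> I" using tc by (simp_all add: inv_mult_group)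
    then show ?case using two by simp
  next
    case (eng h1 h2)
    then have c: "h1 \<in> carrier G" "h2 \<in> carrier G"
      using G_sub_closed[OF I] unfolding G_sub_eq[OF I] by auto
    show ?case
    proof
      fix g assume g: "g \<in> carrier G"
      have "(h1 \<otimes> (h2 \<otimes> g), False) \<in> orb rr I (h2 \<otimes> g, False)"
        "(h2 \<otimes> g, False) \<in> orb rr I (g, False)" using eng g c by auto
      then have "(h1 \<otimes> (h2 \<otimes> g), False) \<in> orb rr I (g, False)" by (rule orb_trans)
      then show "(h1 \<otimes> h2 \<otimes> g, False) \<in> orb rr I (g, False)" using c g by (simp add: m_assoc)
    qed
  qed
  then show "\<exists>h\<in>G_sub n G \<sigma> I. g' = h \<otimes> g \<Longrightarrow> (g', False) \<in> orb rr I (g, False)"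
    using g by blast
qed

text \<open>Left and right multiplication commute; right translations will become
  automorphisms.\<close>

lemma translate_rr:
  assumes "i \<in> {0..<int n}" "x \<in> XX" "c \<in> carrier G"
  shows "map_prod (\<lambda>g. g \<otimes> c) id (rr i x) = rr i (map_prod (\<lambda>g. g \<otimes> c) id x)"
  using assms t_closed[of i] by (auto simp: rr_def m_assoc)

end

text \<open>All of these conditions are stable under products of coprime type and under reversal of
  the generators. \<open>nontrivial\<close> amounts to the prefix products being pairwise distinct,
  which is what \<open>t_inj\<close> extracts.\<close>

locale rotation_system = group_family +
  assumes n_pos: "0 < n"
    and generated: "generate G (\<sigma> ` {1..<n}) = carrier G"
    and involution: "1 \<le> i \<Longrightarrow> i < j \<Longrightarrow> j < n \<Longrightarrow> \<tau> G \<sigma> i j \<otimes> \<tau> G \<sigma> i j = \<one>"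
    and nontrivial: "1 \<le> i \<Longrightarrow> i \<le> j \<Longrightarrow> j < n \<Longrightarrow> \<tau> G \<sigma> i j \<noteq> \<one>"
    and intersection: "0 \<le> m \<Longrightarrow> m \<le> k \<Longrightarrow> k < int n \<Longrightarrow>
      G_sub n G \<sigma> {0..k} \<inter> G_sub n G \<sigma> {m..<int n} \<subseteq> G_sub n G \<sigma> {m..k}"
begin

lemma G_sub_all: "G_sub n G \<sigma> {0..<int n} = carrier G"
proof -
  have "\<sigma> i \<in> G_sub n G \<sigma> {0..<int n}" if "i \<in> {1..<n}" for i
    using t_diff_G_sub[of "int i - 1" "{0..<int n}" "int i"] t_diff_\<sigma>[OF that] that by auto
  moreover have "subgroup (G_sub n G \<sigma> {0..<int n}) G"
    unfolding G_sub_eq[OF order.refl] by (rule generate_is_subgroup) auto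
  ultimately have "generate G (\<sigma> ` {1..<n}) \<subseteq> G_sub n G \<sigma> {0..<int n}"
    by (intro generate_subgroup_incl) auto
  then show ?thesis using generated G_sub_closed[of "{0..<int n}"] by auto
qed

lemma t_inj:
  assumes "t a = t b" "a \<in> {0..<int n}" "b \<in> {0..<int n}"
  shows "a = b"
proof -
  have False if "t a = t b" "a \<in> {0..<int n}" "b \<in> {0..<int n}" "a < b" for a b
  proof -
    have "\<tau> G \<sigma> (nat a + 1) (nat b) = \<one>" using t_diff[of a b] that by simp
    moreover have "nat b < n" "nat a + 1 \<le> nat b" using that by auto
    ultimately show False using nontrivial by simp
  qed
  then show ?thesis using assms by (metis linorder_neqE)
qed

text \<open>For ranks at distance at least 2 the quotient of the two prefix products is a product of
  at least two generators, hence equal to its own inverse. This settles even labels; conjugating by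
  t i gives the version \<open>e'\<close> needed for odd ones.\<close>

lemma rr_commute:
  assumes "i \<in> {0..<int n}" "j \<in> {0..<int n}" "\<bar>i - j\<bar> \<ge> 2" "x \<in> XX"
  shows "rr i (rr j x) = rr j (rr i x)"
proof -
  have *: "inv (t i) \<otimes> t j = inv (t j) \<otimes> t i"
    if "i \<in> {0..<int n}" "j \<in> {0..<int n}" "i + 2 \<le> j" for i j
  proof -
    have "nat j < n" "nat i + 1 < nat j" using that by auto
    then have "(inv (t i) \<otimes> t j) \<otimes> (inv (t i) \<otimes> t j) = \<one>"
      using t_diff[of i j] that involution by simp
    then have "inv (inv (t i) \<otimes> t j) = inv (t i) \<otimes> t j" using that by (simp add: inv_equality)
    then show ?thesis using that by (simp add: inv_mult_group)
  qed
  have c: "t i \<in> carrier G" "t j \<in> carrier G" using assms by auto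
  have e: "inv (t i) \<otimes> t j = inv (t j) \<otimes> t i"
    using *[of i j] *[of j i] assms by (cases "i \<le> j") auto
  have "t j \<otimes> inv (t i) = t i \<otimes> (inv (t i) \<otimes> t j) \<otimes> inv (t i)"
    using c by (simp add: m_assoc[symmetric])
  also have "\<dots> = t i \<otimes> inv (t j)" unfolding e using c by (simp add: m_assoc)
  finally have e': "t j \<otimes> inv (t i) = t i \<otimes> inv (t j)" .
  show ?thesis using assms(4) c e e'
    by (cases "snd x") (auto simp: rr_def m_assoc[symmetric])
qed

lemma orb_all_even: "g \<in> carrier G \<Longrightarrow> h \<in> carrier G \<Longrightarrow> (h, False) \<in> orb rr {0..<int n} (g, False)"
  using orb_even_iff[of "{0..<int n}" g h] G_sub_all by (force intro: bexI[of _ "h \<otimes> inv g"] simp: m_assoc)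

text \<open>Membership in the subgroups only describes even labels. An odd label is made even by one
  step of a rank a in \<open>I\<close>, which does not leave the orbit.\<close>

lemma orb_reduce:
  assumes a: "a \<in> I" and I: "I \<subseteq> {0..<int n}" and x: "x \<in> XX" and y: "y \<in> XX"
    and even: "\<And>x' y'. x' \<in> XX \<Longrightarrow> y' \<in> XX \<Longrightarrow> \<not> snd x' \<Longrightarrow> \<not> snd y' \<Longrightarrow>
      x' \<in> orb rr {a} x \<Longrightarrow> y' \<in> orb rr {a} y \<Longrightarrow> y' \<in> orb rr I x'"
  shows "y \<in> orb rr I x"
proof -
  define ev where "ev z = (if snd z then rr a z else z)" for z
  have aN: "a \<in> {0..<int n}" using a I by auto
  have ev: "ev z \<in> XX" "\<not> snd (ev z)" "ev z \<in> orb rr {a} z" if "z \<in> XX" for z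
    using fl.r_closed[OF aN that] orb.base orb_single[of a "{a}" rr z] that unfolding ev_def by auto
  have "ev y \<in> orb rr I (ev x)" using even[OF ev(1)[OF x] ev(1)[OF y]] ev x y by blast
  moreover have "y \<in> orb rr I (ev y)"
    by (rule orb_mono[OF fl.orb_sym[OF ev(3)[OF y]]]) (use y aN a in auto)
  moreover have "ev x \<in> orb rr I x" by (rule orb_mono[OF ev(3)[OF x]]) (use a in auto)
  ultimately show ?thesis using orb_trans by metis
qed

lemma orb_all: "x \<in> XX \<Longrightarrow> y \<in> XX \<Longrightarrow> y \<in> orb rr {0..<int n} x"
  by (rule orb_reduce[of 0]) (use n_pos orb_all_even in auto)

lemma path_intersection_le:
  assumes "x \<in> XX" "y \<in> XX" and mk: "0 \<le> m" "m \<le> k" "k < int n"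
    and yk: "y \<in> orb rr {0..k} x" and ym: "y \<in> orb rr {m..<int n} x"
  shows "y \<in> orb rr {m..k} x"
proof (rule orb_reduce[of m])
  fix x' y' assume x': "x' \<in> XX" "\<not> snd x'" "x' \<in> orb rr {m} x"
    and y': "y' \<in> XX" "\<not> snd y'" "y' \<in> orb rr {m} y"
  have x: "x \<in> orb rr {m} x'" using fl.orb_sym[OF x'(3)] mk assms by auto
  have "y' \<in> orb rr I x'" if I: "m \<in> I" "y \<in> orb rr I x" for I
  proof -
    have m: "{m} \<subseteq> I" using I by simp
    show ?thesis by (rule orb_trans[OF orb_mono[OF y'(3) m] orb_trans[OF I(2) orb_mono[OF x m]]])
  qed
  then have "y' \<in> orb rr {0..k} x'" "y' \<in> orb rr {m..<int n} x'" using yk ym mk by auto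
  moreover obtain g h where gh: "x' = (g, False)" "y' = (h, False)" "g \<in> carrier G" "h \<in> carrier G"
    using x' y' by auto
  moreover have sub: "{0..k} \<subseteq> {0..<int n}" "{m..<int n} \<subseteq> {0..<int n}" using mk by auto
  ultimately obtain u v where uv: "u \<in> G_sub n G \<sigma> {0..k}" "h = u \<otimes> g" "v \<in> G_sub n G \<sigma> {m..<int n}" "h = v \<otimes> g"
    using orb_even_iff[OF sub(1), of g h] orb_even_iff[OF sub(2), of g h] by blast
  with sub have "u \<in> carrier G" "v \<in> carrier G" using G_sub_closed by blast+
  then have "u = v" using uv gh(3) by simp
  then have "u \<in> G_sub n G \<sigma> {m..k}" using uv intersection[OF mk] by blast
  moreover have "{m..k} \<subseteq> {0..<int n}" using mk by auto
  ultimately show "y' \<in> orb rr {m..k} x'" using orb_even_iff[of "{m..k}" g h] gh uv(2) by blast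
qed (use assms in auto)

lemma path_intersection_core:
  assumes "x \<in> XX" "y \<in> XX" and m: "m \<in> {0..<int n}" and k: "k \<in> {0..<int n}"
    and yk: "y \<in> orb rr {0..k} x" and ym: "y \<in> orb rr {m..<int n} x"
  shows "y \<in> orb rr {m..k} x"
proof (cases "m \<le> k")
  case True
  then show ?thesis using path_intersection_le assms by auto
next
  case False
  \<comment> \<open>With m above k the target segment is empty. Enlarging one segment at a time
    shows that y is reached from x by rank k alone and also by rank m alone; as \<open>t k\<close>
    and \<open>t m\<close> differ, y must be x.\<close>
  have "y \<in> orb rr {k..<int n} x" by (rule orb_mono[OF ym]) (use False in auto)
  then have "y \<in> orb rr {k..k} x" using path_intersection_le[of x y k k] assms by auto
  then have 1: "y = x \<or> y = rr k x" using fl.orb_singleton[of y k x] assms by auto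
  have "y \<in> orb rr {0..m} x" by (rule orb_mono[OF yk]) (use False in auto)
  then have "y \<in> orb rr {m..m} x" using path_intersection_le[of x y m m] assms by auto
  then have 2: "y = x \<or> y = rr m x" using fl.orb_singleton[of y m x] assms by auto
  have "rr k x \<noteq> rr m x"
  proof
    assume "rr k x = rr m x"
    moreover have "t k \<in> carrier G" "t m \<in> carrier G" using m k by auto
    ultimately have "t k = t m" using assms(1) by (auto simp: rr_def split: if_splits)
    then show False using t_inj[OF _ k m] False by auto
  qed
  then have "y = x" using 1 2 by auto
  then show ?thesis by (simp add: orb.base)
qed

sublocale fl: maniplex n XX rr
proof
  fix x y k m assume x: "x \<in> XX" "y \<in> XX"
    and yk: "y \<in> orb rr ({0..k} \<inter> {0..<int n}) x" and ym: "y \<in> orb rr ({m..} \<inter> {0..<int n}) x"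
  show "y \<in> orb rr ({m..k} \<inter> {0..<int n}) x"
  proof (cases "{0..k} \<inter> {0..<int n} = {} \<or> {m..} \<inter> {0..<int n} = {}")
    case True
    then have "y = x" using yk ym orb_empty by metis
    then show ?thesis by (simp add: orb.base)
  next
    case False
    define k' m' where "k' = min k (int n - 1)" and "m' = max m 0"
    have "k' \<in> {0..<int n}" "m' \<in> {0..<int n}" using False by (auto simp: k'_def m'_def)
    moreover have "{0..k} \<inter> {0..<int n} = {0..k'}" "{m..} \<inter> {0..<int n} = {m'..<int n}"
      "{m..k} \<inter> {0..<int n} = {m'..k'}" by (auto simp: k'_def m'_def)
    ultimately show ?thesis using path_intersection_core[OF x] yk ym by simp
  qed
next
  fix i x assume "x \<in> XX" show "rr i x \<noteq> x" using rr_simps(3) by metis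
qed (use rr_commute orb_all in auto)

end

section \<open>The coset poset\<close>

locale coset_polytope = rotation_system +
  assumes n_ge_3: "3 \<le> n"
begin

text \<open>Only the even flags of the orbit are recorded, identified with group elements. This
  makes the face literally a right coset of \<open>face_group\<close>, tagged with its rank.\<close>

definition face :: "int \<Rightarrow> 'a \<times> bool \<Rightarrow> int \<times> 'a set" where
  "face j x = (j, {g \<in> carrier G. (g, False) \<in> orb rr ({0..<int n} - {j}) x})"

lemma face_even:
  assumes "g \<in> carrier G"
  shows "face j (g, False) = (j, face_group n G \<sigma> j #> g)"
proof -
  have N: "{0..int n - 1} - {j} = {0..<int n} - {j}" by auto
  show ?thesis
    using orb_even_iff[of "{0..<int n} - {j}" g] G_sub_closed[of "{0..<int n} - {j}"] assms
    unfolding face_def face_group_def N r_coset_def by auto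
qed

text \<open>Faces record even flags only, so an odd flag must have an even neighbour through the
  same two faces. That takes a rank besides i and j, and hence at least three ranks; one of 0, 1, 2
  always serves.\<close>

lemma even_in_orb:
  assumes "x \<in> XX"
  obtains g where "g \<in> carrier G" "(g, False) \<in> orb rr ({0..<int n} - {i, j}) x"
proof (cases "snd x")
  case True
  define a :: int where "a = (if i \<noteq> 0 \<and> j \<noteq> 0 then 0 else if i \<noteq> 1 \<and> j \<noteq> 1 then 1 else 2)"
  have a: "a \<in> {0..<int n} - {i, j}" using n_ge_3 by (auto simp: a_def)
  then have "rr a x \<in> orb rr ({0..<int n} - {i, j}) x" "rr a x \<in> XX"
    using orb_single fl.r_closed assms by (metis, blast)
  moreover have "rr a x = (fst (rr a x), False)" using True rr_simps(3)[of a x] by (metis prod.collapse)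
  ultimately show ?thesis using that by (metis mem_Sigma_iff)
next
  case False
  then have "x = (fst x, False)" "fst x \<in> carrier G" using assms by auto
  then show ?thesis using that[of "fst x"] orb.base[of x] by metis
qed

lemma face_eq_iff:
  assumes "x \<in> XX" "y \<in> XX"
  shows "face j x = face j y \<longleftrightarrow> y \<in> orb rr ({0..<int n} - {j}) x" (is "_ \<longleftrightarrow> _ \<in> ?O x")
proof
  assume eq: "face j x = face j y"
  obtain g where g: "g \<in> carrier G" "(g, False) \<in> ?O x" using even_in_orb[OF assms(1), of j j] by auto
  then have "(g, False) \<in> ?O y" using eq unfolding face_def by blast
  then have "y \<in> ?O (g, False)" using fl.orb_sym assms by blast
  then show "y \<in> ?O x" using g(2) by (rule orb_trans)
next
  assume y: "y \<in> ?O x"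
  then have x: "x \<in> ?O y" using fl.orb_sym assms by blast
  have "z \<in> ?O x \<longleftrightarrow> z \<in> ?O y" for z using orb_trans[OF _ y, of z] orb_trans[OF _ x, of z] by blast
  then show "face j x = face j y" by (simp add: face_def)
qed

lemma face_even_ex:
  assumes "x \<in> XX"
  obtains g where "g \<in> carrier G" "face j x = face j (g, False)"
  using even_in_orb[OF assms, of j j] face_eq_iff[OF assms] by (metis SigmaI UNIV_I insert_absorb2)

lemma mem_face: "x \<in> XX \<Longrightarrow> g \<in> snd (face j x) \<longleftrightarrow> g \<in> carrier G \<and> face j x = face j (g, False)"
  using face_eq_iff[of x "(g, False)" j] by (auto simp: face_def)

lemma faces_coset_poset:
  "faces (coset_poset n G \<sigma>) = {face j x | j x. j \<in> {-1..int n} \<and> x \<in> XX}"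
proof -
  have "faces (coset_poset n G \<sigma>) = {(j, face_group n G \<sigma> j #> g) | j g. j \<in> {-1..int n} \<and> g \<in> carrier G}"
    by (auto simp: coset_poset_def Let_def RCOSETS_def)
  also have "\<dots> = {face j (g, False) | j g. j \<in> {-1..int n} \<and> g \<in> carrier G}"
    using face_even by (metis (no_types, lifting))
  also have "\<dots> = {face j x | j x. j \<in> {-1..int n} \<and> x \<in> XX}" (is "?A = ?B")
  proof (intro equalityI subsetI)
    fix F assume "F \<in> ?B"
    then obtain j x where F: "F = face j x" "j \<in> {-1..int n}" "x \<in> XX" by blast
    then show "F \<in> ?A" using face_even_ex[OF F(3), of j] by blast
  qed blast
  finally show ?thesis .
qed

lemma le_coset_poset:
  "le (coset_poset n G \<sigma>) = {(face i z, face j z) | i j z. z \<in> XX \<and> i \<in> {-1..int n} \<and> j \<in> {-1..int n} \<and> i \<le> j}"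
proof -
  have "le (coset_poset n G \<sigma>) = {(A, B). A \<in> faces (coset_poset n G \<sigma>) \<and> B \<in> faces (coset_poset n G \<sigma>) \<and>
      fst A \<le> fst B \<and> snd A \<inter> snd B \<noteq> {}}"
    by (auto simp: coset_poset_def Let_def)
  also have "\<dots> = {(face i z, face j z) | i j z. z \<in> XX \<and> i \<in> {-1..int n} \<and> j \<in> {-1..int n} \<and> i \<le> j}"
    (is "?A = ?B")
  proof (intro equalityI subsetI)
    fix p assume "p \<in> ?A"
    then obtain A B g where AB: "p = (A, B)" "A \<in> faces (coset_poset n G \<sigma>)" "B \<in> faces (coset_poset n G \<sigma>)"
      "fst A \<le> fst B" "g \<in> snd A" "g \<in> snd B" by blast
    obtain i x j y where "A = face i x" "i \<in> {-1..int n}" "x \<in> XX" "B = face j y" "j \<in> {-1..int n}" "y \<in> XX"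
      using AB(2,3) unfolding faces_coset_poset by blast
    moreover have "fst (face k z) = k" for k z by (simp add: face_def)
    ultimately have p: "p = (face i x, face j y)" "i \<in> {-1..int n}" "x \<in> XX"
      "j \<in> {-1..int n}" "y \<in> XX" "i \<le> j" "g \<in> snd (face i x)" "g \<in> snd (face j y)"
      using AB by auto
    then have "p = (face i (g, False), face j (g, False))" "(g, False) \<in> XX"
      using mem_face[of x g i] mem_face[of y g j] by auto
    then show "p \<in> ?B" using p by blast
  next
    fix p assume "p \<in> ?B"
    then obtain i j z where p: "p = (face i z, face j z)" "z \<in> XX" "i \<in> {-1..int n}" "j \<in> {-1..int n}" "i \<le> j"
      by blast
    obtain g where g: "g \<in> carrier G" "(g, False) \<in> orb rr ({0..<int n} - {i, j}) z"
      using even_in_orb[OF p(2)] .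
    have "(g, False) \<in> orb rr ({0..<int n} - {i}) z" "(g, False) \<in> orb rr ({0..<int n} - {j}) z"
      by (rule orb_mono[OF g(2)], blast)+
    then have "g \<in> snd (face i z) \<inter> snd (face j z)" using g(1) by (simp add: face_def)
    moreover have "fst (face i z) \<le> fst (face j z)" using p by (simp add: face_def)
    ultimately show "p \<in> ?A" using p unfolding faces_coset_poset by blast
  qed
  finally show ?thesis .
qed

sublocale K: face_poset n XX rr "coset_poset n G \<sigma>" face "(\<one>, False)"
proof
  have "face_group n G \<sigma> j #> \<one> = face_group n G \<sigma> j" for j
    unfolding face_group_def
    by (rule coset_mult_one) (rule G_sub_closed, auto)
  then show "base_flag (coset_poset n G \<sigma>) = (\<lambda>j. face j (\<one>, False)) ` {-1..int n}"
    by (auto simp: coset_poset_def Let_def face_even)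
  show "rank (coset_poset n G \<sigma>) (face j x) = j" for j x
    by (simp add: coset_poset_def Let_def face_def)
qed (use faces_coset_poset le_coset_poset face_eq_iff in auto)

end

section \<open>Polytopes whose flags are labelled by a group\<close>

locale labelled_polytope = rotation_system G n \<sigma> + P: polytope n P
  for G (structure) and n \<sigma> and P :: "('b, 'm) ranked_poset_scheme" +
  fixes F :: "'a \<times> bool \<Rightarrow> 'b set"
  assumes F_bij: "bij_betw F (carrier G \<times> UNIV) (flags P)"
    and F_rr: "i \<in> {0..<int n} \<Longrightarrow> x \<in> carrier G \<times> UNIV \<Longrightarrow> F (rr i x) = flag_adj P i (F x)"
    and F_base: "F (\<one>, False) = base_flag P"
begin

lemma F_flag: "x \<in> XX \<Longrightarrow> F x \<in> flags P"
  using F_bij bij_betwE by blast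

lemma F_inj: "x \<in> XX \<Longrightarrow> y \<in> XX \<Longrightarrow> F x = F y \<Longrightarrow> x = y"
  using F_bij unfolding bij_betw_def inj_on_def by meson

lemma F_surj: "\<Phi> \<in> flags P \<Longrightarrow> \<exists>x\<in>XX. F x = \<Phi>"
  using F_bij unfolding bij_betw_def by (metis imageE)

text \<open>Transported along \<open>F\<close>, a permutation of the labels commuting with all
  \<open>rr\<close> becomes a permutation of the flags commuting with adjacency.\<close>

lemma label_map_Aut:
  assumes u: "\<And>x. x \<in> XX \<Longrightarrow> u x \<in> XX" "\<And>i x. i \<in> {0..<int n} \<Longrightarrow> x \<in> XX \<Longrightarrow> u (rr i x) = rr i (u x)"
    and v: "\<And>x. x \<in> XX \<Longrightarrow> v x \<in> XX" "\<And>i x. i \<in> {0..<int n} \<Longrightarrow> x \<in> XX \<Longrightarrow> v (rr i x) = rr i (v x)"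
    and uv: "\<And>x. x \<in> XX \<Longrightarrow> u (v x) = x" "\<And>x. x \<in> XX \<Longrightarrow> v (u x) = x"
  obtains f where "f \<in> carrier P.Aut" "\<And>x. x \<in> XX \<Longrightarrow> f ` F x = F (u x)"
proof -
  define lift where "lift w \<Phi> = F (w (inv_into XX F \<Phi>))" for w \<Phi>
  have inv: "inv_into XX F (F x) = x" if "x \<in> XX" for x
    using F_bij that by (simp add: bij_betw_def)
  have lift: "lift w (F x) = F (w x)" if "x \<in> XX" for w x
    using inv that by (simp add: lift_def)
  have lift_r: "lift w (flag_adj P i \<Phi>) = flag_adj P i (lift w \<Phi>)"
    if w: "\<And>x. x \<in> XX \<Longrightarrow> w x \<in> XX" "\<And>i x. i \<in> {0..<int n} \<Longrightarrow> x \<in> XX \<Longrightarrow> w (rr i x) = rr i (w x)"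
      and i: "i \<in> {0..<int n}" and \<Phi>: "\<Phi> \<in> flags P" for w i \<Phi>
  proof -
    obtain x where x: "x \<in> XX" "F x = \<Phi>" using F_surj \<Phi> by blast
    have "lift w (flag_adj P i \<Phi>) = lift w (F (rr i x))" using F_rr i x by simp
    also have "\<dots> = F (rr i (w x))" using lift[OF fl.r_closed[OF i x(1)]] w(2)[OF i x(1)] by simp
    also have "\<dots> = flag_adj P i (lift w \<Phi>)" using F_rr[OF i w(1)[OF x(1)]] lift[OF x(1)] x(2) by simp
    finally show ?thesis .
  qed
  have lift_fl: "lift w \<Phi> \<in> flags P" if "\<And>x. x \<in> XX \<Longrightarrow> w x \<in> XX" "\<Phi> \<in> flags P" for w \<Phi>
    using F_surj[OF that(2)] lift F_flag that(1) by metis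
  have lift_inv: "lift w (lift w' \<Phi>) = \<Phi>"
    if w': "\<And>x. x \<in> XX \<Longrightarrow> w' x \<in> XX" "\<And>x. x \<in> XX \<Longrightarrow> w (w' x) = x" and \<Phi>: "\<Phi> \<in> flags P" for w w' \<Phi>
  proof -
    obtain x where x: "x \<in> XX" "F x = \<Phi>" using F_surj \<Phi> by blast
    then have "lift w (lift w' \<Phi>) = F (w (w' x))" using lift[OF x(1)] lift[OF w'(1)[OF x(1)]] by simp
    then show ?thesis using w'(2) x by simp
  qed
  obtain f where f: "f \<in> carrier P.Aut" "\<And>\<Phi>. \<Phi> \<in> flags P \<Longrightarrow> f ` \<Phi> = lift u \<Phi>"
  proof (rule P.flag_map_induces_Aut[of "lift u" "lift v"])
  qed (use lift_fl[OF u(1)] lift_fl[OF v(1)] lift_r[OF u] lift_r[OF v] lift_inv[OF v(1) uv(1)]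
      lift_inv[OF u(1) uv(2)] in auto)
  then have "f ` F x = F (u x)" if "x \<in> XX" for x using lift that F_flag by simp
  then show ?thesis using that f(1) by blast
qed

section \<open>Right translations as automorphisms\<close>

abbreviation tr :: "'a \<Rightarrow> 'a \<times> bool \<Rightarrow> 'a \<times> bool" where
  "tr c \<equiv> map_prod (\<lambda>g. g \<otimes> c) id"

lemma tr_closed: "c \<in> carrier G \<Longrightarrow> x \<in> XX \<Longrightarrow> tr c x \<in> XX"
  by auto

text \<open>The automorphism induced by right translation. It exists by \<open>label_map_Aut\<close>
  and is unique by \<open>Aut_free\<close>, so the choice is determined.\<close>

definition act :: "'a \<Rightarrow> 'b \<Rightarrow> 'b" where
  "act c = (SOME f. f \<in> carrier P.Aut \<and> (\<forall>x\<in>XX. f ` F x = F (tr c x)))"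

lemma act:
  assumes c: "c \<in> carrier G"
  shows "act c \<in> carrier P.Aut" "x \<in> XX \<Longrightarrow> act c ` F x = F (tr c x)"
proof -
  obtain f where "f \<in> carrier P.Aut" "\<And>x. x \<in> XX \<Longrightarrow> f ` F x = F (tr c x)"
    by (rule label_map_Aut[of "tr c" "tr (inv c)"]) (use c translate_rr in \<open>auto simp: m_assoc\<close>)
  then have "\<exists>f. f \<in> carrier P.Aut \<and> (\<forall>x\<in>XX. f ` F x = F (tr c x))" by blast
  from someI_ex[OF this] show "act c \<in> carrier P.Aut" "x \<in> XX \<Longrightarrow> act c ` F x = F (tr c x)"
    unfolding act_def by blast+
qed

lemma act_base: "c \<in> carrier G \<Longrightarrow> act c ` base_flag P = F (c, False)"
  using act(2)[of c "(\<one>, False)"] F_base by simp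

lemma act_unique:
  assumes "f \<in> carrier P.Aut" "c \<in> carrier G" "f ` base_flag P = F (c, False)"
  shows "f = act c"
  using P.Aut_free[OF assms(1) act(1)[OF assms(2)] P.base_flag] act_base assms by simp

lemma act_hom: "act \<in> hom G P.Aut"
proof (rule homI)
  fix c d assume c: "c \<in> carrier G" and d: "d \<in> carrier G"
  interpret A: group P.Aut by (rule P.group_Aut)
  have 1: "act c \<otimes>\<^bsub>P.Aut\<^esub> act d \<in> carrier P.Aut"
    using act(1)[OF c] act(1)[OF d] by (rule A.m_closed)
  have 2: "(act c \<otimes>\<^bsub>P.Aut\<^esub> act d) ` base_flag P = F (c \<otimes> d, False)"
    using P.Aut_mult_image[OF P.base_flag] act_base[OF c] act(2)[OF d, of "(c, False)"] c by simp
  show "act (c \<otimes> d) = act c \<otimes>\<^bsub>P.Aut\<^esub> act d"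
    using act_unique[OF 1 m_closed[OF c d] 2] by simp
qed (rule act(1))

lemma act_inj: "inj_on act (carrier G)"
proof (rule inj_onI)
  fix c d assume cd: "c \<in> carrier G" "d \<in> carrier G" "act c = act d"
  then have "F (c, False) = F (d, False)" using act_base by metis
  then show "c = d" using F_inj[of "(c, False)" "(d, False)"] cd by auto
qed

lemma rotation_eq_act:
  assumes i: "i \<in> {1..<n}"
  shows "rotation P i = act (\<sigma> i)"
proof -
  have ii: "int i \<in> {0..<int n}" "int i - 1 \<in> {0..<int n}" using i by auto
  have "flag_adj P (int i - 1) (flag_adj P (int i) (base_flag P)) = F (rr (int i - 1) (rr (int i) (\<one>, False)))"
    using F_rr[OF ii(1), of "(\<one>, False)"] F_rr[OF ii(2) fl.r_closed[OF ii(1)], of "(\<one>, False)"] F_base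
    by (simp del: rr_simps)
  also have "rr (int i - 1) (rr (int i) (\<one>, False)) = (\<sigma> i, False)"
    using t_diff_\<sigma>[OF i] ii by simp
  finally have *: "flag_adj P (int i - 1) (flag_adj P (int i) (base_flag P)) = F (\<sigma> i, False)" .
  show ?thesis
    unfolding rotation_def *
  proof (rule the_equality)
    show "act (\<sigma> i) \<in> carrier P.Aut \<and> act (\<sigma> i) ` base_flag P = F (\<sigma> i, False)"
      using act(1)[OF \<sigma>_closed[OF i]] act_base[OF \<sigma>_closed[OF i]] by simp
  qed (use act_unique[OF _ \<sigma>_closed[OF i]] in blast)
qed

end

text \<open>The group is achiral if replacing each generator by its mirror image
  ($\sigma_1^{-1}$, $\sigma_1^2\sigma_2$, $\sigma_3$, \dots) defines a homomorphism; in terms of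
  the products $\sigma_1\cdots\sigma_i$ this means inverting each of them.\<close>

definition (in group_family) achiral :: bool where
  "achiral \<longleftrightarrow> (\<exists>\<theta>\<in>hom G G. \<forall>i\<in>{0..<int n}. \<theta> (t i) = inv (t i))"

section \<open>Mirror homomorphisms, parity of automorphisms and chirality\<close>

context labelled_polytope
begin

lemma adjacent_F:
  assumes "i \<in> {0..<int n}" "x \<in> XX"
  shows "adjacent (F x) (F (rr i x))"
  using P.adjacent_iff[OF F_flag[OF assms(2)] F_flag[OF fl.r_closed[OF assms]]] F_rr[OF assms] assms(1)
  by blast

text \<open>Applying the mirror homomorphism to the group element and switching parity commutes with
  every step. The resulting automorphism maps the base flag to its 0-adjacent flag, because t 0 is
  the identity.\<close>

lemma achiral_not_chiral:
  assumes achiral shows "\<not> chiral n P"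
proof
  assume ch: "chiral n P"
  obtain \<theta> where \<theta>: "\<theta> \<in> hom G G" "\<And>i. i \<in> {0..<int n} \<Longrightarrow> \<theta> (t i) = inv (t i)"
    using assms unfolding achiral_def by blast
  interpret \<theta>: group_hom G G \<theta> using \<theta>(1) by unfold_locales
  define u where "u = map_prod \<theta> Not"
  \<comment> \<open>Inverting every prefix product twice fixes each generator; so \<open>u\<close>
    is a permutation with itself as inverse.\<close>
  have invol: "\<theta> (\<theta> g) = g" if "g \<in> carrier G" for g
  proof -
    have \<sigma>: "\<theta> (\<theta> (\<sigma> i)) = \<sigma> i" if i: "i \<in> {1..<n}" for i
    proof -
      have ii: "int i - 1 \<in> {0..<int n}" "int i \<in> {0..<int n}" using i by auto
      then show ?thesis using t_diff_\<sigma>[OF i, symmetric] \<theta>(2)[OF ii(1)] \<theta>(2)[OF ii(2)] by simp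
    qed
    have "g \<in> generate G (\<sigma> ` {1..<n})" using that generated by simp
    then show ?thesis
    proof (induction rule: generate.induct)
      case (incl h)
      then show ?case using \<sigma> by auto
    next
      case (inv h)
      then show ?case using \<sigma> \<sigma>_closed by auto
    next
      case (eng h1 h2)
      then have "h1 \<in> carrier G" "h2 \<in> carrier G" using generated by auto
      then show ?case using eng by simp
    qed simp
  qed
  have u: "u x \<in> XX" "u (u x) = x" if "x \<in> XX" for x using that invol by (auto simp: u_def)
  have u_rr: "u (rr i x) = rr i (u x)" if "i \<in> {0..<int n}" "x \<in> XX" for i x
    using that \<theta>(2)[of i] by (auto simp: u_def rr_def)
  obtain f where f: "f \<in> carrier P.Aut" "\<And>x. x \<in> XX \<Longrightarrow> f ` F x = F (u x)"
    by (rule label_map_Aut[of u u]) (use u u_rr in auto)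
  have x: "(\<one>, False) \<in> XX" and 0: "0 \<in> {0..<int n}" using n_pos by auto
  have "f ` F (\<one>, False) = F (rr 0 (\<one>, False))" using f(2)[OF x] by (simp add: u_def)
  then have "(F (\<one>, False), F (rr 0 (\<one>, False))) \<in> flag_orbit_rel P"
    using f(1) F_flag[OF x] F_flag[OF fl.r_closed[OF 0 x]] unfolding flag_orbit_rel_def by blast
  then show False
    using ch adjacent_F[OF 0 x] F_flag[OF x] F_flag[OF fl.r_closed[OF 0 x]] unfolding chiral_def by blast
qed

text \<open>The converse direction: an automorphism moving the base flag to an odd flag, read in
  labels, exchanges left multiplication by t i and by its inverse on the two sides. Its action on
  even labels is therefore a mirror homomorphism.\<close>

lemma Aut_parity:
  assumes f: "f \<in> carrier P.Aut" and odd: "c \<in> carrier G" "f ` F (\<one>, False) = F (c, True)"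
  shows achiral
proof -
  define w where "w x = inv_into XX F (f ` F x)" for x
  have w: "w x \<in> XX" "F (w x) = f ` F x" if "x \<in> XX" for x
    using P.Aut_flag[OF f F_flag[OF that]] F_bij unfolding w_def
    by (auto simp: bij_betw_def f_inv_into_f intro: inv_into_into simp del: mem_Sigma_iff)
  have w_rr: "w (rr i x) = rr i (w x)" if "i \<in> {0..<int n}" "x \<in> XX" for i x
  proof -
    have "F (w (rr i x)) = F (rr i (w x))"
      using w fl.r_closed F_rr that P.Aut_r[OF f F_flag[OF that(2)] that(1)] by simp
    then show ?thesis using F_inj w(1) fl.r_closed that by meson
  qed
  have w1: "w (\<one>, False) = (c, True)"
    using F_inj[of "w (\<one>, False)" "(c, True)"] w[of "(\<one>, False)"] odd by simp
  have par: "snd (w x) \<longleftrightarrow> \<not> snd x" if "x \<in> XX" for x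
  proof -
    have "x \<in> orb rr {0..<int n} (\<one>, False)" using orb_all that by simp
    then show ?thesis
    proof (induction rule: orb.induct)
      case (step y i)
      then show ?case using w_rr[OF step(2)] fl.orb_closed[OF step(1)] by simp
    qed (simp add: w1)
  qed
  \<comment> \<open>Dividing by the label c of the image of the base flag normalises \<theta> to fix
    the identity.\<close>
  define \<theta> where "\<theta> g = fst (w (g, False)) \<otimes> inv c" for g
  have w_even: "w (g, False) = (\<theta> g \<otimes> c, True)" "\<theta> g \<in> carrier G" if "g \<in> carrier G" for g
  proof -
    have "fst (w (g, False)) \<in> carrier G" "snd (w (g, False))" using w(1)[of "(g, False)"] par that by auto
    then show "w (g, False) = (\<theta> g \<otimes> c, True)" "\<theta> g \<in> carrier G"
      using odd(1) by (auto simp: \<theta>_def m_assoc prod_eq_iff)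
  qed
  have \<theta>_1: "\<theta> \<one> = \<one>" using w1 odd(1) by (simp add: \<theta>_def)
  \<comment> \<open>Two steps preserve parity. On an odd label they multiply by t a times the
    inverse of t b, where on an even one they multiply by the inverse of t a times t b.\<close>
  have two: "\<theta> (inv (t a) \<otimes> t b \<otimes> g) = t a \<otimes> inv (t b) \<otimes> \<theta> g"
    if "a \<in> {0..<int n}" "b \<in> {0..<int n}" "g \<in> carrier G" for a b g
  proof -
    have c: "t a \<in> carrier G" "t b \<in> carrier G" using that by auto
    have "w (rr a (rr b (g, False))) = rr a (rr b (w (g, False)))"
      using w_rr[OF that(1) fl.r_closed[OF that(2)], of "(g, False)"] w_rr[OF that(2), of "(g, False)"] that(3)
      by (simp del: rr_simps)
    then have "(\<theta> (inv (t a) \<otimes> t b \<otimes> g) \<otimes> c, True) = (t a \<otimes> inv (t b) \<otimes> \<theta> g \<otimes> c, True)"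
      using w_even c that odd(1) by (simp add: m_assoc)
    then show ?thesis using w_even(2) c odd(1) that by simp
  qed
  have "\<theta> (t i) = inv (t i)" if "i \<in> {0..<int n}" for i
    using two[of 0 i \<one>] that \<theta>_1 by simp
  moreover have "\<theta> (h \<otimes> g) = \<theta> h \<otimes> \<theta> g" if "h \<in> carrier G" "g \<in> carrier G" for h g
  proof -
    have 2: "\<theta> (inv (t a) \<otimes> t b \<otimes> g) = \<theta> (inv (t a) \<otimes> t b) \<otimes> \<theta> g"
      if "a \<in> {0..<int n}" "b \<in> {0..<int n}" "g \<in> carrier G" for a b g
      using two[OF that(1,2), of \<one>] two[OF that] \<theta>_1 that by simp
    have "h \<in> generate G (\<sigma> ` {1..<n})" using that generated by simp
    then have "\<forall>g\<in>carrier G. \<theta> (h \<otimes> g) = \<theta> h \<otimes> \<theta> g"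
    proof (induction rule: generate.induct)
      case one
      then show ?case using \<theta>_1 w_even(2) by simp
    next
      case (incl h)
      then obtain i where i: "i \<in> {1..<n}" "h = \<sigma> i" by blast
      then show ?case using 2[of "int i - 1" "int i"] t_diff_\<sigma>[OF i(1)] by auto
    next
      case (inv h)
      then obtain i where i: "i \<in> {1..<n}" "h = \<sigma> i" by blast
      then have "t (int i) \<in> carrier G" "t (int i - 1) \<in> carrier G" by auto
      then have "inv h = inv (t (int i)) \<otimes> t (int i - 1)"
        using t_diff_\<sigma>[OF i(1), symmetric] i(2) by (simp add: inv_mult_group)
      then show ?case using 2[of "int i" "int i - 1"] i(1) by auto
    next
      case (eng h1 h2)
      then have c: "h1 \<in> carrier G" "h2 \<in> carrier G" using generated by auto
      show ?case
      proof
        fix g assume g: "g \<in> carrier G"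
        have "\<theta> (h1 \<otimes> h2 \<otimes> g) = \<theta> h1 \<otimes> (\<theta> h2 \<otimes> \<theta> g)" using eng c g by (simp add: m_assoc)
        also have "\<dots> = \<theta> (h1 \<otimes> h2) \<otimes> \<theta> g" using eng c g w_even(2) by (simp add: m_assoc)
        finally show "\<theta> (h1 \<otimes> h2 \<otimes> g) = \<theta> (h1 \<otimes> h2) \<otimes> \<theta> g" .
      qed
    qed
    then show ?thesis using that by blast
  qed
  ultimately show achiral
    unfolding achiral_def using w_even(2) by (intro bexI[of _ \<theta>] homI) auto
qed

lemma Aut_even:
  assumes "\<not> achiral" and f: "f \<in> carrier P.Aut"
  obtains c where "c \<in> carrier G" "f = act c"
proof -
  have "f ` F (\<one>, False) \<in> flags P" using P.Aut_flag[OF f F_flag] by simp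
  then obtain c b where c: "c \<in> carrier G" "F (c, b) = f ` F (\<one>, False)"
    using F_surj by (metis SigmaE)
  have "\<not> b"
  proof
    assume b
    then show False using Aut_parity[OF f c(1)] c(2) assms(1) by simp
  qed
  then show ?thesis using that[OF c(1)] act_unique[OF f c(1)] c F_base by simp
qed

lemma flag_orbit_rel_iff:
  assumes "\<not> achiral" "x \<in> XX" "y \<in> XX"
  shows "(F x, F y) \<in> flag_orbit_rel P \<longleftrightarrow> snd x = snd y"
proof
  assume "(F x, F y) \<in> flag_orbit_rel P"
  then obtain f where f: "f \<in> carrier P.Aut" "f ` F x = F y" by (auto simp: flag_orbit_rel_def)
  obtain c where c: "c \<in> carrier G" "f = act c" using Aut_even[OF assms(1) f(1)] .
  have "F (tr c x) = F y" using act(2)[OF c(1) assms(2)] f(2) c(2) by simp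
  then have "tr c x = y" using F_inj[OF tr_closed[OF c(1) assms(2)] assms(3)] by simp
  then show "snd x = snd y" by auto
next
  assume "snd x = snd y"
  then have "tr (inv (fst x) \<otimes> fst y) x = y" "inv (fst x) \<otimes> fst y \<in> carrier G"
    using assms(2,3) by (auto simp: prod_eq_iff m_assoc[symmetric])
  then have "act (inv (fst x) \<otimes> fst y) ` F x = F y" "act (inv (fst x) \<otimes> fst y) \<in> carrier P.Aut"
    using act assms(2) by auto
  then show "(F x, F y) \<in> flag_orbit_rel P"
    using F_flag[OF assms(2)] F_flag[OF assms(3)] by (auto simp: flag_orbit_rel_def)
qed

text \<open>Right translations act transitively on the labels of each parity and no automorphism
  changes parity, so the two parities are the orbits; every step switches parity.\<close>

lemma not_achiral_chiral:
  assumes na: "\<not> achiral" shows "chiral n P"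
  unfolding chiral_def
proof (intro conjI ballI impI)
  define cl where "cl b = F ` (carrier G \<times> {b})" for b
  have cls: "flag_orbit_rel P `` {F x} = cl (snd x)" if x: "x \<in> XX" for x
  proof (intro equalityI subsetI)
    fix \<Psi> assume \<Psi>: "\<Psi> \<in> flag_orbit_rel P `` {F x}"
    then have "\<Psi> \<in> flags P" by (simp add: flag_orbit_rel_def)
    then obtain y where y: "y \<in> XX" "F y = \<Psi>" using F_surj by metis
    then have "snd y = snd x" using flag_orbit_rel_iff[OF na x y(1)] \<Psi> by simp
    then have "y \<in> carrier G \<times> {snd x}" using y(1) by (cases y) auto
    then show "\<Psi> \<in> cl (snd x)" using y(2) unfolding cl_def by blast
  next
    fix \<Psi> assume "\<Psi> \<in> cl (snd x)"
    then obtain y where "y \<in> XX" "\<Psi> = F y" "snd y = snd x" unfolding cl_def by auto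
    then show "\<Psi> \<in> flag_orbit_rel P `` {F x}" using flag_orbit_rel_iff[OF na x] by auto
  qed
  have "flags P // flag_orbit_rel P = {cl False, cl True}"
  proof (intro equalityI subsetI)
    fix C assume "C \<in> flags P // flag_orbit_rel P"
    then obtain \<Phi> where "\<Phi> \<in> flags P" "C = flag_orbit_rel P `` {\<Phi>}" by (rule quotientE)
    then obtain x where "x \<in> XX" "C = cl (snd x)" using F_surj cls by metis
    then show "C \<in> {cl False, cl True}" by (cases "snd x") auto
  next
    fix C assume "C \<in> {cl False, cl True}"
    then obtain b where "C = cl b" by blast
    then show "C \<in> flags P // flag_orbit_rel P"
      using cls[of "(\<one>, b)"] quotientI[OF F_flag[of "(\<one>, b)"], of "flag_orbit_rel P"] by simp
  qed
  moreover have "cl False \<noteq> cl True"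
  proof -
    have "F (\<one>, False) \<notin> cl True"
    proof
      assume "F (\<one>, False) \<in> cl True"
      then obtain g where "g \<in> carrier G" "F (\<one>, False) = F (g, True)" unfolding cl_def by auto
      then show False using F_inj[of "(\<one>, False)" "(g, True)"] by auto
    qed
    moreover have "F (\<one>, False) \<in> cl False" unfolding cl_def by auto
    ultimately show ?thesis by metis
  qed
  ultimately show "card (flags P // flag_orbit_rel P) = 2" by simp
next
  fix \<Phi> \<Psi> assume fl: "\<Phi> \<in> flags P" "\<Psi> \<in> flags P" and "adjacent \<Phi> \<Psi>"
  then obtain i where i: "i \<in> {0..<int n}" "\<Psi> = flag_adj P i \<Phi>" using P.adjacent_iff by blast
  obtain x where x: "x \<in> XX" "F x = \<Phi>" using F_surj fl(1) by blast
  have "\<Psi> = F (rr i x)" using F_rr i x by simp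
  then show "(\<Phi>, \<Psi>) \<notin> flag_orbit_rel P"
    using flag_orbit_rel_iff[OF na x(1) fl.r_closed[OF i(1) x(1)]] x(2) by simp
qed (rule P.poly)

lemma act_iso:
  assumes "\<not> achiral"
  shows "act \<in> iso G P.Aut"
proof (rule isoI[OF act_hom])
  have "act ` carrier G = carrier P.Aut"
    using act(1) Aut_even[OF assms] by (metis (no_types, lifting) image_eqI image_subsetI subsetI subset_antisym)
  then show "bij_betw act (carrier G) (carrier P.Aut)" using act_inj by (simp add: bij_betw_def)
qed

lemma rotation_group_eq:
  assumes "\<not> achiral"
  shows "rotation_group n P = P.Aut"
proof -
  interpret A: group P.Aut by (rule P.group_Aut)
  interpret act: group_hom G P.Aut act using act_hom by unfold_locales
  have "rotation P ` {1..<n} = act ` \<sigma> ` {1..<n}" using rotation_eq_act by (auto simp: image_image)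
  then have "generate P.Aut (rotation P ` {1..<n}) = act ` generate G (\<sigma> ` {1..<n})"
    using act.generate_img[of "\<sigma> ` {1..<n}"] \<sigma>_closed by (simp add: image_subset_iff)
  also have "\<dots> = carrier P.Aut" using act_iso[OF assms] generated by (simp add: iso_def bij_betw_def)
  finally show ?thesis by (simp add: rotation_group_def)
qed

lemma has_type_ord:
  assumes "\<not> achiral"
  shows "has_type n P p \<longleftrightarrow> (\<forall>i\<in>{1..<n}. p i = ord (\<sigma> i))"
proof -
  interpret A: group P.Aut by (rule P.group_Aut)
  interpret act: group_hom G P.Aut act using act_hom by unfold_locales
  have "group.ord P.Aut (act (\<sigma> i)) = ord (\<sigma> i)" if i: "i \<in> {1..<n}" for i
  proof -
    have "act (\<sigma> i) [^]\<^bsub>P.Aut\<^esub> k = \<one>\<^bsub>P.Aut\<^esub> \<longleftrightarrow> ord (\<sigma> i) dvd k" for k :: nat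
    proof -
      have "act (\<sigma> i) [^]\<^bsub>P.Aut\<^esub> k = \<one>\<^bsub>P.Aut\<^esub> \<longleftrightarrow> act (\<sigma> i [^] k) = act \<one>"
        using act.hom_nat_pow \<sigma>_closed[OF i] by simp
      also have "\<dots> \<longleftrightarrow> \<sigma> i [^] k = \<one>"
        using act_inj \<sigma>_closed[OF i] by (auto simp: inj_on_def)
      finally show ?thesis using pow_eq_id \<sigma>_closed[OF i] by simp
    qed
    then show ?thesis using A.ord_unique \<sigma>_closed[OF i] by simp
  qed
  then show ?thesis unfolding has_type_def rotation_group_eq[OF assms] using rotation_eq_act by simp
qed

end

sublocale coset_polytope \<subseteq> M: labelled_polytope G n \<sigma> "coset_poset n G \<sigma>" K.flag
proof
  show "bij_betw K.flag XX (flags (coset_poset n G \<sigma>))"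
    using K.flag_inj K.flags_eq by (auto simp: bij_betw_def inj_on_def)
  show "K.flag (\<one>, False) = base_flag (coset_poset n G \<sigma>)"
    using K.base_L by (simp add: K.flag_def)
qed (use K.flag_L_adj in auto)

section \<open>The rotation group of a chiral polytope\<close>

context polytope
begin

lemma flag_orbit_rel_refl: "x \<in> flags P \<Longrightarrow> (x, x) \<in> flag_orbit_rel P"
proof -
  interpret A: group Aut by (rule group_Aut)
  assume "x \<in> flags P"
  then show ?thesis using Aut_one_image A.one_closed by (auto simp: flag_orbit_rel_def)
qed

lemma flag_orbit_rel_trans:
  assumes "(x, y) \<in> flag_orbit_rel P" "(y, z) \<in> flag_orbit_rel P"
  shows "(x, z) \<in> flag_orbit_rel P"
proof -
  interpret A: group Aut by (rule group_Aut)
  obtain f g where fg: "f \<in> carrier Aut" "f ` x = y" "g \<in> carrier Aut" "g ` y = z"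
    and fl: "x \<in> flags P" "z \<in> flags P"
    using assms unfolding flag_orbit_rel_def by auto
  then have "(f \<otimes>\<^bsub>Aut\<^esub> g) ` x = z" "f \<otimes>\<^bsub>Aut\<^esub> g \<in> carrier Aut"
    using Aut_mult_image by (metis, blast)
  then show ?thesis using fl by (auto simp: flag_orbit_rel_def)
qed

lemma flag_orbit_rel_sym:
  assumes "(x, y) \<in> flag_orbit_rel P"
  shows "(y, x) \<in> flag_orbit_rel P"
proof -
  interpret A: group Aut by (rule group_Aut)
  obtain f where f: "f \<in> carrier Aut" "f ` x = y" and fl: "x \<in> flags P" "y \<in> flags P"
    using assms unfolding flag_orbit_rel_def by auto
  have "(inv\<^bsub>Aut\<^esub> f) ` y = (f \<otimes>\<^bsub>Aut\<^esub> inv\<^bsub>Aut\<^esub> f) ` x" using Aut_mult_image[OF fl(1)] f(2) by simp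
  then have "(inv\<^bsub>Aut\<^esub> f) ` y = x" using f(1) Aut_one_image[OF fl(1)] by simp
  then show ?thesis using fl A.inv_closed[OF f(1)] by (auto simp: flag_orbit_rel_def)
qed

lemma equiv_flag_orbit_rel: "equiv (flags P) (flag_orbit_rel P)"
proof (rule equivI)
  show "flag_orbit_rel P \<subseteq> flags P \<times> flags P" by (auto simp: flag_orbit_rel_def)
  show "refl_on (flags P) (flag_orbit_rel P)" using flag_orbit_rel_refl by (simp add: refl_on_def)
  show "sym (flag_orbit_rel P)" using flag_orbit_rel_sym by (rule symI)
  show "trans (flag_orbit_rel P)" using flag_orbit_rel_trans by (rule transI)
qed

lemma two_orbits:
  assumes "card (flags P // flag_orbit_rel P) = 2" "x \<in> flags P" "y \<in> flags P" "z \<in> flags P"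
    and "(x, y) \<notin> flag_orbit_rel P" "(y, z) \<notin> flag_orbit_rel P"
  shows "(x, z) \<in> flag_orbit_rel P"
proof -
  let ?c = "\<lambda>x. flag_orbit_rel P `` {x}"
  have "?c x = ?c z"
  proof (rule third_eq[OF assms(1), of "?c y"])
    show "?c x \<noteq> ?c y" "?c z \<noteq> ?c y"
      using eq_equiv_class_iff[OF equiv_flag_orbit_rel] assms flag_orbit_rel_sym by metis+
  qed (use assms quotientI[of _ "flags P" "flag_orbit_rel P"] in auto)
  then show ?thesis using eq_equiv_class_iff[OF equiv_flag_orbit_rel] assms by metis
qed

end

locale chiral_polytope = polytope +
  assumes ch: "chiral n P" and n_pos: "0 < n"
begin

abbreviation \<Phi> :: "'a set" where "\<Phi> \<equiv> base_flag P"

lemma not_rel_r: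
  assumes "x \<in> flags P" "i \<in> {0..<int n}"
  shows "(x, r i x) \<notin> flag_orbit_rel P"
proof -
  have "adjacent x (r i x)" using adjacent_iff[OF assms(1) r_flag[OF assms]] assms(2) by auto
  then show ?thesis using ch assms(1) r_flag[OF assms] by (simp add: chiral_def)
qed

lemma rel_r_r:
  assumes x: "x \<in> flags P" and i: "i \<in> {0..<int n}" and j: "j \<in> {0..<int n}"
  shows "(x, r i (r j x)) \<in> flag_orbit_rel P"
  by (rule two_orbits[of _ "r j x"])
    (use ch x i j r_flag not_rel_r in \<open>simp_all add: chiral_def\<close>)

text \<open>A single step leaves the orbit and there are only two orbits, so two steps return to it.
  This gives the automorphism, and freeness makes it the one singled out by
  \<open>rotation\<close>.\<close>

lemma rotation_props:
  assumes i: "i \<in> {1..<n}"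
  shows rotation_closed: "rotation P i \<in> carrier Aut"
    and rotation_base: "rotation P i ` \<Phi> = r (int i - 1) (r (int i) \<Phi>)"
proof -
  have "(\<Phi>, r (int i - 1) (r (int i) \<Phi>)) \<in> flag_orbit_rel P"
    using rel_r_r base_flag i by simp
  then obtain f where f: "f \<in> carrier Aut" "f ` \<Phi> = r (int i - 1) (r (int i) \<Phi>)"
    by (auto simp: flag_orbit_rel_def)
  have "rotation P i = f"
    unfolding rotation_def
  proof (rule the_equality)
    fix g assume "g \<in> carrier Aut \<and> g ` \<Phi> = r (int i - 1) (r (int i) \<Phi>)"
    then show "g = f" using Aut_free[of g f \<Phi>] f base_flag by simp
  qed (use f in simp)
  then show "rotation P i \<in> carrier Aut" "rotation P i ` \<Phi> = r (int i - 1) (r (int i) \<Phi>)"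
    using f by simp_all
qed

sublocale A: group_family Aut n "rotation P"
proof -
  interpret group Aut by (rule group_Aut)
  show "group_family Aut n (rotation P)" by unfold_locales (rule rotation_closed)
qed

text \<open>Automorphisms commute with adjacency, so the images telescope: the inner steps of rank i
  occur twice in a row and cancel.\<close>

lemma \<tau>_base:
  "1 \<le> i \<Longrightarrow> i \<le> j \<Longrightarrow> j < n \<Longrightarrow> \<tau> Aut (rotation P) i j ` \<Phi> = r (int i - 1) (r (int j) \<Phi>)"
proof (induction "j - i" arbitrary: i)
  case 0
  then show ?case using A.\<tau>_single[of i] rotation_base[of i] by simp
next
  case (Suc k)
  have c: "\<tau> Aut (rotation P) (Suc i) j \<in> carrier Aut" using A.\<tau>_closed Suc.prems by simp
  have ij: "int i \<in> {0..<int n}" "int i - 1 \<in> {0..<int n}" "int j \<in> {0..<int n}" using Suc.prems by auto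
  have "\<tau> Aut (rotation P) i j ` \<Phi> = \<tau> Aut (rotation P) (Suc i) j ` (r (int i - 1) (r (int i) \<Phi>))"
    using A.\<tau>_Cons[of i j] Aut_mult_image[OF base_flag] rotation_base[of i] Suc.prems by simp
  also have "\<dots> = r (int i - 1) (r (int i) (\<tau> Aut (rotation P) (Suc i) j ` \<Phi>))"
    using Aut_r[OF c r_flag[OF base_flag ij(1)] ij(2)] Aut_r[OF c base_flag ij(1)] by simp
  also have "\<tau> Aut (rotation P) (Suc i) j ` \<Phi> = r (int i) (r (int j) \<Phi>)"
    using Suc.hyps(1)[of "Suc i"] Suc.hyps(2) Suc.prems by simp
  finally show ?case using r_r[OF ij(1) r_flag[OF base_flag ij(3)]] by simp
qed

lemma t_base:
  assumes "i \<in> {0..<int n}"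
  shows "A.t i ` \<Phi> = r 0 (r i \<Phi>)"
proof (cases "i = 0")
  case True
  then show ?thesis using Aut_one_image base_flag r_r assms by simp
next
  case False
  then have "1 \<le> nat i" "nat i < n" "int (nat i) = i" using assms by auto
  then show ?thesis using \<tau>_base[of 1 "nat i"] unfolding A.t_def by simp
qed

text \<open>The base flag and its 0-adjacent flag represent the two orbits; the Boolean selects the
  representative.\<close>

definition F :: "('a \<Rightarrow> 'a) \<times> bool \<Rightarrow> 'a set" where
  "F x = fst x ` (if snd x then r 0 \<Phi> else \<Phi>)"

lemma zero: "0 \<in> {0..<int n}"
  using n_pos by simp

lemma F_flags: "x \<in> carrier Aut \<times> UNIV \<Longrightarrow> F x \<in> flags P"
  using Aut_flag base_flag r_flag[OF base_flag zero] by (auto simp: F_def)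

lemma F_r:
  assumes i: "i \<in> {0..<int n}" and x: "x \<in> carrier Aut \<times> UNIV"
  shows "F (A.rr i x) = r i (F x)"
proof -
  have even: "F (A.rr i x) = r i (F x)" if x: "x \<in> carrier Aut \<times> UNIV" "\<not> snd x" for x
  proof -
    obtain g where g: "x = (g, False)" "g \<in> carrier Aut" using x by auto
    have t: "A.t i \<in> carrier Aut" using i by simp
    have "F (A.rr i x) = g ` (A.t i ` r 0 \<Phi>)"
      using g Aut_mult_image[OF r_flag[OF base_flag zero]] by (simp add: F_def)
    also have "A.t i ` r 0 \<Phi> = r 0 (r 0 (r i \<Phi>))" using Aut_r[OF t base_flag zero] t_base[OF i] by simp
    also have "\<dots> = r i \<Phi>" using r_r[OF zero r_flag[OF base_flag i]] .
    finally show ?thesis using Aut_r[OF g(2) base_flag i] g(1) by (simp add: F_def)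
  qed
  show ?thesis
  proof (cases "snd x")
    case True
    have y: "A.rr i x \<in> carrier Aut \<times> UNIV" "\<not> snd (A.rr i x)"
      using A.fl.r_closed[OF i x] True by simp_all
    have "r i (F (A.rr i x)) = F x" using even[OF y] A.fl.r_r[OF i x] by simp
    then show ?thesis using r_r[OF i F_flags[OF y(1)]] by metis
  qed (use even x in blast)
qed

lemma F_bij: "bij_betw F (carrier Aut \<times> UNIV) (flags P)"
  unfolding bij_betw_def
proof (intro conjI equalityI subsetI)
  define b where "b p = (if p then r 0 \<Phi> else \<Phi>)" for p
  have b: "b p \<in> flags P" for p using base_flag r_flag[OF base_flag zero] by (simp add: b_def)
  have F: "F (g, p) = g ` b p" for g p by (simp add: F_def b_def)
  have rel: "(b p, F (g, p)) \<in> flag_orbit_rel P" if "g \<in> carrier Aut" for g p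
    using b Aut_flag that by (auto simp: flag_orbit_rel_def F)
  have nrel: "(b p, b q) \<notin> flag_orbit_rel P" if "p \<noteq> q" for p q
    using not_rel_r[OF base_flag zero] flag_orbit_rel_sym that by (auto simp: b_def)
  show "inj_on F (carrier Aut \<times> UNIV)"
  proof (rule inj_onI)
    fix x y assume xy: "x \<in> carrier Aut \<times> UNIV" "y \<in> carrier Aut \<times> UNIV" "F x = F y"
    obtain g p where x: "x = (g, p)" "g \<in> carrier Aut" using xy(1) by auto
    obtain h q where y: "y = (h, q)" "h \<in> carrier Aut" using xy(2) by auto
    have "(b p, b q) \<in> flag_orbit_rel P"
      using rel[OF x(2), of p] rel[OF y(2), of q] xy(3) x(1) y(1)
      by (metis flag_orbit_rel_sym flag_orbit_rel_trans)
    then have "p = q" using nrel by metis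
    then show "x = y" using Aut_free[OF x(2) y(2) b[of p]] xy(3) x(1) y(1) F by simp
  qed
  fix y assume y: "y \<in> flags P"
  have "(b False, y) \<in> flag_orbit_rel P \<or> (b True, y) \<in> flag_orbit_rel P"
  proof (rule disjCI)
    assume "(b True, y) \<notin> flag_orbit_rel P"
    then show "(b False, y) \<in> flag_orbit_rel P"
      using two_orbits[OF _ b b y, of False True] nrel[of False True] ch by (simp add: chiral_def)
  qed
  then obtain p where "(b p, y) \<in> flag_orbit_rel P" by blast
  then obtain g where "g \<in> carrier Aut" "y = F (g, p)" by (auto simp: flag_orbit_rel_def F)
  then show "y \<in> F ` (carrier Aut \<times> UNIV)" by blast
qed (use F_flags in auto)

lemma F_base: "F (\<one>\<^bsub>Aut\<^esub>, False) = \<Phi>"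
  using Aut_one_image[OF base_flag] by (simp add: F_def)

text \<open>\<open>G_sub\<close> for \<open>I\<close> is the stabilizer of the base faces whose
  ranks lie outside \<open>I\<close>. Intersecting such stabilizers unites the sets of fixed faces,
  which gives the intersection property at once.\<close>

lemma G_sub_iff:
  assumes I: "I \<subseteq> {0..<int n}"
  shows "g \<in> G_sub n Aut (rotation P) I \<longleftrightarrow> g \<in> carrier Aut \<and> (\<forall>k\<in>{-1..int n} - I. fc (g ` \<Phi>) k = fc \<Phi> k)"
proof -
  have "g \<in> G_sub n Aut (rotation P) I \<longleftrightarrow> g ` \<Phi> \<in> orb r I \<Phi>" if g: "g \<in> carrier Aut"
  proof -
    \<comment> \<open>\<open>F\<close> and its inverse both commute with the steps, so paths of
      labels and paths of flags correspond in both directions.\<close>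
    let ?X = "carrier Aut \<times> (UNIV :: bool set)" and ?Fi = "inv_into (carrier Aut \<times> UNIV) F"
    have o: "(\<one>\<^bsub>Aut\<^esub>, False) \<in> ?X" by simp
    have Fi: "?Fi (F x) = x" if "x \<in> ?X" for x using bij_betw_inv_into_left[OF F_bij that] .
    have FFi: "?Fi y \<in> ?X \<and> F (?Fi y) = y" if "y \<in> flags P" for y
      using F_bij that bij_betw_inv_into_right[OF F_bij that] bij_betwE[OF bij_betw_inv_into[OF F_bij]] by blast
    have Fi_r: "?Fi (r i y) = A.rr i (?Fi y)" if "i \<in> I" "y \<in> flags P" for i y
    proof -
      have i: "i \<in> {0..<int n}" using that I by blast
      have "r i y = F (A.rr i (?Fi y))" using F_r[OF i] FFi[OF that(2)] by metis
      then show ?thesis using Fi[OF A.fl.r_closed[OF i]] FFi[OF that(2)] by metis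
    qed
    have Fg: "F (g, False) = g ` \<Phi>" by (simp add: F_def)
    have "g \<in> G_sub n Aut (rotation P) I \<longleftrightarrow> (g, False) \<in> orb A.rr I (\<one>\<^bsub>Aut\<^esub>, False)"
      using A.orb_even_iff[OF I, of "\<one>\<^bsub>Aut\<^esub>" g] A.G_sub_closed[OF I] by force
    also have "\<dots> \<longleftrightarrow> g ` \<Phi> \<in> orb r I \<Phi>"
    proof
      assume "(g, False) \<in> orb A.rr I (\<one>\<^bsub>Aut\<^esub>, False)"
      then have "F (g, False) \<in> orb r I (F (\<one>\<^bsub>Aut\<^esub>, False))"
        by (rule A.fl.orb_hom[OF _ I o]) (use F_r I in blast)
      then show "g ` \<Phi> \<in> orb r I \<Phi>" unfolding Fg F_base .
    next
      assume "g ` \<Phi> \<in> orb r I \<Phi>"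
      then have "?Fi (g ` \<Phi>) \<in> orb A.rr I (?Fi \<Phi>)"
        by (rule orb_hom[OF _ I base_flag]) (rule Fi_r)
      then show "(g, False) \<in> orb A.rr I (\<one>\<^bsub>Aut\<^esub>, False)"
        using Fi[OF o] Fi[of "(g, False)"] g F_base Fg by simp
    qed
    finally show ?thesis .
  qed
  then show ?thesis
    using A.G_sub_closed[OF I] orb_iff[OF base_flag Aut_flag[OF _ base_flag] I] by blast
qed

sublocale A: rotation_system Aut n "rotation P"
proof unfold_locales
  show "0 < n" by (rule n_pos)
  have "carrier Aut \<subseteq> G_sub n Aut (rotation P) {0..<int n}"
    using G_sub_iff[of "{0..<int n}"] orb_iff[OF base_flag Aut_flag[OF _ base_flag], of _ "{0..<int n}"]
      orb_all[OF base_flag Aut_flag[OF _ base_flag]] by blast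
  moreover have "generate Aut (rotation P ` {1..<n}) \<subseteq> carrier Aut"
    by (rule A.generate_incl) (use rotation_closed in auto)
  ultimately show "generate Aut (rotation P ` {1..<n}) = carrier Aut"
    using A.G_sub_subset_generate by blast
next
  fix i j :: nat assume ij: "1 \<le> i" "i < j" "j < n"
  \<comment> \<open>The condition i < j says exactly that these two ranks are at distance at least
    2, where the adjacencies commute.\<close>
  define a b where "a = int i - 1" and "b = int j"
  have ab: "a \<in> {0..<int n}" "b \<in> {0..<int n}" "\<bar>a - b\<bar> \<ge> 2" using ij by (auto simp: a_def b_def)
  let ?t = "\<tau> Aut (rotation P) i j"
  have c: "?t \<in> carrier Aut" using A.\<tau>_closed ij by simp
  have tb: "?t ` \<Phi> = r a (r b \<Phi>)" using \<tau>_base ij by (simp add: a_def b_def)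
  note fl = base_flag r_flag[OF base_flag ab(1)] r_flag[OF base_flag ab(2)]
  have "(?t \<otimes>\<^bsub>Aut\<^esub> ?t) ` \<Phi> = r a (r b (r a (r b \<Phi>)))"
    using Aut_mult_image[OF base_flag] Aut_r[OF c fl(3) ab(1)] Aut_r[OF c fl(1) ab(2)] tb by simp
  also have "r a (r b \<Phi>) = r b (r a \<Phi>)" using r_commute[OF ab fl(1)] .
  finally have "(?t \<otimes>\<^bsub>Aut\<^esub> ?t) ` \<Phi> = \<Phi>" using r_r ab fl by simp
  then show "?t \<otimes>\<^bsub>Aut\<^esub> ?t = \<one>\<^bsub>Aut\<^esub>"
    using Aut_free[OF A.m_closed[OF c c] A.one_closed base_flag] Aut_one_image[OF base_flag] by simp
next
  fix i j :: nat assume ij: "1 \<le> i" "i \<le> j" "j < n"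
  define a b where "a = int i - 1" and "b = int j"
  have ab: "a \<in> {0..<int n}" "b \<in> {0..<int n}" "a \<noteq> b" using ij by (auto simp: a_def b_def)
  show "\<tau> Aut (rotation P) i j \<noteq> \<one>\<^bsub>Aut\<^esub>"
  proof
    assume "\<tau> Aut (rotation P) i j = \<one>\<^bsub>Aut\<^esub>"
    then have "r a (r b \<Phi>) = \<Phi>" using \<tau>_base[OF ij] Aut_one_image[OF base_flag] by (simp add: a_def b_def)
    then have "r b \<Phi> = r a \<Phi>" using r_r[OF ab(1) r_flag[OF base_flag ab(2)]] by simp
    then have "fc (r b \<Phi>) b = fc \<Phi> b" using r_fc[OF base_flag ab(1), of b] ab by simp
    then show False using r_fc_ne[OF base_flag ab(2)] by simp
  qed
next
  fix m k :: int assume mk: "0 \<le> m" "m \<le> k" "k < int n"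
  have "{0..k} \<subseteq> {0..<int n}" "{m..<int n} \<subseteq> {0..<int n}" "{m..k} \<subseteq> {0..<int n}"
    using mk by auto
  then show "G_sub n Aut (rotation P) {0..k} \<inter> G_sub n Aut (rotation P) {m..<int n}
      \<subseteq> G_sub n Aut (rotation P) {m..k}"
    using G_sub_iff by auto
qed

sublocale L: labelled_polytope Aut n "rotation P" P F
  by unfold_locales (use F_bij F_r F_base in auto)

lemma not_achiral: "\<not> A.achiral"
  using L.achiral_not_chiral ch by blast

end

section \<open>Reversing the generators and self-duality\<close>

lemma (in group) generate_inv_image:
  assumes "S \<subseteq> carrier G"
  shows "generate G (m_inv G ` S) = generate G S"
proof -
  have *: "generate G (m_inv G ` S) \<subseteq> generate G S" if "S \<subseteq> carrier G" for S
    by (rule generate_subgroup_incl) (use that generate_is_subgroup in \<open>auto intro: generate.inv\<close>)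
  have "m_inv G ` m_inv G ` S = S" using assms by (force simp: image_image)
  moreover have "m_inv G ` S \<subseteq> carrier G" using assms by auto
  ultimately show ?thesis using *[OF assms] *[of "m_inv G ` S"] by simp
qed

context group_family
begin

lemma group_family_rev:
  assumes "\<And>i. i \<in> {1..<n} \<Longrightarrow> y i = inv (\<sigma> (n - i))"
  shows "group_family G n y"
  by unfold_locales (use assms \<sigma>_closed in auto)

lemma \<tau>_rev:
  assumes y: "\<And>i. i \<in> {1..<n} \<Longrightarrow> y i = inv (\<sigma> (n - i))"
    and "1 \<le> i" "i \<le> j" "j < n"
  shows "\<tau> G y i j = inv (\<tau> G \<sigma> (n - j) (n - i))"
proof -
  interpret Y: group_family G n y by (rule group_family_rev[OF y])
  show ?thesis
    using assms(2-)
  proof (induction "j - i" arbitrary: i)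
    case 0
    then have "i = j" by simp
    then show ?case using Y.\<tau>_single[of i] \<tau>_single[of "n - i"] y 0 by simp
  next
    case (Suc k)
    have IH: "\<tau> G y (Suc i) j = inv (\<tau> G \<sigma> (n - j) (n - Suc i))" using Suc by simp
    have split: "\<tau> G \<sigma> (n - j) (n - i) = \<tau> G \<sigma> (n - j) (n - i - 1) \<otimes> \<sigma> (n - i)"
      using \<tau>_split[of "n - j" "n - i" "n - i"] \<tau>_single[of "n - i"] Suc by simp
    have c: "\<tau> G \<sigma> (n - j) (n - i - 1) \<in> carrier G" "\<sigma> (n - i) \<in> carrier G"
      using \<tau>_closed[of "n - j" "n - i - 1"] \<sigma>_closed[of "n - i"] Suc by auto
    show ?case using Y.\<tau>_Cons[of i j] IH y[of i] split c Suc.prems Suc.hyps(2) by (simp add: inv_mult_group)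
  qed
qed

text \<open>Reversing and inverting the generators inverts each \<tau> and reflects its ranks by k
  \<mapsto> n - 1 - k; inverses generate the same subgroup.\<close>

lemma G_sub_rev:
  assumes y: "\<And>i. i \<in> {1..<n} \<Longrightarrow> y i = inv (\<sigma> (n - i))"
  shows "G_sub n G y I = G_sub n G \<sigma> ((\<lambda>k. int n - 1 - k) ` I)"
proof -
  let ?S = "{\<tau> G \<sigma> i j | i j. 1 \<le> i \<and> i \<le> j \<and> j < n \<and>
    int i - 1 \<in> (\<lambda>k. int n - 1 - k) ` I \<and> int j \<in> (\<lambda>k. int n - 1 - k) ` I}"
  have mem: "a \<in> (\<lambda>k. int n - 1 - k) ` I \<longleftrightarrow> int n - 1 - a \<in> I" for a
    by (force simp: image_iff intro: bexI[of _ "int n - 1 - a"])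
  have "{\<tau> G y i j | i j. 1 \<le> i \<and> i \<le> j \<and> j < n \<and> int i - 1 \<in> I \<and> int j \<in> I} = m_inv G ` ?S" (is "?A = _")
  proof (intro equalityI subsetI)
    fix x assume "x \<in> ?A"
    then obtain i j where ij: "x = \<tau> G y i j" "1 \<le> i" "i \<le> j" "j < n" "int i - 1 \<in> I" "int j \<in> I" by blast
    then have "\<tau> G \<sigma> (n - j) (n - i) \<in> ?S"
      by (intro CollectI exI[of _ "n - j"] exI[of _ "n - i"]) (auto simp: mem of_nat_diff)
    then show "x \<in> m_inv G ` ?S" using \<tau>_rev[OF y] ij by blast
  next
    fix x assume "x \<in> m_inv G ` ?S"
    then obtain i j where ij: "x = inv (\<tau> G \<sigma> i j)" "1 \<le> i" "i \<le> j" "j < n"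
      "int n - 1 - (int i - 1) \<in> I" "int n - 1 - int j \<in> I" by (auto simp: mem)
    then have "\<tau> G y (n - j) (n - i) = x" using \<tau>_rev[OF y, of "n - j" "n - i"] by simp
    then show "x \<in> ?A" using ij
      by (intro CollectI exI[of _ "n - j"] exI[of _ "n - i"]) (auto simp: of_nat_diff algebra_simps)
  qed
  moreover have "?S \<subseteq> carrier G" using \<tau>_closed by auto
  ultimately show ?thesis unfolding G_sub_def using generate_inv_image by simp
qed

end

lemma (in rotation_system) rev_rotation_system:
  assumes y: "\<And>i. i \<in> {1..<n} \<Longrightarrow> y i = inv (\<sigma> (n - i))"
  shows "rotation_system G n y"
proof -
  interpret Y: group_family G n y by (rule group_family_rev[OF y])
  show ?thesis
  proof
    show "0 < n" by (rule n_pos)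
    have "y ` {1..<n} = m_inv G ` \<sigma> ` {1..<n}"
    proof (intro equalityI subsetI)
      fix a assume "a \<in> y ` {1..<n}"
      then obtain i where "i \<in> {1..<n}" "a = inv (\<sigma> (n - i))" using y by auto
      then show "a \<in> m_inv G ` \<sigma> ` {1..<n}" by force
    next
      fix a assume "a \<in> m_inv G ` \<sigma> ` {1..<n}"
      then obtain i where "i \<in> {1..<n}" "a = inv (\<sigma> i)" by blast
      then have "n - i \<in> {1..<n}" "a = y (n - i)" using y[of "n - i"] by auto
      then show "a \<in> y ` {1..<n}" by blast
    qed
    moreover have "\<sigma> ` {1..<n} \<subseteq> carrier G" using \<sigma>_closed by auto
    ultimately show "generate G (y ` {1..<n}) = carrier G"
      using generate_inv_image[of "\<sigma> ` {1..<n}"] generated by simp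
  next
    fix i j assume ij: "1 \<le> i" "i < j" "j < n"
    have c: "\<tau> G \<sigma> (n - j) (n - i) \<in> carrier G" using \<tau>_closed ij by simp
    have "inv (\<tau> G \<sigma> (n - j) (n - i) \<otimes> \<tau> G \<sigma> (n - j) (n - i)) = \<one>"
      using involution[of "n - j" "n - i"] ij by simp
    then show "\<tau> G y i j \<otimes> \<tau> G y i j = \<one>"
      using \<tau>_rev[OF y] ij c by (simp add: inv_mult_group)
  next
    fix i j assume ij: "1 \<le> i" "i \<le> j" "j < n"
    then have "\<tau> G \<sigma> (n - j) (n - i) \<in> carrier G" "\<tau> G \<sigma> (n - j) (n - i) \<noteq> \<one>"
      using \<tau>_closed nontrivial by simp_all
    then show "\<tau> G y i j \<noteq> \<one>" using \<tau>_rev[OF y ij] by simp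
  next
    fix m k :: int assume mk: "0 \<le> m" "m \<le> k" "k < int n"
    let ?\<rho> = "\<lambda>k. int n - 1 - k"
    have G: "G_sub n G y I = G_sub n G \<sigma> (?\<rho> ` I)" for I by (rule G_sub_rev) (rule y)
    \<comment> \<open>Reflection exchanges initial and final segments, so the interval form of the
      intersection property is symmetric under it.\<close>
    have rev: "?\<rho> ` {0..k} = {?\<rho> k..<int n}" "?\<rho> ` {m..<int n} = {0..?\<rho> m}" "?\<rho> ` {m..k} = {?\<rho> k..?\<rho> m}"
      by (force simp: image_iff intro: bexI[of _ "?\<rho> x" for x])+
    show "G_sub n G y {0..k} \<inter> G_sub n G y {m..<int n} \<subseteq> G_sub n G y {m..k}"
      unfolding G rev using intersection[of "?\<rho> k" "?\<rho> m"] mk by auto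
  qed
qed

lemma (in group_family) \<tau>_hom:
  assumes "\<theta> \<in> hom G G" "1 \<le> i" "j < n"
  shows "\<tau> G (\<lambda>i. \<theta> (\<sigma> i)) i j = \<theta> (\<tau> G \<sigma> i j)"
proof -
  interpret \<theta>: group_hom G G \<theta> using assms(1) by unfold_locales
  interpret Y: group_family G n "\<lambda>i. \<theta> (\<sigma> i)" by unfold_locales (simp add: \<sigma>_closed)
  show ?thesis
    using assms(2,3)
  proof (induction "Suc j - i" arbitrary: i)
    case 0
    then show ?case by (simp add: \<tau>_empty Y.\<tau>_empty)
  next
    case (Suc k)
    then have "i \<le> j" by simp
    then show ?case using Suc \<tau>_Cons[of i j] Y.\<tau>_Cons[of i j] \<sigma>_closed[of i] \<tau>_closed[of "Suc i" j] by simp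
  qed
qed

lemma (in group_family) G_sub_hom:
  assumes "\<theta> \<in> hom G G"
  shows "G_sub n G (\<lambda>i. \<theta> (\<sigma> i)) I = \<theta> ` G_sub n G \<sigma> I"
proof -
  interpret \<theta>: group_hom G G \<theta> using assms by unfold_locales
  let ?S = "{\<tau> G \<sigma> i j | i j. 1 \<le> i \<and> i \<le> j \<and> j < n \<and> int i - 1 \<in> I \<and> int j \<in> I}"
  have "?S \<subseteq> carrier G" using \<tau>_closed by auto
  moreover have "{\<tau> G (\<lambda>i. \<theta> (\<sigma> i)) i j | i j. 1 \<le> i \<and> i \<le> j \<and> j < n \<and> int i - 1 \<in> I \<and> int j \<in> I} = \<theta> ` ?S"
    (is "?A = _")
  proof (intro equalityI subsetI)
    fix x assume "x \<in> ?A"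
    then show "x \<in> \<theta> ` ?S" using \<tau>_hom[OF assms] by blast
  next
    fix x assume "x \<in> \<theta> ` ?S"
    then show "x \<in> ?A" using \<tau>_hom[OF assms, symmetric] by blast
  qed
  ultimately show ?thesis unfolding G_sub_def using \<theta>.generate_img by simp
qed

text \<open>The automorphism \<theta> carries the subgroup of rank j to that of rank n - 1 - j.
  Applying it to cosets reflects the ranks and keeps incidence, which is nonempty intersection; the
  base subgroups are permuted, so the base flag is fixed.\<close>

lemma (in group_family) properly_self_dual_coset_poset:
  assumes \<theta>: "\<theta> \<in> iso G G" and rev: "\<And>i. i \<in> {1..<n} \<Longrightarrow> \<theta> (\<sigma> i) = inv (\<sigma> (n - i))"
  shows "properly_self_dual (coset_poset n G \<sigma>)"
proof -
  interpret \<theta>: group_hom G G \<theta> using \<theta> by unfold_locales (simp add: iso_def)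
  have bij: "bij_betw \<theta> (carrier G) (carrier G)" using \<theta> by (simp add: iso_def)
  define H where "H = face_group n G \<sigma>"
  define \<rho> where "\<rho> k = int n - 1 - k" for k :: int
  have H_sub: "H j \<subseteq> carrier G" for j
    unfolding H_def face_group_def by (rule G_sub_closed) auto
  have \<theta>H: "\<theta> ` H j = H (\<rho> j)" for j
  proof -
    have "\<theta> ` H j = G_sub n G \<sigma> (\<rho> ` ({0..int n - 1} - {j}))"
      unfolding H_def face_group_def \<rho>_def using G_sub_hom[OF \<theta>.homh] G_sub_rev[OF rev] by simp
    also have "\<rho> ` ({0..int n - 1} - {j}) = {0..int n - 1} - {\<rho> j}"
    proof (rule Set.set_eqI)
      fix a
      have "a \<in> \<rho> ` I \<longleftrightarrow> \<rho> a \<in> I" for I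
        by (force simp: image_iff \<rho>_def intro: bexI[of _ "\<rho> a"])
      then show "a \<in> \<rho> ` ({0..int n - 1} - {j}) \<longleftrightarrow> a \<in> {0..int n - 1} - {\<rho> j}"
        by (auto simp: \<rho>_def)
    qed
    finally show ?thesis by (simp add: H_def face_group_def)
  qed
  have \<theta>_coset: "\<theta> ` (H j #> g) = H (\<rho> j) #> \<theta> g" if "g \<in> carrier G" for j g
  proof -
    have "\<theta> ` (H j #> g) = \<theta> ` H j #> \<theta> g"
      using H_sub[of j] that unfolding r_coset_def by (auto simp: image_iff subset_iff)
    then show ?thesis by (simp add: \<theta>H)
  qed
  define A where "A = (SIGMA j:{- 1..int n}. rcosets (H j))"
  have A_cases: "\<exists>g\<in>carrier G. snd F = H (fst F) #> g \<and> fst F \<in> {-1..int n}" if "F \<in> A" for F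
    using that by (auto simp: A_def RCOSETS_def)
  have A_I: "(j, H j #> g) \<in> A" if "g \<in> carrier G" "j \<in> {-1..int n}" for j g
    using that by (auto simp: A_def RCOSETS_def)
  have A_sub: "snd F \<subseteq> carrier G" if "F \<in> A" for F
    using A_cases[OF that] H_sub r_coset_subset_G by metis
  define d where "d F = (\<rho> (fst F), \<theta> ` snd F)" for F
  have \<rho>: "\<rho> j \<in> {-1..int n}" "\<rho> (\<rho> j) = j" if "j \<in> {-1..int n}" for j using that by (auto simp: \<rho>_def)
  have "bij_betw d A A"
    unfolding bij_betw_def
  proof (intro conjI equalityI subsetI)
    show "inj_on d A"
    proof (rule inj_onI)
      fix F F' assume "F \<in> A" "F' \<in> A" "d F = d F'"
      then show "F = F'"
        using A_sub inj_on_image_eq_iff[OF bij_betw_imp_inj_on[OF bij]]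
        by (simp add: d_def \<rho>_def prod_eq_iff)
    qed
  next
    fix F assume "F \<in> d ` A"
    then obtain F' where F': "F' \<in> A" "F = d F'" by blast
    then obtain g where g: "g \<in> carrier G" "snd F' = H (fst F') #> g" "fst F' \<in> {-1..int n}"
      using A_cases by blast
    then have "F = (\<rho> (fst F'), H (\<rho> (fst F')) #> \<theta> g)" using F'(2) \<theta>_coset by (simp add: d_def)
    then show "F \<in> A" using A_I[OF \<theta>.hom_closed[OF g(1)] \<rho>(1)[OF g(3)]] by simp
  next
    fix F assume "F \<in> A"
    then obtain g where g: "g \<in> carrier G" "F = (fst F, H (fst F) #> g)" "fst F \<in> {-1..int n}"
      using A_cases by (metis prod.collapse)
    obtain g' where g': "g' \<in> carrier G" "g = \<theta> g'" using bij g(1) by (auto simp: bij_betw_def)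
    have "F = d (\<rho> (fst F), H (\<rho> (fst F)) #> g')"
      using g g' \<theta>_coset[of g'] \<rho>(2)[OF g(3)] by (simp add: d_def)
    then show "F \<in> d ` A" using A_I[OF g'(1) \<rho>(1)[OF g(3)]] by blast
  qed
  moreover have "(F, F') \<in> le (coset_poset n G \<sigma>) \<longleftrightarrow> (d F', d F) \<in> le (coset_poset n G \<sigma>)"
    if "F \<in> A" "F' \<in> A" for F F'
  proof -
    have le: "(F, F') \<in> le (coset_poset n G \<sigma>) \<longleftrightarrow> fst F \<le> fst F' \<and> snd F \<inter> snd F' \<noteq> {}"
      if "F \<in> A" "F' \<in> A" for F F'
      using that by (cases F, cases F') (simp add: coset_poset_def Let_def A_def H_def)
    have "\<theta> ` snd F' \<inter> \<theta> ` snd F = \<theta> ` (snd F' \<inter> snd F)"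
      using inj_on_image_Int[OF bij_betw_imp_inj_on[OF bij] A_sub A_sub] that by simp
    moreover have "d F \<in> A" "d F' \<in> A" using \<open>bij_betw d A A\<close> that bij_betwE by blast+
    ultimately show ?thesis using that le by (auto simp: d_def \<rho>_def)
  qed
  moreover have "d ` base_flag (coset_poset n G \<sigma>) = base_flag (coset_poset n G \<sigma>)"
  proof -
    have "d ` (\<lambda>j. (j, H j)) ` {-1..int n} = (\<lambda>j. (\<rho> j, H (\<rho> j))) ` {-1..int n}"
      by (simp add: image_image d_def \<theta>H)
    also have "\<dots> = (\<lambda>j. (j, H j)) ` \<rho> ` {-1..int n}" by (simp add: image_image)
    also have "\<rho> ` {-1..int n} = {-1..int n}" using \<rho> by (force simp: image_iff)
    finally show ?thesis by (simp add: coset_poset_def Let_def H_def)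
  qed
  moreover have "faces (coset_poset n G \<sigma>) = A" by (simp add: coset_poset_def Let_def A_def H_def)
  ultimately show ?thesis unfolding properly_self_dual_def by auto
qed

section \<open>The dual polytope\<close>

lemma flags_dual: "flags (dual n P) = flags P"
proof -
  have "Chains ((le P)\<inverse>) = Chains (le P)" by (auto simp: Chains_def)
  then show ?thesis by (simp add: flags_def dual_def)
qed

lemma automorphism_group_dual: "automorphism_group (dual n P) = automorphism_group P"
proof -
  have "{f \<in> Bij (faces P). \<forall>F\<in>faces P. \<forall>G\<in>faces P. (G, F) \<in> le P \<longleftrightarrow> (f G, f F) \<in> le P} =
    {f \<in> Bij (faces P). \<forall>F\<in>faces P. \<forall>G\<in>faces P. (F, G) \<in> le P \<longleftrightarrow> (f F, f G) \<in> le P}" by blast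
  then show ?thesis by (simp add: automorphism_group_def dual_def)
qed

lemma base_flag_dual: "base_flag (dual n P) = base_flag P"
  by (simp add: dual_def)

lemma flag_adj_dual: "flag_adj (dual n P) j = flag_adj P (int n - 1 - j)"
proof -
  have "rank (dual n P) F \<noteq> j \<longleftrightarrow> rank P F \<noteq> int n - 1 - j" for F by (auto simp: dual_def)
  then show ?thesis unfolding flag_adj_def flags_dual by simp
qed

context chiral_polytope
begin

lemma rotation_inv_base:
  assumes i: "i \<in> {1..<n}"
  shows "(inv\<^bsub>Aut\<^esub> (rotation P i)) ` \<Phi> = r (int i) (r (int i - 1) \<Phi>)"
proof -
  have ii: "int i \<in> {0..<int n}" "int i - 1 \<in> {0..<int n}" using i by auto
  note c = rotation_closed[OF i] A.inv_closed[OF rotation_closed[OF i]]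
  let ?f = "inv\<^bsub>Aut\<^esub> (rotation P i)"
  have "r (int i - 1) (r (int i) (?f ` \<Phi>)) = ?f ` rotation P i ` \<Phi>"
    using Aut_r[OF c(2)] base_flag r_flag ii rotation_base[OF i] by simp
  also have "\<dots> = (rotation P i \<otimes>\<^bsub>Aut\<^esub> ?f) ` \<Phi>" using Aut_mult_image[OF base_flag] by simp
  also have "\<dots> = \<Phi>" using c(1) Aut_one_image[OF base_flag] by simp
  finally have *: "r (int i - 1) (r (int i) (?f ` \<Phi>)) = \<Phi>" .
  note fl = Aut_flag[OF c(2) base_flag]
  show ?thesis
    using r_r[OF ii(1) fl] r_r[OF ii(2) r_flag[OF fl ii(1)]] * by metis
qed

end

text \<open>In the dual the steps i and i - 1 become n - 1 - i and n - i. This is the pair of steps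
  performed by the rotation numbered n - i, in the opposite order, hence the inverse.\<close>

lemma rotation_dual:
  fixes P :: "'a ranked_poset"
  assumes "chiral_polytope n P" and i: "i \<in> {1..<n}"
  shows "rotation (dual n P) i = inv\<^bsub>automorphism_group P\<^esub> (rotation P (n - i))"
proof -
  interpret chiral_polytope n P by fact
  have i': "n - i \<in> {1..<n}" using i by auto
  let ?f = "inv\<^bsub>Aut\<^esub> (rotation P (n - i))"
  have c: "?f \<in> carrier Aut" using A.inv_closed[OF rotation_closed[OF i']] .
  have "int n - 1 - (int i - 1) = int (n - i)" "int n - 1 - int i = int (n - i) - 1" using i by auto
  note e = this
  have f: "?f ` \<Phi> = r (int n - 1 - (int i - 1)) (r (int n - 1 - int i) \<Phi>)"
    unfolding e by (rule rotation_inv_base[OF i'])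
  show ?thesis
    unfolding rotation_def[of "dual n P"] automorphism_group_dual base_flag_dual flag_adj_dual
  proof (rule the_equality)
    fix g assume "g \<in> carrier Aut \<and> g ` \<Phi> = r (int n - 1 - (int i - 1)) (r (int n - 1 - int i) \<Phi>)"
    then show "g = ?f" using Aut_free[of g ?f \<Phi>] f c base_flag by simp
  qed (use c f in simp)
qed

section \<open>Products of rotation groups of coprime type\<close>

lemma \<tau>_DirProd: "\<tau> (G \<times>\<times> H) (\<lambda>i. (x i, y i)) i j = (\<tau> G x i j, \<tau> H y i j)"
proof -
  have "foldr (\<lambda>k z. (x k, y k) \<otimes>\<^bsub>G \<times>\<times> H\<^esub> z) l \<one>\<^bsub>G \<times>\<times> H\<^esub> =
    (foldr (\<lambda>k z. x k \<otimes>\<^bsub>G\<^esub> z) l \<one>\<^bsub>G\<^esub>, foldr (\<lambda>k z. y k \<otimes>\<^bsub>H\<^esub> z) l \<one>\<^bsub>H\<^esub>)" for l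
    by (induction l) auto
  then show ?thesis by (simp add: \<tau>_def)
qed

locale coprime_pair = A: rotation_system G n x + B: rotation_system H n y
  for G (structure) and H (structure) and n x y +
  assumes coprime_ord: "i \<in> {1..<n} \<Longrightarrow> coprime (A.ord (x i)) (B.ord (y i))"
begin

abbreviation GH where "GH \<equiv> G \<times>\<times> H"
abbreviation xy where "xy \<equiv> \<lambda>i. (x i, y i)"

sublocale C: group GH
  by (rule DirProd_group) unfold_locales

sublocale C: group_family GH n xy
  by unfold_locales (use A.\<sigma>_closed B.\<sigma>_closed in auto)

sublocale fst: group_hom GH G fst
  by unfold_locales (auto simp: hom_def)

sublocale snd: group_hom GH H snd
  by unfold_locales (auto simp: hom_def)

lemma t_prod: "C.t i = (A.t i, B.t i)"
  by (simp add: C.t_def A.t_def B.t_def \<tau>_DirProd)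

text \<open>Bezout provides an exponent congruent to 1 modulo the first order and to 0 modulo the
  second. The first congruence is kept in the conclusion because \<open>not_achiral_prod\<close>
  applies the same power to mirror images.\<close>

lemma coprime_power:
  assumes i: "i \<in> {1..<n}"
  obtains k :: int where "xy i [^]\<^bsub>GH\<^esub> k = (x i, \<one>\<^bsub>H\<^esub>)" "int (A.ord (x i)) dvd k - 1"
proof -
  have c: "x i \<in> carrier G" "y i \<in> carrier H" using A.\<sigma>_closed B.\<sigma>_closed i by auto
  have "gcd (int (A.ord (x i))) (int (B.ord (y i))) = 1"
    using coprime_ord[OF i] by (simp flip: coprime_iff_gcd_eq_1 add: coprime_int_iff)
  then obtain u v where uv: "u * int (A.ord (x i)) + v * int (B.ord (y i)) = 1" using bezout_int by metis
  define k where "k = v * int (B.ord (y i))"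
  have k: "int (A.ord (x i)) dvd k - 1" "int (B.ord (y i)) dvd k"
    using uv by (auto simp: k_def dvd_def intro!: exI[of _ "- u"]) (simp add: algebra_simps)
  have "x i [^] k = x i [^] (1 :: int)" using A.int_pow_eq[OF c(1)] k(1) by (metis dvd_minus_iff minus_diff_eq)
  moreover have "y i [^]\<^bsub>H\<^esub> k = \<one>\<^bsub>H\<^esub>" using B.int_pow_eq_id c k(2) by simp
  moreover have "fst (xy i [^]\<^bsub>GH\<^esub> k) = x i [^] k" "snd (xy i [^]\<^bsub>GH\<^esub> k) = y i [^]\<^bsub>H\<^esub> k"
    using fst.hom_int_pow[of "xy i" k] snd.hom_int_pow[of "xy i" k] C.\<sigma>_closed[OF i] by simp_all
  ultimately have "xy i [^]\<^bsub>GH\<^esub> k = (x i, \<one>\<^bsub>H\<^esub>)"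
    using c A.int_pow_1 by (metis prod.collapse)
  then show ?thesis using that k(1) by blast
qed

text \<open>A subgroup containing the i-th pair contains its power (x i, 1), and then by division
  (1, y i) as well, so the two components can be moved independently.\<close>

lemma product_mem:
  assumes S: "subgroup S GH" and K: "K \<subseteq> {1..<n}" "\<And>i. i \<in> K \<Longrightarrow> xy i \<in> S"
    and g: "g \<in> generate G (x ` K)" and h: "h \<in> generate H (y ` K)"
  shows "(g, h) \<in> S"
proof -
  have Kc: "x ` K \<subseteq> carrier G" "y ` K \<subseteq> carrier H" using K(1) A.\<sigma>_closed B.\<sigma>_closed by auto
  have xS: "(x i, \<one>\<^bsub>H\<^esub>) \<in> S" if "i \<in> K" for i
  proof -
    have "i \<in> {1..<n}" using K(1) that by blast
    then obtain k :: int where "xy i [^]\<^bsub>GH\<^esub> k = (x i, \<one>\<^bsub>H\<^esub>)" by (rule coprime_power)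
    then show ?thesis using C.subgroup_int_pow_closed[OF S K(2)[OF that], of k] by simp
  qed
  have yS: "(\<one>, y i) \<in> S" if "i \<in> K" for i
  proof -
    have c: "x i \<in> carrier G" "y i \<in> carrier H" using that Kc by auto
    have "inv\<^bsub>GH\<^esub> (x i, \<one>\<^bsub>H\<^esub>) \<otimes>\<^bsub>GH\<^esub> xy i \<in> S"
      using subgroup.m_closed[OF S] subgroup.m_inv_closed[OF S] xS[OF that] K(2)[OF that] by blast
    then show ?thesis using c inv_DirProd[OF A.is_group B.is_group c(1) B.one_closed] by simp
  qed
  have "(g, \<one>\<^bsub>H\<^esub>) \<in> S"
    using g
  proof (induction rule: generate.induct)
    case one
    then show ?case using subgroup.one_closed[OF S] by simp
  next
    case (inv a)
    then have "a \<in> carrier G" "(a, \<one>\<^bsub>H\<^esub>) \<in> S" using Kc xS by auto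
    then show ?case
      using subgroup.m_inv_closed[OF S] inv_DirProd[OF A.is_group B.is_group _ B.one_closed] by force
  next
    case (eng a b)
    then show ?case using subgroup.m_closed[OF S eng(3,4)] by simp
  qed (use xS in blast)
  moreover have "(\<one>, h) \<in> S"
    using h
  proof (induction rule: generate.induct)
    case one
    then show ?case using subgroup.one_closed[OF S] by simp
  next
    case (inv a)
    then have "a \<in> carrier H" "(\<one>, a) \<in> S" using Kc yS by auto
    then show ?case
      using subgroup.m_inv_closed[OF S] inv_DirProd[OF A.is_group B.is_group A.one_closed] by force
  next
    case (eng a b)
    then show ?case using subgroup.m_closed[OF S eng(3,4)] by simp
  qed (use yS in blast)
  moreover have "g \<in> carrier G" "h \<in> carrier H"
    using g h A.generate_in_carrier[OF Kc(1)] B.generate_in_carrier[OF Kc(2)] by auto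
  ultimately show ?thesis using subgroup.m_closed[OF S] by fastforce
qed

lemma G_sub_subset_prod:
  assumes I: "I \<subseteq> {0..<int n}"
  shows "G_sub n GH xy I \<subseteq> G_sub n G x I \<times> G_sub n H y I"
  unfolding G_sub_def[of n GH]
proof (rule C.generate_subgroup_incl)
  have "subgroup (G_sub n G x I) G" "subgroup (G_sub n H y I) H"
    unfolding G_sub_def using A.\<tau>_closed B.\<tau>_closed
    by (intro A.generate_is_subgroup B.generate_is_subgroup; auto)+
  then show "subgroup (G_sub n G x I \<times> G_sub n H y I) GH"
    by (rule DirProd_subgroups[OF A.is_group _ B.is_group])
qed (auto simp: \<tau>_DirProd G_sub_def intro!: generate.incl)

lemma generate_xy: "generate GH (xy ` {1..<n}) = carrier GH"
proof -
  have S: "subgroup (generate GH (xy ` {1..<n})) GH"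
    by (rule C.generate_is_subgroup) (use C.\<sigma>_closed in auto)
  have "(g, h) \<in> generate GH (xy ` {1..<n})" if "g \<in> carrier G" "h \<in> carrier H" for g h
    by (rule product_mem[OF S order.refl]) (use that A.generated B.generated in \<open>auto intro: generate.incl\<close>)
  then show ?thesis using subgroup.subset[OF S] by auto
qed

sublocale C: rotation_system GH n xy
proof
  show "0 < n" by (rule A.n_pos)
  show "generate GH (xy ` {1..<n}) = carrier GH" by (rule generate_xy)
next
  fix i j assume "1 \<le> i" "i < j" "j < n"
  then show "\<tau> GH xy i j \<otimes>\<^bsub>GH\<^esub> \<tau> GH xy i j = \<one>\<^bsub>GH\<^esub>"
    using A.involution B.involution by (simp add: \<tau>_DirProd)
next
  fix i j assume "1 \<le> i" "i \<le> j" "j < n"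
  then show "\<tau> GH xy i j \<noteq> \<one>\<^bsub>GH\<^esub>" using A.nontrivial by (simp add: \<tau>_DirProd)
next
  fix m k :: int assume mk: "0 \<le> m" "m \<le> k" "k < int n"
  have sub: "{0..k} \<subseteq> {0..<int n}" "{m..<int n} \<subseteq> {0..<int n}" "{m..k} \<subseteq> {0..<int n}" using mk by auto
  show "G_sub n GH xy {0..k} \<inter> G_sub n GH xy {m..<int n} \<subseteq> G_sub n GH xy {m..k}"
  proof
    fix p assume p: "p \<in> G_sub n GH xy {0..k} \<inter> G_sub n GH xy {m..<int n}"
    obtain g h where gh: "p = (g, h)" by (cases p)
    have "(g, h) \<in> G_sub n G x {0..k} \<times> G_sub n H y {0..k}"
      "(g, h) \<in> G_sub n G x {m..<int n} \<times> G_sub n H y {m..<int n}"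
      using p G_sub_subset_prod[OF sub(1)] G_sub_subset_prod[OF sub(2)] gh by blast+
    then have "g \<in> G_sub n G x {m..k}" "h \<in> G_sub n H y {m..k}"
      using A.intersection[OF mk] B.intersection[OF mk] by auto
    \<comment> \<open>Here the interval matters: both components are words in the generators inside
      it, and each corresponding pair lies in the target subgroup, so \<open>product_mem\<close>
      reassembles them.\<close>
    then have g: "g \<in> generate G (x ` {nat m + 1..nat k})" and h: "h \<in> generate H (y ` {nat m + 1..nat k})"
      using A.G_sub_interval_generate B.G_sub_interval_generate mk by blast+
    have S: "subgroup (G_sub n GH xy {m..k}) GH"
      unfolding G_sub_def by (rule C.generate_is_subgroup) (use C.\<tau>_closed in blast)
    have "xy i \<in> G_sub n GH xy {m..k}" if "i \<in> {nat m + 1..nat k}" for i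
    proof -
      have i: "1 \<le> i" "i < n" "int i - 1 \<in> {m..k}" "int i \<in> {m..k}" using that mk by auto
      have "\<tau> GH xy i i \<in> G_sub n GH xy {m..k}" unfolding G_sub_def
        by (rule generate.incl) (use i in blast)
      then show ?thesis using C.\<tau>_single[of i] i by simp
    qed
    moreover have "{nat m + 1..nat k} \<subseteq> {1..<n}" using mk by auto
    ultimately have "(g, h) \<in> G_sub n GH xy {m..k}" using product_mem[OF S _ _ g h] by blast
    then show "p \<in> G_sub n GH xy {m..k}" using gh by simp
  qed
qed

text \<open>A mirror homomorphism of the product restricts to one of the first factor: the power
  of the $i$-th generator that lies in the first factor is mapped to the same power of its
  mirror image, whose first component has the same order as $x_i$.\<close>

lemma not_achiral_prod:
  assumes "\<not> A.achiral"
  shows "\<not> C.achiral"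
proof
  assume C.achiral
  then obtain \<theta> where \<theta>: "\<theta> \<in> hom GH GH" "\<And>i. i \<in> {0..<int n} \<Longrightarrow> \<theta> (C.t i) = inv\<^bsub>GH\<^esub> (C.t i)"
    unfolding C.achiral_def by blast
  interpret \<theta>: group_hom GH GH \<theta> using \<theta>(1) by unfold_locales
  define \<phi> where "\<phi> g = fst (\<theta> (g, \<one>\<^bsub>H\<^esub>))" for g
  have \<phi>: "\<phi> \<in> hom G G"
  proof (rule homI)
    fix a b assume ab: "a \<in> carrier G" "b \<in> carrier G"
    have "\<theta> (a \<otimes> b, \<one>\<^bsub>H\<^esub>) = \<theta> (a, \<one>\<^bsub>H\<^esub>) \<otimes>\<^bsub>GH\<^esub> \<theta> (b, \<one>\<^bsub>H\<^esub>)"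
      using \<theta>.hom_mult[of "(a, \<one>\<^bsub>H\<^esub>)" "(b, \<one>\<^bsub>H\<^esub>)"] ab by simp
    then show "\<phi> (a \<otimes> b) = \<phi> a \<otimes> \<phi> b"
      using fst.hom_mult \<theta>.hom_closed ab by (simp add: \<phi>_def)
    show "\<phi> a \<in> carrier G" using fst.hom_closed \<theta>.hom_closed ab by (simp add: \<phi>_def)
  qed
  interpret \<phi>: group_hom G G \<phi> using \<phi> by unfold_locales
  have \<phi>x: "\<phi> (x i) = A.t (int i - 1) \<otimes> inv (A.t (int i))" if i: "i \<in> {1..<n}" for i
  proof -
    have ii: "int i - 1 \<in> {0..<int n}" "int i \<in> {0..<int n}" using i by auto
    define s u where "s = A.t (int i - 1)" and "u = A.t (int i)"
    have su: "s \<in> carrier G" "u \<in> carrier G" using ii by (auto simp: s_def u_def)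
    have xc: "x i \<in> carrier G" using A.\<sigma>_closed[OF i] .
    have x: "x i = inv s \<otimes> u" using A.t_diff_\<sigma>[OF i] by (simp add: s_def u_def)
    obtain k where k: "xy i [^]\<^bsub>GH\<^esub> k = (x i, \<one>\<^bsub>H\<^esub>)" "int (A.ord (x i)) dvd k - 1"
      using coprime_power[OF i] .
    have "\<theta> (xy i) = C.t (int i - 1) \<otimes>\<^bsub>GH\<^esub> inv\<^bsub>GH\<^esub> (C.t (int i))"
      unfolding C.t_diff_\<sigma>[OF i, symmetric]
      using \<theta>(2)[OF ii(1)] \<theta>(2)[OF ii(2)] C.t_closed ii
      by (simp del: carrier_DirProd mult_DirProd add: \<theta>.hom_mult)
    then have "fst (\<theta> (xy i)) = s \<otimes> inv u"
      using fst.hom_mult fst.hom_inv ii by (simp add: t_prod s_def u_def)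
    then have "\<phi> (x i) = (s \<otimes> inv u) [^] k"
      using \<theta>.hom_int_pow[of "xy i" k] fst.hom_int_pow[of "\<theta> (xy i)" k] C.\<sigma>_closed[OF i] k(1)
        \<theta>.hom_closed[of "xy i"]
      by (simp add: \<phi>_def del: carrier_DirProd)
    moreover have "(s \<otimes> inv u) [^] k = s \<otimes> inv u"
    proof -
      \<comment> \<open>Conjugation by s carries the inverse of x i, that is inv u times s, to the
        mirror image s times inv u. The exponent k therefore fixes the mirror image just as it fixes
        x i.\<close>
      define c where "c g = s \<otimes> g \<otimes> inv s" for g
      have "c \<in> hom G G"
      proof (rule homI)
        fix a b assume "a \<in> carrier G" "b \<in> carrier G"
        then show "c (a \<otimes> b) = c a \<otimes> c b"
          using su(1) by (simp add: c_def A.m_assoc) (simp add: A.m_assoc[symmetric])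
      qed (use su in \<open>simp add: c_def\<close>)
      then interpret c: group_hom G G c by unfold_locales
      have "c (inv (x i)) = s \<otimes> inv u" using su x by (simp add: c_def A.inv_mult_group A.m_assoc)
      moreover have "inv (x i) [^] k = inv (x i)"
        using A.int_pow_eq[of "inv (x i)" k 1] k(2) xc A.ord_inv[OF xc]
        by (metis A.int_pow_1 A.inv_closed dvd_minus_iff minus_diff_eq)
      ultimately show ?thesis using c.hom_int_pow[of "inv (x i)" k] xc by simp
    qed
    ultimately show ?thesis by (simp add: s_def u_def)
  qed
  \<comment> \<open>From generators back to prefix products: t (i + 1) is t i times the next
    generator, and the mirrored factors telescope.\<close>
  have "\<phi> (A.t (int i)) = inv (A.t (int i))" if "i < n" for i
    using that
  proof (induction i)
    case (Suc i)
    have c: "A.t (int i) \<in> carrier G" "A.t (int (Suc i)) \<in> carrier G" using Suc by auto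
    have "A.t (int (Suc i)) = A.t (int i) \<otimes> (inv (A.t (int i)) \<otimes> A.t (int (Suc i)))"
      using c by (simp add: A.m_assoc[symmetric])
    then have "A.t (int (Suc i)) = A.t (int i) \<otimes> x (Suc i)"
      using A.t_diff_\<sigma>[of "Suc i"] Suc.prems by simp
    then have "\<phi> (A.t (int (Suc i))) = inv (A.t (int i)) \<otimes> (A.t (int i) \<otimes> inv (A.t (int (Suc i))))"
      using Suc \<phi>x[of "Suc i"] c A.\<sigma>_closed[of "Suc i"] by simp
    then show ?case using c by (simp add: A.m_assoc[symmetric])
  qed simp
  then have "\<forall>i\<in>{0..<int n}. \<phi> (A.t i) = inv (A.t i)"
    by (metis atLeastLessThan_iff nonneg_int_cases of_nat_less_iff)
  then show False using assms \<phi> unfolding A.achiral_def by blast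
qed

lemma ord_xy:
  assumes i: "i \<in> {1..<n}"
  shows "C.ord (xy i) = A.ord (x i) * B.ord (y i)"
proof -
  have c: "x i \<in> carrier G" "y i \<in> carrier H" "xy i \<in> carrier GH" using A.\<sigma>_closed B.\<sigma>_closed i by auto
  have "xy i [^]\<^bsub>GH\<^esub> k = \<one>\<^bsub>GH\<^esub> \<longleftrightarrow> A.ord (x i) * B.ord (y i) dvd k" for k :: nat
  proof -
    have "fst (xy i [^]\<^bsub>GH\<^esub> k) = x i [^] k" "snd (xy i [^]\<^bsub>GH\<^esub> k) = y i [^]\<^bsub>H\<^esub> k"
      using fst.hom_nat_pow[of "xy i" k] snd.hom_nat_pow[of "xy i" k] c(3) by simp_all
    then have "xy i [^]\<^bsub>GH\<^esub> k = \<one>\<^bsub>GH\<^esub> \<longleftrightarrow> A.ord (x i) dvd k \<and> B.ord (y i) dvd k"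
      using A.pow_eq_id[OF c(1)] B.pow_eq_id[OF c(2)] by (auto simp: prod_eq_iff)
    then show ?thesis using coprime_ord[OF i] by (auto intro: divides_mult dvd_mult_left dvd_mult_right)
  qed
  then show ?thesis using C.ord_unique[OF c(3)] by blast
qed

end

text \<open>An odd rank below 3 is 1. There the only prefix product is the identity, so the identity
  map is a mirror homomorphism, against chirality.\<close>

lemma chiral_rank_ge_3:
  assumes "chiral n P" "odd n"
  shows "3 \<le> n"
proof (rule ccontr)
  assume "\<not> 3 \<le> n"
  then have n: "n = 1" using assms(2) by (auto elim!: oddE)
  interpret chiral_polytope n P
    by unfold_locales (use assms n in \<open>auto simp: chiral_def\<close>)
  have "id \<in> hom Aut Aut" by (rule homI) auto
  moreover have "\<forall>i\<in>{0..<int n}. id (A.t i) = inv\<^bsub>Aut\<^esub> (A.t i)"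
  proof
    fix i assume "i \<in> {0..<int n}"
    then have "i = 0" using n by simp
    then show "id (A.t i) = inv\<^bsub>Aut\<^esub> (A.t i)" by simp
  qed
  ultimately show False using not_achiral unfolding A.achiral_def by blast
qed

lemma swap_hom: "prod.swap \<in> hom (G \<times>\<times> H) (H \<times>\<times> G)"
  by (auto simp: hom_def)

theorem theorem5p7:
  fixes P :: "'a ranked_poset" and n :: nat and p :: "nat \<Rightarrow> nat"
  assumes "finite (faces P)"
    and "chiral n P"
    and "odd n"
    and "has_type n P p"
    and "\<forall>i\<in>{1..n - 1}. gcd (p i) (p (n - i)) = 1"
    and "order (comix (n - 1) (rotation_group n P) (rotation P)
                  (rotation_group n (mirror P)) (rotation (mirror P)))
           < Lcm (p ` {1..n - 1})"
  shows "chiral n (polytope_mix n P (dual n P))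
    \<and> properly_self_dual (polytope_mix n P (dual n P))
    \<and> has_type n (polytope_mix n P (dual n P)) (\<lambda>i. p i * p (n - i))
    \<and> automorphism_group (polytope_mix n P (dual n P))
        \<cong> rotation_group n P \<times>\<times> rotation_group n (dual n P)"
proof -
  have n: "3 \<le> n" using chiral_rank_ge_3 assms(2,3) .
  have n1: "{1..n - 1} = {1..<n}" using n by auto
  interpret P: chiral_polytope n P
    by unfold_locales (use assms(2) n in \<open>auto simp: chiral_def\<close>)
  define x y where "x = rotation P" and "y = rotation (dual n P)"
  have y: "y i = inv\<^bsub>P.Aut\<^esub> (x (n - i))" if "i \<in> {1..<n}" for i
    unfolding x_def y_def using P.chiral_polytope_axioms that by (rule rotation_dual)
  interpret Y: rotation_system P.Aut n y
    by (rule P.A.rev_rotation_system) (use y in \<open>simp add: x_def\<close>)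
  have ord_y: "P.A.ord (y i) = P.A.ord (x (n - i))" if "i \<in> {1..<n}" for i
  proof -
    have "x (n - i) \<in> carrier P.Aut" using P.rotation_closed[of "n - i"] that by (auto simp: x_def)
    then show ?thesis unfolding y[OF that] by (rule P.A.ord_inv)
  qed
  have p: "p i = P.A.ord (x i)" if "i \<in> {1..<n}" for i
    using assms(4) P.L.has_type_ord[OF P.not_achiral] that by (simp add: x_def)
  interpret M: coprime_pair P.Aut P.Aut n x y
  proof -
    have "coprime (P.A.ord (x i)) (P.A.ord (y i))" if "i \<in> {1..<n}" for i
    proof -
      have "n - i \<in> {1..<n}" using that by auto
      then have "gcd (P.A.ord (x i)) (P.A.ord (x (n - i))) = 1"
        using assms(5) that p[OF that] p[of "n - i"] unfolding n1 by metis
      then show ?thesis unfolding ord_y[OF that] by (simp only: coprime_iff_gcd_eq_1)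
    qed
    then show "coprime_pair P.Aut P.Aut n x y"
      unfolding x_def by unfold_locales
  qed
  interpret Q: coset_polytope M.GH n M.xy
    by unfold_locales (rule n)
  have rot: "rotation_group n P = P.Aut" "rotation_group n (dual n P) = P.Aut"
    using P.L.rotation_group_eq[OF P.not_achiral] Y.generated
    by (simp_all add: rotation_group_def automorphism_group_dual flip: y_def)
  \<comment> \<open>Coprimality makes the diagonal pairs generate everything, so the mix is the full
    direct product.\<close>
  have "mix (n - 1) P.Aut x P.Aut y = M.GH"
    unfolding mix_def n1 M.generate_xy by simp
  then have mix: "polytope_mix n P (dual n P) = coset_poset n M.GH M.xy"
    unfolding polytope_mix_def rot by (simp flip: x_def y_def)
  have na: "\<not> M.C.achiral"
    using M.not_achiral_prod P.not_achiral by (simp add: x_def)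
  have "has_type n (coset_poset n M.GH M.xy) (\<lambda>i. p i * p (n - i))"
    unfolding Q.M.has_type_ord[OF na] using M.ord_xy p ord_y by auto
  moreover have "properly_self_dual (coset_poset n M.GH M.xy)"
  proof (rule M.C.properly_self_dual_coset_poset)
    \<comment> \<open>Since y i is the inverse of x (n - i), swapping the components of the i-th
      pair gives the inverse of the pair numbered n - i.\<close>
    show "prod.swap \<in> iso M.GH M.GH"
      by (rule isoI) (use swap_hom in \<open>auto simp: bij_betw_def\<close>)
    fix i assume i: "i \<in> {1..<n}"
    then have i': "n - i \<in> {1..<n}" "n - (n - i) = i" by auto
    have c: "x i \<in> carrier P.Aut" "x (n - i) \<in> carrier P.Aut" "y (n - i) \<in> carrier P.Aut"
      using P.rotation_closed i i' Y.\<sigma>_closed by (auto simp: x_def)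
    have "y (n - i) = inv\<^bsub>P.Aut\<^esub> (x i)" using y[OF i'(1)] i'(2) by simp
    then have "x i = inv\<^bsub>P.Aut\<^esub> (y (n - i))" using c by simp
    then show "prod.swap (M.xy i) = inv\<^bsub>M.GH\<^esub> (M.xy (n - i))"
      using y[OF i] inv_DirProd[OF P.A.is_group P.A.is_group c(2,3)] by simp
  qed
  moreover have "automorphism_group (coset_poset n M.GH M.xy) \<cong> M.GH"
    using Q.M.act_iso[OF na] M.C.iso_sym unfolding is_iso_def by blast
  ultimately show ?thesis
    unfolding mix rot using Q.M.not_achiral_chiral[OF na] by blast
qed

end
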